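(* Let $X_1$ and $X_2$ be operators, let $\mathcal D\subseteq\mathbb C^2$ be a domain containing all pairs $(\lambda_1,\lambda_2)$ with $\lambda_1\in\sigma(X_1)$, $\lambda_2\in\sigma(X_2)$, and for a bivariate analytic function $\beta$ on $\mathcal D$ let $T_\beta^{X_1,X_2}$ be the generalized double operator integral. Then the map $\beta\mapsto T_\beta^{X_1,X_2}$ is a linear homomorphism; that is, for all bivariate analytic functions $\beta_1,\beta_2,\beta,\gamma$ on $\mathcal D$ and all scalars $c_1,c_2\in\mathbb C$, $$T^{X_1,X_2}_{c_1\beta_1+c_2\beta_2}=c_1T^{X_1,X_2}_{\beta_1}+c_2T^{X_1,X_2}_{\beta_2}\qquad\text{and}\qquad T^{X_1,X_2}_{\beta\gamma}=T^{X_1,X_2}_{\beta}\circ T^{X_1,X_2}_{\gamma}.$$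
   Context: All operators act on a complex Hilbert space, with identity $I$; they need not be self-adjoint. Each parameter operator $X$ is assumed to admit a spectral decomposition $X=\int_{\sigma(X)}\lambda\,dE_X(\lambda)+\int_{\sigma(X)}(X-\lambda I)\,dE_X(\lambda)$, where $\sigma(X)$ is the spectrum and $E_X$ is a spectral measure on $\sigma(X)$ (projection-valued, projections not necessarily orthogonal) with $\int_{\sigma(X)}dE_X(\lambda)=I$ and, formally, with $\delta(\lambda,\lambda')$ the delta symbol, $dE_X(\lambda)\,dE_X(\lambda')=\delta(\lambda,\lambda')\,dE_X(\lambda)$, $dE_X(\lambda')(X-\lambda I)dE_X(\lambda)=(X-\lambda I)dE_X(\lambda)dE_X(\lambda')=\delta(\lambda,\lambda')(X-\lambda I)dE_X(\lambda)$, and $(X-\lambda I)dE_X(\lambda)\,(X-\lambda' I)dE_X(\lambda')=\delta(\lambda,\lambda')(X-\lambda I)^2dE_X(\lambda)$. For each $\lambda\in\sigma(X)$, $(X-\lambda I)dE_X(\lambda)$ is nilpotent, of order $m_\lambda\ge 1$: $[(X-\lambda I)dE_X(\lambda)]^\ell=0$ for $\ell\ge m_\lambda$. An integral $\int g(\lambda)(X-\lambda I)^q dE_X(\lambda)$ is read by expanding $(X-\lambda I)^q$ in powers of $X$ and $\lambda$. All integrals are assumed to be well defined. Generalized double operator integral (GDOI): for operators $X_1,X_2,Y$ and a bivariate analytic function $\beta$, $$T_\beta^{X_1,X_2}(Y)=\int_{\sigma(X_1)}\int_{\sigma(X_2)}\sum_{q_1=0}^{m_{\lambda_1}-1}\sum_{q_2=0}^{m_{\lambda_2}-1}\frac{\beta^{(q_1,q_2)}(\lambda_1,\lambda_2)}{q_1!\,q_2!}(X_1-\lambda_1I)^{q_1}dE_{X_1}(\lambda_1)\,Y\,(X_2-\lambda_2I)^{q_2}dE_{X_2}(\lambda_2),$$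 where $\beta^{(q_1,q_2)}$ is the partial derivative of order $q_1$ in the first and $q_2$ in the second variable, $\beta^{(0,0)}=\beta$, and $(X-\lambda I)^0=I$. The composition is $(T_\beta^{X_1,X_2}\circ T_\gamma^{X_1,X_2})(Y)=T_\beta^{X_1,X_2}\big(T_\gamma^{X_1,X_2}(Y)\big)$. *)

theory Defs
  imports "HOL-Analysis.Analysis" "HOL-Library.Disjoint_Sets"
begin

class complex_vector = real_vector +
  fixes scaleC :: "complex \<Rightarrow> 'a \<Rightarrow> 'a"  (infixr \<open>*\<^sub>C\<close> 75)
  assumes scaleC_add_right: "c *\<^sub>C (x + y) = c *\<^sub>C x + c *\<^sub>C y"
    and scaleC_add_left: "(c + d) *\<^sub>C x = c *\<^sub>C x + d *\<^sub>C x"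
    and scaleC_scaleC: "c *\<^sub>C (d *\<^sub>C x) = (c * d) *\<^sub>C x"
    and scaleC_one: "1 *\<^sub>C x = x"
    and scaleR_scaleC: "r *\<^sub>R x = complex_of_real r *\<^sub>C x"

text \<open>
  Norm, metric and topology come from \<open>real_inner\<close>; since the real inner product is
  the real part of \<open>cinner\<close>, the norm of \<open>x\<close> is the square root of \<open>cinner x x\<close>, and
  positive definiteness of \<open>cinner\<close> follows from that of \<open>inner\<close> and Hermitian symmetry.
\<close>

class complex_inner = real_inner + complex_vector +
  fixes cinner :: "'a \<Rightarrow> 'a \<Rightarrow> complex"
  assumes cinner_commute: "cinner x y = cnj (cinner y x)"
    and cinner_add_left: "cinner (x + y) z = cinner x z + cinner y z"
    and cinner_scaleC_left: "cinner (c *\<^sub>C x) y = c * cinner x y"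
    and inner_Re_cinner: "inner x y = Re (cinner x y)"

class chilbert_space = complex_inner + complete_space

instantiation complex :: chilbert_space
begin

definition scaleC_complex :: "complex \<Rightarrow> complex \<Rightarrow> complex"
  where "scaleC_complex c z = c * z"

definition cinner_complex :: "complex \<Rightarrow> complex \<Rightarrow> complex"
  where "cinner_complex x y = x * cnj y"

instance
  by standard
    (auto simp: scaleC_complex_def cinner_complex_def algebra_simps inner_complex_def
      scaleR_conv_of_real)

end

lemma scaleC_zero_right [simp]: "c *\<^sub>C (0::'a::complex_vector) = 0"
  using scaleC_add_right[of c 0 "0::'a"] by simp

lemma scaleC_minus_right: "c *\<^sub>C (- x) = - (c *\<^sub>C (x::'a::complex_vector))"
  using scaleC_add_right[of c x "- x"] by (simp add: eq_neg_iff_add_eq_0 add.commute)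

lemma scaleC_diff_right: "c *\<^sub>C (x - y) = c *\<^sub>C x - c *\<^sub>C (y::'a::complex_vector)"
  using scaleC_add_right[of c x "- y"] by (simp add: scaleC_minus_right)

lemma bounded_linear_scaleC: "bounded_linear (\<lambda>x. c *\<^sub>C (x::'a::complex_inner))"
proof (rule bounded_linear_intro)
  fix x y :: 'a and r :: real
  show "c *\<^sub>C (x + y) = c *\<^sub>C x + c *\<^sub>C y" by (rule scaleC_add_right)
  show "c *\<^sub>C (r *\<^sub>R x) = r *\<^sub>R (c *\<^sub>C x)"
    by (simp add: scaleR_scaleC scaleC_scaleC mult.commute)
  have "cinner (c *\<^sub>C x) (c *\<^sub>C x) = c * cnj c * cinner x x"
    using cinner_commute[of x "c *\<^sub>C x"] cinner_commute[of x x]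
    by (simp add: cinner_scaleC_left)
  moreover have "c * cnj c = complex_of_real ((cmod c)\<^sup>2)"
    using complex_norm_square[of c] by simp
  ultimately have "inner (c *\<^sub>C x) (c *\<^sub>C x) = (cmod c)\<^sup>2 * inner x x"
    by (simp add: inner_Re_cinner)
  then have "norm (c *\<^sub>C x) = norm x * cmod c"
    by (simp add: norm_eq_sqrt_inner real_sqrt_mult)
  then show "norm (c *\<^sub>C x) \<le> norm x * cmod c" by simp
qed

typedef (overloaded) 'a bop =
  "{f :: 'a::chilbert_space \<Rightarrow> 'a. bounded_linear f \<and> (\<forall>c x. f (c *\<^sub>C x) = c *\<^sub>C f x)}"
  morphisms app Bop
  by (rule exI[of _ "\<lambda>x. 0"]) (simp add: bounded_linear_zero)

setup_lifting type_definition_bop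

lemma bounded_linear_app: "bounded_linear (app T)"
  using app[of T] by simp

lemma app_scaleC: "app T (c *\<^sub>C x) = c *\<^sub>C app T x"
  using app[of T] by simp

lemma bop_eqI: "(\<And>x. app S x = app T x) \<Longrightarrow> S = T"
  by (simp add: app_inject[symmetric] ext)

instantiation bop :: (chilbert_space) "{complex_vector, ring, monoid_mult}"
begin

lift_definition zero_bop :: "'a bop" is "\<lambda>x. 0"
  by (simp add: bounded_linear_zero)

lift_definition one_bop :: "'a bop" is "\<lambda>x. x"
  by (simp add: bounded_linear_ident)

lift_definition plus_bop :: "'a bop \<Rightarrow> 'a bop \<Rightarrow> 'a bop" is "\<lambda>S T x. S x + T x"
  by (auto intro: bounded_linear_add simp: scaleC_add_right)

lift_definition minus_bop :: "'a bop \<Rightarrow> 'a bop \<Rightarrow> 'a bop" is "\<lambda>S T x. S x - T x"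
  by (auto intro: bounded_linear_sub simp: scaleC_diff_right)

lift_definition uminus_bop :: "'a bop \<Rightarrow> 'a bop" is "\<lambda>T x. - T x"
  by (auto intro: bounded_linear_minus simp: scaleC_minus_right)

lift_definition times_bop :: "'a bop \<Rightarrow> 'a bop \<Rightarrow> 'a bop" is "\<lambda>S T x. S (T x)"
  by (auto intro: bounded_linear_compose)

lift_definition scaleC_bop :: "complex \<Rightarrow> 'a bop \<Rightarrow> 'a bop" is "\<lambda>c T x. c *\<^sub>C T x"
  by (auto intro: bounded_linear_compose[OF bounded_linear_scaleC]
      simp: scaleC_scaleC mult.commute)

definition scaleR_bop :: "real \<Rightarrow> 'a bop \<Rightarrow> 'a bop"
  where "scaleR_bop r T = complex_of_real r *\<^sub>C T"

instance
proof
  fix S T U :: "'a bop" and a b :: real and c d :: complex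
  show "S + T + U = S + (T + U)" by transfer (simp add: add.assoc)
  show "S + T = T + S" by transfer (simp add: add.commute)
  show "0 + S = S" by transfer simp
  show "- S + S = 0" by transfer simp
  show "S - T = S + - T" by transfer simp
  show cr: "c *\<^sub>C (S + T) = c *\<^sub>C S + c *\<^sub>C T" for c and S T :: "'a bop"
    by transfer (simp add: scaleC_add_right)
  show cl: "(c + d) *\<^sub>C S = c *\<^sub>C S + d *\<^sub>C S" for c d and S :: "'a bop"
    by transfer (simp add: scaleC_add_left)
  show cc: "c *\<^sub>C (d *\<^sub>C S) = (c * d) *\<^sub>C S" for c d and S :: "'a bop"
    by transfer (simp add: scaleC_scaleC)
  show c1: "1 *\<^sub>C S = S" for S :: "'a bop" by transfer (simp add: scaleC_one)
  show "a *\<^sub>R S = complex_of_real a *\<^sub>C S" by (rule scaleR_bop_def)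
  show "a *\<^sub>R (S + T) = a *\<^sub>R S + a *\<^sub>R T" by (simp add: scaleR_bop_def cr)
  show "(a + b) *\<^sub>R S = a *\<^sub>R S + b *\<^sub>R S" by (simp add: scaleR_bop_def cl)
  show "a *\<^sub>R b *\<^sub>R S = (a * b) *\<^sub>R S" by (simp add: scaleR_bop_def cc)
  show "1 *\<^sub>R S = S" by (simp add: scaleR_bop_def c1)
  show "S * T * U = S * (T * U)" by transfer simp
  show "1 * S = S" by transfer simp
  show "S * 1 = S" by transfer simp
  show "(S + T) * U = S * U + T * U" by transfer simp
  show "S * (T + U) = S * T + S * U"
    by transfer (simp add: linear_add bounded_linear.linear)
qed

end

definition spectrum :: "'a::chilbert_space bop \<Rightarrow> complex set"
  where "spectrum X = {\<mu>. \<not> (\<exists>R. R * (X - \<mu> *\<^sub>C 1) = 1 \<and> (X - \<mu> *\<^sub>C 1) * R = 1)}"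

definition borel_subsets :: "complex set \<Rightarrow> complex set set"
  where "borel_subsets S = {A \<in> sets borel. A \<subseteq> S}"

definition spectral_measure_on :: "complex set \<Rightarrow> (complex set \<Rightarrow> 'a::chilbert_space bop) \<Rightarrow> bool"
  where "spectral_measure_on S E \<longleftrightarrow>
    E S = 1 \<and>
    (\<forall>A\<in>borel_subsets S. \<forall>B\<in>borel_subsets S. E A * E B = E (A \<inter> B)) \<and>
    (\<forall>F :: nat \<Rightarrow> complex set. range F \<subseteq> borel_subsets S \<and> disjoint_family F \<longrightarrow>
      (\<forall>x. (\<lambda>n. app (E (F n)) x) sums app (E (\<Union>n. F n)) x))"

definition borel_partition :: "complex set \<Rightarrow> complex set set \<Rightarrow> bool"
  where "borel_partition S P \<longleftrightarrow> finite P \<and> P \<subseteq> borel_subsets S \<and> partition_on S P"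

text \<open>
  Finite Borel partitions \<open>P\<close> of \<open>S\<close>, with a tag \<open>t A \<in> A\<close> in each cell, directed by
  refinement. A property holds eventually if it holds for all tagged refinements of
  some partition.
\<close>

definition tagged_partitions :: "complex set \<Rightarrow> (complex set set \<times> (complex set \<Rightarrow> complex)) filter"
  where "tagged_partitions S =
    (INF P\<in>{P. borel_partition S P}.
      principal {(Q, t). borel_partition S Q \<and> refines S Q P \<and> (\<forall>A\<in>Q. t A \<in> A)})"

lemma borel_partition_common:
  assumes "borel_partition S P" "borel_partition S Q"
  shows "\<exists>R. borel_partition S R \<and> refines S R P \<and> refines S R Q"
proof (intro exI conjI)
  let ?R = "(\<lambda>(A, B). A \<inter> B) ` (P \<times> Q) - {{}}"
  note P = assms(1)[unfolded borel_partition_def partition_on_def borel_subsets_def]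
  note Q = assms(2)[unfolded borel_partition_def partition_on_def borel_subsets_def]
  have part: "partition_on S ?R"
  proof (rule partition_onI)
    have "\<Union>?R = (\<Union>(A, B)\<in>P \<times> Q. A \<inter> B)" by auto
    also have "\<dots> = \<Union>P \<inter> \<Union>Q" by auto
    finally show "\<Union>?R = S" using P Q by simp
    fix A B assume "A \<in> ?R" "B \<in> ?R" "A \<noteq> B"
    then obtain C D C' D' where *: "A = C \<inter> D" "B = C' \<inter> D'"
      "C \<in> P" "C' \<in> P" "D \<in> Q" "D' \<in> Q" by auto
    with \<open>A \<noteq> B\<close> have "C \<noteq> C' \<or> D \<noteq> D'" by blast
    moreover have "disjoint P" "disjoint Q" using P Q by auto
    ultimately have "C \<inter> C' = {} \<or> D \<inter> D' = {}"
      using *(3-6) by (metis disjointD)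
    then show "disjnt A B" using * by (auto simp: disjnt_def)
  qed auto
  have "A \<inter> B \<in> borel_subsets S" if "A \<in> P" "B \<in> Q" for A B
    using P Q that by (auto simp: borel_subsets_def)
  moreover have "finite ?R" using P Q by simp
  ultimately show "borel_partition S ?R"
    using part by (auto simp: borel_partition_def)
  have "\<forall>C\<in>?R. \<exists>A\<in>P. C \<subseteq> A" "\<forall>C\<in>?R. \<exists>B\<in>Q. C \<subseteq> B" by auto
  then show "refines S ?R P" "refines S ?R Q"
    using part assms unfolding refines_def borel_partition_def by simp_all
qed

lemma tagged_partitions_neq_bot: "tagged_partitions S \<noteq> bot"
proof (cases "\<exists>P. borel_partition S P")
  case False
  then have "tagged_partitions S = top" by (simp add: tagged_partitions_def)
  then show ?thesis by (metis principal_eq_bot_iff top_eq_principal_UNIV UNIV_not_empty)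
next
  case True
  show ?thesis
    unfolding tagged_partitions_def
  proof (subst INF_filter_bot_base)
    fix P Q assume "P \<in> {P. borel_partition S P}" "Q \<in> {P. borel_partition S P}"
    then obtain R where R: "borel_partition S R" "refines S R P" "refines S R Q"
      using borel_partition_common by blast
    have "{(R', t). borel_partition S R' \<and> refines S R' R \<and> (\<forall>A\<in>R'. t A \<in> A)} \<subseteq>
        {(R', t). borel_partition S R' \<and> refines S R' K \<and> (\<forall>A\<in>R'. t A \<in> A)}"
      if "refines S R K" for K
      using refines_trans[OF _ that] by blast
    with R show "\<exists>R\<in>{P. borel_partition S P}.
        principal {(R', t). borel_partition S R' \<and> refines S R' R \<and> (\<forall>A\<in>R'. t A \<in> A)} \<le>
        inf (principal {(R', t). borel_partition S R' \<and> refines S R' P \<and> (\<forall>A\<in>R'. t A \<in> A)})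
            (principal {(R', t). borel_partition S R' \<and> refines S R' Q \<and> (\<forall>A\<in>R'. t A \<in> A)})"
      by (intro bexI[of _ R]) (simp_all only: le_inf_iff principal_le_iff mem_Collect_eq simp_thms)
  next
    have "principal {(Q, t). borel_partition S Q \<and> refines S Q P \<and> (\<forall>A\<in>Q. t A \<in> A)} \<noteq> bot"
      if P: "borel_partition S P" for P
    proof -
      have "refines S P P" using P by (simp add: borel_partition_def refines_refl)
      moreover have "(SOME x. x \<in> A) \<in> A" if "A \<in> P" for A
        using P that by (metis borel_partition_def partition_on_def some_in_eq)
      ultimately have "(P, \<lambda>A. SOME x. x \<in> A) \<in>
          {(Q, t). borel_partition S Q \<and> refines S Q P \<and> (\<forall>A\<in>Q. t A \<in> A)}"
        using P by simp
      then show ?thesis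
        unfolding principal_eq_bot_iff by (rule ex_in_conv[THEN iffD1, OF exI])
    qed
    then show "\<not> (\<exists>P\<in>{P. borel_partition S P}.
        principal {(Q, t). borel_partition S Q \<and> refines S Q P \<and> (\<forall>A\<in>Q. t A \<in> A)} = bot)"
      by blast
  qed
qed

text \<open>
  \<open>\<integral>\<^sub>S \<Phi>(\<mu>) dE(\<mu>)\<close> for operator-valued \<open>\<Phi>\<close>, as the limit in the strong operator topology
  of the Riemann sums \<open>\<Sum> \<Phi>(t\<^sub>A) E(A)\<close>. For \<open>\<Phi>(\<mu>) = g(\<mu>) (X - \<mu> I)\<^sup>q\<close> the power at each tag
  expands binomially in \<open>X\<close> and \<open>\<mu>\<close>, so that this is the combination of the operators
  \<open>X\<^sup>j \<integral> g(\<mu>) (- \<mu>)\<^bsup>q-j\<^esup> dE(\<mu>)\<close>.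
\<close>

definition has_spectral_integral ::
  "(complex set \<Rightarrow> 'a::chilbert_space bop) \<Rightarrow> (complex \<Rightarrow> 'a bop) \<Rightarrow> complex set \<Rightarrow> 'a bop \<Rightarrow> bool"
  where "has_spectral_integral E \<Phi> S T \<longleftrightarrow>
    (\<forall>x. ((\<lambda>(P, t). app (\<Sum>A\<in>P. \<Phi> (t A) * E A) x) \<longlongrightarrow> app T x) (tagged_partitions S))"

lemma has_spectral_integral_unique:
  "has_spectral_integral E \<Phi> S T \<Longrightarrow> has_spectral_integral E \<Phi> S T' \<Longrightarrow> T = T'"
  unfolding has_spectral_integral_def
  by (rule bop_eqI, rule tendsto_unique[OF tagged_partitions_neq_bot]) (erule spec)+

definition spectral_integral ::
  "(complex set \<Rightarrow> 'a::chilbert_space bop) \<Rightarrow> (complex \<Rightarrow> 'a bop) \<Rightarrow> complex set \<Rightarrow> 'a bop"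
  where "spectral_integral E \<Phi> S = (THE T. has_spectral_integral E \<Phi> S T)"

text \<open>
  The differential relations between \<open>dE(\<mu>)\<close> and \<open>(X - \<mu> I) dE(\<mu>)\<close> are stated in integrated
  form, for \<open>E\<close> and the set functions \<open>A \<mapsto> \<integral>\<^sub>A (X - \<mu> I)\<^sup>q dE(\<mu>)\<close> on Borel subsets of the
  spectrum, the delta symbol becoming the intersection of the two sets. Likewise the
  nilpotency of \<open>(X - \<mu> I) dE(\<mu>)\<close> with order \<open>m \<mu>\<close> is stated on every Borel set on which
  \<open>m \<le> l\<close>, since a single point of the continuous spectrum may have \<open>E {\<mu>} = 0\<close>. The
  condition \<open>l \<ge> 1\<close> matters for the empty set only.
\<close>

definition spectral_decomposition ::
  "'a::chilbert_space bop \<Rightarrow> (complex set \<Rightarrow> 'a bop) \<Rightarrow> (complex \<Rightarrow> nat) \<Rightarrow> bool"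
  where "spectral_decomposition X E m \<longleftrightarrow>
    (let \<sigma> = spectrum X; N = (\<lambda>q. spectral_integral E (\<lambda>\<mu>. (X - \<mu> *\<^sub>C 1) ^ q))
     in spectral_measure_on \<sigma> E \<and>
        X = spectral_integral E (\<lambda>\<mu>. \<mu> *\<^sub>C 1) \<sigma> + N 1 \<sigma> \<and>
        (\<forall>A\<in>borel_subsets \<sigma>. \<forall>B\<in>borel_subsets \<sigma>.
          E B * N 1 A = N 1 (A \<inter> B) \<and>
          N 1 A * E B = N 1 (A \<inter> B) \<and>
          N 1 A * N 1 B = N 2 (A \<inter> B)) \<and>
        (\<forall>\<mu>\<in>\<sigma>. m \<mu> \<ge> 1) \<and>
        (\<forall>k. {\<mu>\<in>\<sigma>. m \<mu> = k} \<in> sets borel) \<and>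
        (\<forall>l\<ge>1. \<forall>A\<in>borel_subsets \<sigma>. (\<forall>\<mu>\<in>A. m \<mu> \<le> l) \<longrightarrow> N 1 A ^ l = 0))"

definition bianalytic_on :: "(complex \<times> complex \<Rightarrow> complex) \<Rightarrow> (complex \<times> complex) set \<Rightarrow> bool"
  where "bianalytic_on \<beta> D \<longleftrightarrow>
    (\<forall>(a, b)\<in>D. \<exists>r>0. \<exists>c :: nat \<times> nat \<Rightarrow> complex. \<forall>z\<in>ball a r. \<forall>w\<in>ball b r.
      ((\<lambda>(j, k). c (j, k) * (z - a) ^ j * (w - b) ^ k) has_sum \<beta> (z, w)) UNIV)"

definition partial_deriv :: "nat \<Rightarrow> nat \<Rightarrow> (complex \<times> complex \<Rightarrow> complex) \<Rightarrow> complex \<Rightarrow> complex \<Rightarrow> complex"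
  where "partial_deriv q\<^sub>1 q\<^sub>2 \<beta> z w =
    (deriv ^^ q\<^sub>1) (\<lambda>z'. (deriv ^^ q\<^sub>2) (\<lambda>w'. \<beta> (z', w')) w) z"

text \<open>
  The double integral is the strong limit of Riemann sums over pairs of tagged partitions
  of the two spectra, the whole integrand, including the ranges \<open>q\<^sub>i < m\<^sub>i\<close> of
  the inner sums, being evaluated at the tags.
\<close>

definition gdoi_integrand ::
  "'a::chilbert_space bop \<Rightarrow> (complex set \<Rightarrow> 'a bop) \<Rightarrow> (complex \<Rightarrow> nat) \<Rightarrow>
   'a bop \<Rightarrow> (complex set \<Rightarrow> 'a bop) \<Rightarrow> (complex \<Rightarrow> nat) \<Rightarrow>
   (complex \<times> complex \<Rightarrow> complex) \<Rightarrow> 'a bop \<Rightarrow>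
   complex \<Rightarrow> complex set \<Rightarrow> complex \<Rightarrow> complex set \<Rightarrow> 'a bop"
  where "gdoi_integrand X\<^sub>1 E\<^sub>1 m\<^sub>1 X\<^sub>2 E\<^sub>2 m\<^sub>2 \<beta> Y \<mu> A \<nu> B =
    (\<Sum>q\<^sub>1<m\<^sub>1 \<mu>. \<Sum>q\<^sub>2<m\<^sub>2 \<nu>. (partial_deriv q\<^sub>1 q\<^sub>2 \<beta> \<mu> \<nu> / (fact q\<^sub>1 * fact q\<^sub>2)) *\<^sub>C
      ((X\<^sub>1 - \<mu> *\<^sub>C 1) ^ q\<^sub>1 * E\<^sub>1 A * Y * (X\<^sub>2 - \<nu> *\<^sub>C 1) ^ q\<^sub>2 * E\<^sub>2 B))"

definition has_gdoi ::
  "'a::chilbert_space bop \<Rightarrow> (complex set \<Rightarrow> 'a bop) \<Rightarrow> (complex \<Rightarrow> nat) \<Rightarrow>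
   'a bop \<Rightarrow> (complex set \<Rightarrow> 'a bop) \<Rightarrow> (complex \<Rightarrow> nat) \<Rightarrow>
   (complex \<times> complex \<Rightarrow> complex) \<Rightarrow> 'a bop \<Rightarrow> 'a bop \<Rightarrow> bool"
  where "has_gdoi X\<^sub>1 E\<^sub>1 m\<^sub>1 X\<^sub>2 E\<^sub>2 m\<^sub>2 \<beta> Y T \<longleftrightarrow>
    (\<forall>x. ((\<lambda>((P, s), (Q, t)).
        app (\<Sum>A\<in>P. \<Sum>B\<in>Q. gdoi_integrand X\<^sub>1 E\<^sub>1 m\<^sub>1 X\<^sub>2 E\<^sub>2 m\<^sub>2 \<beta> Y (s A) A (t B) B) x)
      \<longlongrightarrow> app T x) (tagged_partitions (spectrum X\<^sub>1) \<times>\<^sub>F tagged_partitions (spectrum X\<^sub>2)))"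

lemma has_gdoi_unique:
  assumes "has_gdoi X\<^sub>1 E\<^sub>1 m\<^sub>1 X\<^sub>2 E\<^sub>2 m\<^sub>2 \<beta> Y T" "has_gdoi X\<^sub>1 E\<^sub>1 m\<^sub>1 X\<^sub>2 E\<^sub>2 m\<^sub>2 \<beta> Y T'"
  shows "T = T'"
proof (rule bop_eqI)
  have "tagged_partitions (spectrum X\<^sub>1) \<times>\<^sub>F tagged_partitions (spectrum X\<^sub>2) \<noteq> bot"
    by (simp add: prod_filter_eq_bot tagged_partitions_neq_bot)
  then show "app T x = app T' x" for x
    using assms[unfolded has_gdoi_def, THEN spec, of x] by (rule tendsto_unique)
qed

definition gdoi ::
  "'a::chilbert_space bop \<Rightarrow> (complex set \<Rightarrow> 'a bop) \<Rightarrow> (complex \<Rightarrow> nat) \<Rightarrow>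
   'a bop \<Rightarrow> (complex set \<Rightarrow> 'a bop) \<Rightarrow> (complex \<Rightarrow> nat) \<Rightarrow>
   (complex \<times> complex \<Rightarrow> complex) \<Rightarrow> 'a bop \<Rightarrow> 'a bop"
  where "gdoi X\<^sub>1 E\<^sub>1 m\<^sub>1 X\<^sub>2 E\<^sub>2 m\<^sub>2 \<beta> Y = (THE T. has_gdoi X\<^sub>1 E\<^sub>1 m\<^sub>1 X\<^sub>2 E\<^sub>2 m\<^sub>2 \<beta> Y T)"

definition gdoi_well_defined ::
  "'a::chilbert_space bop \<Rightarrow> (complex set \<Rightarrow> 'a bop) \<Rightarrow> (complex \<Rightarrow> nat) \<Rightarrow>
   'a bop \<Rightarrow> (complex set \<Rightarrow> 'a bop) \<Rightarrow> (complex \<Rightarrow> nat) \<Rightarrow>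
   (complex \<times> complex \<Rightarrow> complex) \<Rightarrow> bool"
  where "gdoi_well_defined X\<^sub>1 E\<^sub>1 m\<^sub>1 X\<^sub>2 E\<^sub>2 m\<^sub>2 \<beta> \<longleftrightarrow>
    (\<forall>Y. \<exists>T. has_gdoi X\<^sub>1 E\<^sub>1 m\<^sub>1 X\<^sub>2 E\<^sub>2 m\<^sub>2 \<beta> Y T)"

end

theory Submission
  imports Defs "HOL-Complex_Analysis.Cauchy_Integral_Formula"
begin

text \<open>
  Riemann sums do not interact well with products because the double integral of a merely continuous
  function need not be bounded, so the integral is computed on small rectangles. Let \<open>A\<close>, \<open>B\<close> be Borel
  sets in the two spectra on which the orders of nilpotency are constant and which lie in balls
  around \<open>a\<close>, \<open>b\<close> where \<open>\<beta>\<close> is given by a power series with coefficients \<open>c (j, k)\<close>. The Riemann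
  sums for \<open>E\<^sub>1 A * Y * E\<^sub>2 B\<close> are series in \<open>c (j, k) *\<^sub>C (L j * Y * R k)\<close>, where \<open>L j\<close> and \<open>R k\<close> are
  one-variable Riemann sums of \<open>(z - a)\<^sup>j\<close> and \<open>(w - b)\<^sup>k\<close>. On \<open>A\<close> these equal
  \<open>\<Sum>\<^bsub>q<m\<^esub> (j choose q) U\<^bsup>j-q\<^esup> V\<^sup>q E\<^sub>1 A\<close>, with \<open>U\<close> a Riemann sum for the scalar part of \<open>X\<^sub>1 - a\<close> and \<open>V\<close>
  one for its nilpotent part; they are dominated geometrically and converge in norm to
  \<open>(X\<^sub>1 - a)\<^sup>j E\<^sub>1 A\<close>. By dominated convergence the integral is
  \<open>\<Sum> c (j, k) (X\<^sub>1 - a)\<^sup>j E\<^sub>1 A Y E\<^sub>2 B (X\<^sub>2 - b)\<^sup>k\<close>, which is multiplicative by the Cauchy product.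
  Finitely many cells as small as required cover the compact spectra (Lebesgue number), and the
  possibly unbounded orders of nilpotency are handled by \<open>\<sigma>\<close>-additivity of \<open>E\<^sub>1\<close> and \<open>E\<^sub>2\<close>.
\<close>

section \<open>The Banach algebra of bounded operators\<close>

\<comment> \<open>Multiplication is not jointly continuous for strong limits, so whatever has to be
  multiplied is made to converge in norm; hence the Banach algebra structure on \<open>bop\<close>.
  As the projections need not be orthogonal, no Pythagorean identity controls a sum of
  \<open>f B *\<^sub>C E B\<close>. The substitute is one bound for all \<open>E A\<close>, which is
  not part of the notion of spectral measure and has to be extracted from strong countable
  additivity by a uniform boundedness argument. That \<open>X\<close> commutes with \<open>E\<close>
  is likewise derived, from the relations of the nilpotent part. The passage between local and
  global rests on compressions: if \<open>T\<close> is the integral for \<open>Y\<close>, then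
  \<open>E\<^sub>1 A * T * E\<^sub>2 B\<close> is the one for
  \<open>E\<^sub>1 A * Y * E\<^sub>2 B\<close>, because fixed factors respect strong limits. Hence
  the two operators of the product formula may be compared on small rectangles, the local series
  being used twice, once for \<open>Y\<close> and once for the integral of \<gamma> at
  \<open>Y\<close>. Three nested radii occur there, \<rho> < s < r: the sets lie within \<rho>, the
  gap up to s absorbs binomial coefficients, and the gap up to r gives absolute summability.\<close>
subclass (in chilbert_space) banach ..

instantiation bop :: (chilbert_space) real_normed_algebra
begin

definition norm_bop :: "'a bop \<Rightarrow> real"
  where "norm_bop T = onorm (app T)"

definition dist_bop :: "'a bop \<Rightarrow> 'a bop \<Rightarrow> real"
  where "dist_bop S T = norm (S - T)"

definition sgn_bop :: "'a bop \<Rightarrow> 'a bop"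
  where "sgn_bop T = T /\<^sub>R norm T"

definition uniformity_bop :: "('a bop \<times> 'a bop) filter"
  where "uniformity_bop = (INF e\<in>{0 <..}. principal {(x, y). dist x y < e})"

definition open_bop :: "'a bop set \<Rightarrow> bool"
  where "open_bop U = (\<forall>x\<in>U. \<forall>\<^sub>F (x', y) in uniformity. x' = x \<longrightarrow> y \<in> U)"

lemma app_scaleR: "app (r *\<^sub>R T) = (\<lambda>x. r *\<^sub>R app T x)"
  by (simp add: scaleR_bop_def scaleC_bop.rep_eq scaleR_scaleC)

instance
proof
  fix S T U :: "'a bop" and a :: real
  show "dist S T = norm (S - T)" by (rule dist_bop_def)
  show "sgn T = T /\<^sub>R norm T" by (rule sgn_bop_def)
  show "(uniformity :: ('a bop \<times> 'a bop) filter) = (INF e\<in>{0 <..}. principal {(x, y). dist x y < e})"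
    by (rule uniformity_bop_def)
  show "open U = (\<forall>x\<in>U. \<forall>\<^sub>F (x', y) in uniformity. x' = x \<longrightarrow> y \<in> U)" for U :: "'a bop set"
    by (rule open_bop_def)
  show "norm S = 0 \<longleftrightarrow> S = 0"
    unfolding norm_bop_def onorm_eq_0[OF bounded_linear_app]
    by (auto simp: zero_bop.rep_eq intro: bop_eqI)
  show "norm (S + T) \<le> norm S + norm T"
    unfolding norm_bop_def plus_bop.rep_eq by (intro onorm_triangle bounded_linear_app)
  show "norm (a *\<^sub>R S) = \<bar>a\<bar> * norm S"
    unfolding norm_bop_def app_scaleR by (intro onorm_scaleR bounded_linear_app)
  show "a *\<^sub>R S * T = a *\<^sub>R (S * T)"
    by (rule bop_eqI) (simp add: app_scaleR times_bop.rep_eq)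
  show "S * a *\<^sub>R T = a *\<^sub>R (S * T)"
    by (rule bop_eqI)
      (simp add: app_scaleR times_bop.rep_eq linear_cmul bounded_linear.linear[OF bounded_linear_app])
  show "norm (S * T) \<le> norm S * norm T"
    using onorm_compose[OF bounded_linear_app[of S] bounded_linear_app[of T]]
    by (simp add: norm_bop_def times_bop.rep_eq o_def)
qed

end

lemma norm_app_le: "norm (app T x) \<le> norm T * norm x"
  unfolding norm_bop_def by (rule onorm[OF bounded_linear_app])

lemma norm_bop_le: "0 \<le> b \<Longrightarrow> (\<And>x. norm (app T x) \<le> b * norm x) \<Longrightarrow> norm T \<le> b"
  unfolding norm_bop_def by (rule onorm_bound)

lemma bounded_linear_app_left: "bounded_linear (\<lambda>T. app T x)"
  by (rule bounded_linear_intro[where K = "norm x"])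
    (simp_all add: plus_bop.rep_eq app_scaleR norm_app_le)

lemmas tendsto_app = bounded_linear.tendsto[OF bounded_linear_app_left]
lemmas tendsto_app_right = bounded_linear.tendsto[OF bounded_linear_app]
lemmas app_diff_right = linear_diff[OF bounded_linear.linear[OF bounded_linear_app]]
lemmas app_zero_right = linear_0[OF bounded_linear.linear[OF bounded_linear_app]]
lemmas app_diff = linear_diff[OF bounded_linear.linear[OF bounded_linear_app_left]]

text \<open>Limits exist pointwise. The Cauchy estimate passes to the pointwise limit with a
  constant independent of the vector, which yields both the boundedness of the limit and convergence
  in norm.\<close>

instance bop :: (chilbert_space) banach
proof
  fix T :: "nat \<Rightarrow> 'a bop"
  assume T: "Cauchy T"
  have c: "Cauchy (\<lambda>n. app (T n) x)" for x
    using T by (rule bounded_linear.Cauchy[OF bounded_linear_app_left])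
  define f where "f x = lim (\<lambda>n. app (T n) x)" for x
  have f: "(\<lambda>n. app (T n) x) \<longlonglongrightarrow> f x" for x
    unfolding f_def using c[of x] Cauchy_convergent convergent_LIMSEQ_iff by blast
  have close: "\<exists>N. \<forall>n\<ge>N. \<forall>x. norm (app (T n) x - f x) \<le> e * norm x" if e: "e > 0" for e
  proof -
    obtain N where N: "\<And>m n. m \<ge> N \<Longrightarrow> n \<ge> N \<Longrightarrow> norm (T n - T m) < e"
      using CauchyD[OF T e] by blast
    have "norm (app (T n) x - f x) \<le> e * norm x" if n: "n \<ge> N" for n x
    proof (rule tendsto_le[OF trivial_limit_sequentially tendsto_const])
      show "(\<lambda>m. norm (app (T n) x - app (T m) x)) \<longlonglongrightarrow> norm (app (T n) x - f x)"
        by (intro tendsto_intros f)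
      have "norm (app (T n) x - app (T m) x) \<le> e * norm x" if "m \<ge> N" for m
        using norm_app_le[of "T n - T m" x] N[OF that n]
        by (simp add: app_diff) (meson mult_right_mono norm_ge_zero less_imp_le order_trans)
      then show "\<forall>\<^sub>F m in sequentially. norm (app (T n) x - app (T m) x) \<le> e * norm x"
        unfolding eventually_sequentially by blast
    qed
    then show ?thesis by blast
  qed
  have add: "f (x + y) = f x + f y" for x y
    using tendsto_add[OF f[of x] f[of y]] f[of "x + y"]
    by (auto simp: linear_add[OF bounded_linear.linear[OF bounded_linear_app]] intro: LIMSEQ_unique)
  have scC: "f (c *\<^sub>C x) = c *\<^sub>C f x" for c x
    using bounded_linear.tendsto[OF bounded_linear_scaleC f[of x], of c] f[of "c *\<^sub>C x"]
    by (auto simp: app_scaleC intro: LIMSEQ_unique)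
  have bl: "bounded_linear f"
  proof -
    obtain N where N: "\<And>x. norm (app (T N) x - f x) \<le> 1 * norm x"
      using close[of 1] by auto
    show ?thesis
    proof (rule bounded_linear_intro)
      show "f (r *\<^sub>R x) = r *\<^sub>R f x" for r x by (simp add: scaleR_scaleC scC)
      show "norm (f x) \<le> norm x * (1 + norm (T N))" for x
      proof -
        have "norm (f x) \<le> norm (app (T N) x) + norm (app (T N) x - f x)"
          by (metis add.commute diff_add_cancel norm_minus_commute norm_triangle_ineq)
        then show ?thesis
          using N[of x] norm_app_le[of "T N" x] by (simp add: algebra_simps)
      qed
    qed (rule add)
  qed
  define L where "L = Bop f"
  have L: "app L = f" unfolding L_def by (rule Bop_inverse) (simp add: bl scC)
  have "T \<longlonglongrightarrow> L"
  proof (rule LIMSEQ_I)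
    fix r :: real assume r: "0 < r"
    then obtain N where N: "\<And>n x. n \<ge> N \<Longrightarrow> norm (app (T n) x - f x) \<le> (r/2) * norm x"
      using close[of "r/2"] by auto
    have "norm (T n - L) \<le> r/2" if "n \<ge> N" for n
      using r N[OF that] by (intro norm_bop_le) (auto simp: app_diff L)
    then show "\<exists>N. \<forall>n\<ge>N. norm (T n - L) < r" using r by (metis field_sum_of_halves less_add_same_cancel1 order_le_less_trans half_gt_zero)
  qed
  then show "convergent T" by (auto simp: convergent_def)
qed

lemma norm_scaleC_vec: "norm (c *\<^sub>C (x::'a::complex_inner)) = cmod c * norm x"
proof -
  have "cinner (c *\<^sub>C x) (c *\<^sub>C x) = c * cnj c * cinner x x"
    using cinner_commute[of x "c *\<^sub>C x"] cinner_commute[of x x]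
    by (simp add: cinner_scaleC_left)
  moreover have "c * cnj c = complex_of_real ((cmod c)\<^sup>2)"
    using complex_norm_square[of c] by simp
  ultimately have "inner (c *\<^sub>C x) (c *\<^sub>C x) = (cmod c)\<^sup>2 * inner x x"
    by (simp add: inner_Re_cinner)
  then show ?thesis by (simp add: norm_eq_sqrt_inner real_sqrt_mult)
qed

lemma norm_scaleC: "norm (c *\<^sub>C (T::'a::chilbert_space bop)) \<le> cmod c * norm T"
  by (rule norm_bop_le)
    (auto simp: scaleC_bop.rep_eq norm_scaleC_vec norm_app_le mult.assoc intro: mult_left_mono)

lemma scaleC_mult_left: "(c *\<^sub>C S) * T = c *\<^sub>C (S * (T::'a::chilbert_space bop))"
  by transfer simp

lemma scaleC_mult_right: "S * (c *\<^sub>C T) = c *\<^sub>C (S * (T::'a::chilbert_space bop))"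
  by transfer simp

lemma scaleC_zero_left [simp]: "0 *\<^sub>C (x::'a::complex_vector) = 0"
  using scaleC_add_left[of 0 0 x] by simp

lemma scaleC_minus_left: "(- c) *\<^sub>C x = - (c *\<^sub>C (x::'a::complex_vector))"
  using scaleC_add_left[of c "- c" x] by (simp add: eq_neg_iff_add_eq_0 add.commute)

lemma scaleC_diff_left: "(c - d) *\<^sub>C x = c *\<^sub>C x - d *\<^sub>C (x::'a::complex_vector)"
  using scaleC_add_left[of c "- d" x] by (simp add: scaleC_minus_left)

lemma scaleC_sum_right: "c *\<^sub>C (\<Sum>i\<in>I. f i) = (\<Sum>i\<in>I. c *\<^sub>C (f i :: 'a::complex_vector))"
  by (induction I rule: infinite_finite_induct) (simp_all add: scaleC_add_right)

lemma scaleC_sum_left: "(\<Sum>i\<in>I. f i) *\<^sub>C x = (\<Sum>i\<in>I. f i *\<^sub>C (x :: 'a::complex_vector))"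
  by (induction I rule: infinite_finite_induct) (simp_all add: scaleC_add_left)

lemma bounded_linear_scaleC_left: "bounded_linear (\<lambda>c. c *\<^sub>C (T::'a::chilbert_space bop))"
  by (rule bounded_linear_intro[where K = "norm T"])
    (simp_all add: scaleC_add_left scaleR_bop_def scaleC_scaleC norm_scaleC scaleR_conv_of_real)

lemma bounded_linear_scaleC_right: "bounded_linear (\<lambda>T::'a::chilbert_space bop. c *\<^sub>C T)"
  using norm_scaleC[of c]
  by (intro bounded_linear_intro[where K = "cmod c"])
    (simp_all add: scaleC_add_right scaleR_scaleC scaleC_scaleC mult.commute)

text \<open>The unit of \<open>bop\<close> has norm \<open>0\<close> on the trivial space, so the algebra is not unital as a
  normed algebra and \<open>norm_power_ineq\<close> does not apply.\<close>

lemma norm_power_bop: "norm ((T::'a::chilbert_space bop) ^ n) \<le> norm T ^ n"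
proof (induction n)
  case 0
  show ?case by (rule norm_bop_le) (simp_all add: one_bop.rep_eq)
next
  case (Suc n)
  have "norm (T ^ Suc n) \<le> norm T * norm (T ^ n)" by (simp add: norm_mult_ineq)
  also have "\<dots> \<le> norm T * norm T ^ n" by (intro mult_left_mono Suc) simp
  finally show ?case by simp
qed

section \<open>Neumann series and compactness of the spectrum\<close>

lemma neumann_series:
  fixes T :: "'a::chilbert_space bop"
  assumes "norm T < 1"
  shows "\<exists>R. R * (1 - T) = 1 \<and> (1 - T) * R = 1"
proof -
  have sm: "summable (\<lambda>n. T ^ n)"
    by (rule summable_comparison_test'[where g = "\<lambda>n. norm T ^ n" and N = 0])
      (use assms norm_power_bop in \<open>auto intro: summable_geometric\<close>)
  define R where "R = (\<Sum>n. T ^ n)"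
  have R: "R = 1 + (\<Sum>n. T ^ Suc n)"
    unfolding R_def using suminf_split_head[OF sm] by simp
  have "(\<Sum>n. T ^ Suc n) = T * R"
    unfolding R_def using suminf_mult[OF sm, of T] by simp
  moreover have "(\<Sum>n. T ^ Suc n) = R * T"
    unfolding R_def using suminf_mult2[OF sm, of T] by (simp add: power_commutes)
  ultimately show ?thesis
    using R by (intro exI[of _ R]) (simp add: algebra_simps)
qed

lemma spectrum_bounded:
  fixes X :: "'a::chilbert_space bop"
  shows "spectrum X \<subseteq> cball 0 (norm X)"
proof
  fix \<mu> assume \<mu>: "\<mu> \<in> spectrum X"
  show "\<mu> \<in> cball 0 (norm X)"
  proof (rule ccontr)
    assume "\<mu> \<notin> cball 0 (norm X)"
    then have less: "norm X < cmod \<mu>" by simp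
    then have nz: "\<mu> \<noteq> 0" using norm_ge_zero[of X] by auto
    have "norm (inverse \<mu> *\<^sub>C X) \<le> cmod (inverse \<mu>) * norm X" by (rule norm_scaleC)
    also have "\<dots> < 1" using less nz by (simp add: norm_inverse divide_less_eq flip: divide_inverse_commute)
    finally obtain R where R: "R * (1 - inverse \<mu> *\<^sub>C X) = 1" "(1 - inverse \<mu> *\<^sub>C X) * R = 1"
      using neumann_series by blast
    have eq: "X - \<mu> *\<^sub>C 1 = (- \<mu>) *\<^sub>C (1 - inverse \<mu> *\<^sub>C X)"
      using nz by (simp add: scaleC_minus_left scaleC_diff_right scaleC_scaleC scaleC_one)
    have "((- inverse \<mu>) *\<^sub>C R) * (X - \<mu> *\<^sub>C 1) = 1" "(X - \<mu> *\<^sub>C 1) * ((- inverse \<mu>) *\<^sub>C R) = 1"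
      unfolding eq using nz R by (simp_all add: scaleC_mult_left scaleC_mult_right scaleC_scaleC scaleC_one)
    then show False using \<mu> by (auto simp: spectrum_def)
  qed
qed

lemma closed_spectrum:
  fixes X :: "'a::chilbert_space bop"
  shows "closed (spectrum X)"
proof -
  have "open (- spectrum X)"
    unfolding open_dist
  proof
    fix \<mu> assume "\<mu> \<in> - spectrum X"
    then obtain R where R: "R * (X - \<mu> *\<^sub>C 1) = 1" "(X - \<mu> *\<^sub>C 1) * R = 1"
      by (auto simp: spectrum_def)
    \<comment> \<open>With the resolvent \<open>R\<close> at \<mu>, the operator at \<nu> is the one
      at \<mu> times \<open>1 - (\<nu> - \<mu>) *\<^sub>C R\<close>, and the Neumann series inverts
      this factor. The added 1 in the radius covers \<open>norm R = 0\<close>.\<close>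
    show "\<exists>e>0. \<forall>\<nu>. dist \<nu> \<mu> < e \<longrightarrow> \<nu> \<in> - spectrum X"
    proof (intro exI[of _ "1 / (norm R + 1)"] conjI allI impI)
      show "0 < 1 / (norm R + 1)" by (simp add: add_nonneg_pos)
      fix \<nu> assume d: "dist \<nu> \<mu> < 1 / (norm R + 1)"
      have "norm ((\<nu> - \<mu>) *\<^sub>C R) \<le> dist \<nu> \<mu> * norm R"
        using norm_scaleC[of "\<nu> - \<mu>" R] by (simp add: dist_norm)
      also have "\<dots> \<le> (1 / (norm R + 1)) * norm R"
        using d by (intro mult_right_mono) auto
      also have "\<dots> < 1" by (simp add: divide_less_eq add_nonneg_pos)
      finally obtain K where K: "K * (1 - (\<nu> - \<mu>) *\<^sub>C R) = 1" "(1 - (\<nu> - \<mu>) *\<^sub>C R) * K = 1"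
        using neumann_series by blast
      have dec: "X - \<nu> *\<^sub>C 1 = (X - \<mu> *\<^sub>C 1) - (\<nu> - \<mu>) *\<^sub>C 1"
        by (simp add: scaleC_diff_left)
      have e1: "X - \<nu> *\<^sub>C 1 = (1 - (\<nu> - \<mu>) *\<^sub>C R) * (X - \<mu> *\<^sub>C 1)"
        unfolding left_diff_distrib scaleC_mult_left R(1) dec by simp
      have e2: "X - \<nu> *\<^sub>C 1 = (X - \<mu> *\<^sub>C 1) * (1 - (\<nu> - \<mu>) *\<^sub>C R)"
        unfolding right_diff_distrib scaleC_mult_right R(2) dec by simp
      have "R * (X - \<nu> *\<^sub>C 1) = 1 - (\<nu> - \<mu>) *\<^sub>C R"
        unfolding e2 mult.assoc[symmetric] R(1) by simp
      then have "(K * R) * (X - \<nu> *\<^sub>C 1) = 1" using K(1) by (simp add: mult.assoc)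
      moreover have "(X - \<nu> *\<^sub>C 1) * R = 1 - (\<nu> - \<mu>) *\<^sub>C R"
        unfolding e1 mult.assoc R(2) by simp
      then have r: "(X - \<nu> *\<^sub>C 1) * (R * K) = 1" using K(2) by (simp add: mult.assoc[symmetric])
      ultimately have "K * R = R * K" by (metis mult.assoc mult.left_neutral mult.right_neutral)
      with r \<open>(K * R) * (X - \<nu> *\<^sub>C 1) = 1\<close> show "\<nu> \<in> - spectrum X"
        by (auto simp: spectrum_def)
    qed
  qed
  then show ?thesis by (simp add: open_closed)
qed

lemma compact_spectrum: "compact (spectrum (X::'a::chilbert_space bop))"
  using spectrum_bounded[of X] closed_spectrum[of X]
  by (metis bounded_cball bounded_subset compact_eq_bounded_closed)

section \<open>Spectral measures\<close>

text \<open>The vector is affine in each \<open>f i\<close> and the norm is convex, so the norm is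
  largest at a vertex of the cube, that is, at the indicator of some \<open>J\<close>. The offset
  \<open>w\<close> carries the coordinates that the induction has already moved to a vertex.\<close>

lemma norm_sum_convex_le:
  fixes v :: "'i \<Rightarrow> 'b::real_normed_vector"
  assumes "finite I" "\<And>i. i \<in> I \<Longrightarrow> 0 \<le> f i \<and> f i \<le> 1"
    and "\<And>J. J \<subseteq> I \<Longrightarrow> norm (w + sum v J) \<le> M"
  shows "norm (w + (\<Sum>i\<in>I. f i *\<^sub>R v i)) \<le> M"
  using assms
proof (induction I arbitrary: w rule: finite_induct)
  case (insert i I)
  have le0: "norm (w + (\<Sum>i\<in>I. f i *\<^sub>R v i)) \<le> M"
    using insert.prems by (intro insert.IH) auto
  have le1: "norm ((w + v i) + (\<Sum>i\<in>I. f i *\<^sub>R v i)) \<le> M"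
  proof (rule insert.IH)
    fix J assume "J \<subseteq> I"
    then show "norm ((w + v i) + sum v J) \<le> M"
      using insert.prems(2)[of "insert i J"] insert.hyps finite_subset[of J I]
      by (cases "i \<in> J") (auto simp: add.assoc sum.insert_if)
  qed (use insert.prems in auto)
  have f: "0 \<le> f i" "f i \<le> 1" using insert.prems by auto
  have "w + (\<Sum>i\<in>insert i I. f i *\<^sub>R v i) =
      (1 - f i) *\<^sub>R (w + (\<Sum>i\<in>I. f i *\<^sub>R v i)) + f i *\<^sub>R ((w + v i) + (\<Sum>i\<in>I. f i *\<^sub>R v i))"
    using insert.hyps by (simp add: algebra_simps)
  also have "norm \<dots> \<le> (1 - f i) * M + f i * M"
    by (intro order_trans[OF norm_triangle_ineq] add_mono) (use f le0 le1 in \<open>auto intro!: mult_left_mono\<close>)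
  finally show ?case by (simp add: algebra_simps)
qed simp

lemma norm_sum_scaleR_le:
  fixes v :: "'i \<Rightarrow> 'b::real_normed_vector"
  assumes fin: "finite I" and f: "\<And>i. i \<in> I \<Longrightarrow> \<bar>f i\<bar> \<le> c" and c: "0 \<le> c"
    and M: "\<And>J. J \<subseteq> I \<Longrightarrow> norm (sum v J) \<le> M"
  shows "norm (\<Sum>i\<in>I. f i *\<^sub>R v i) \<le> 2 * c * M"
proof (cases "c = 0")
  case True
  then show ?thesis using f by simp
next
  case False
  have half: "norm (\<Sum>i\<in>I. max 0 (g i) *\<^sub>R v i) \<le> c * M" if g: "\<And>i. i \<in> I \<Longrightarrow> \<bar>g i\<bar> \<le> c" for g
  proof -
    have bd: "0 \<le> max 0 (g i) / c \<and> max 0 (g i) / c \<le> 1" if "i \<in> I" for i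
      using g[OF that] False c by (auto simp: divide_le_eq)
    have "norm (0 + (\<Sum>i\<in>I. (max 0 (g i) / c) *\<^sub>R v i)) \<le> M"
      by (rule norm_sum_convex_le[OF fin bd]) (auto simp: M)
    then have "c * norm (\<Sum>i\<in>I. (max 0 (g i) / c) *\<^sub>R v i) \<le> c * M"
      using c by (simp add: mult_left_mono)
    moreover have "(\<Sum>i\<in>I. max 0 (g i) *\<^sub>R v i) = c *\<^sub>R (\<Sum>i\<in>I. (max 0 (g i) / c) *\<^sub>R v i)"
      using False by (simp add: scaleR_sum_right)
    ultimately show ?thesis using c by simp
  qed
  have "f i *\<^sub>R v i = max 0 (f i) *\<^sub>R v i - max 0 (- f i) *\<^sub>R v i" for i
    by (simp add: max_def flip: scaleR_left_diff_distrib)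
  then have "(\<Sum>i\<in>I. f i *\<^sub>R v i) =
      (\<Sum>i\<in>I. max 0 (f i) *\<^sub>R v i) - (\<Sum>i\<in>I. max 0 (- f i) *\<^sub>R v i)"
    by (simp add: sum_subtractf)
  also have "norm \<dots> \<le> c * M + c * M"
    by (intro order_trans[OF norm_triangle_ineq4] add_mono half) (use f in auto)
  finally show ?thesis by (simp add: mult_ac)
qed

text \<open>The factor 4 counts the positive and negative parts of the real and imaginary parts of
  \<open>f\<close>. In the applications \<open>V\<close> consists of values of \<open>E\<close> on
  disjoint sets, so that the sums over \<open>J\<close> are values of \<open>E\<close> on unions and
  share one bound.\<close>

lemma norm_sum_scaleC_le:
  fixes V :: "'i \<Rightarrow> 'a::chilbert_space bop"
  assumes fin: "finite I" and f: "\<And>i. i \<in> I \<Longrightarrow> cmod (f i) \<le> c" and c: "0 \<le> c"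
    and M: "\<And>J. J \<subseteq> I \<Longrightarrow> norm (sum V J) \<le> M"
  shows "norm (\<Sum>i\<in>I. f i *\<^sub>C V i) \<le> 4 * c * M"
proof -
  have "f i *\<^sub>C V i = Re (f i) *\<^sub>R V i + \<i> *\<^sub>C (Im (f i) *\<^sub>R V i)" for i
    by (simp add: scaleR_bop_def scaleC_scaleC flip: scaleC_add_left complex_eq)
  then have "(\<Sum>i\<in>I. f i *\<^sub>C V i) = (\<Sum>i\<in>I. Re (f i) *\<^sub>R V i) + \<i> *\<^sub>C (\<Sum>i\<in>I. Im (f i) *\<^sub>R V i)"
    by (simp add: sum.distrib scaleC_sum_right)
  also have "norm \<dots> \<le> 2 * c * M + cmod \<i> * (2 * c * M)"
  proof (intro order_trans[OF norm_triangle_ineq] add_mono)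
    show "norm (\<Sum>i\<in>I. Re (f i) *\<^sub>R V i) \<le> 2 * c * M"
      by (rule norm_sum_scaleR_le[OF fin _ c M]) (use f abs_Re_le_cmod order_trans in blast)
    have "norm (\<Sum>i\<in>I. Im (f i) *\<^sub>R V i) \<le> 2 * c * M"
      by (rule norm_sum_scaleR_le[OF fin _ c M]) (use f abs_Im_le_cmod order_trans in blast)
    then show "norm (\<i> *\<^sub>C (\<Sum>i\<in>I. Im (f i) *\<^sub>R V i)) \<le> cmod \<i> * (2 * c * M)"
      using norm_scaleC[of \<i> "\<Sum>i\<in>I. Im (f i) *\<^sub>R V i"] by simp
  qed
  finally show ?thesis by (simp add: mult_ac)
qed

text \<open>The basis of Sokal's proof of the uniform boundedness principle: near any point there is one on
  which \<open>T\<close> is at least as large as on a centred ball of the same radius.\<close>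

lemma gliding_step:
  fixes T :: "'a::chilbert_space bop"
  assumes r: "0 < r" and t: "0 \<le> t" "t < norm T"
  shows "\<exists>y. norm (y - x) \<le> r \<and> t * r \<le> norm (app T y)"
proof -
  obtain u where u: "norm (app T u) > t * norm u"
    using norm_bop_le[OF t(1), of T] t(2) by (meson not_less)
  then have nz: "norm u > 0" using app_zero_right[of T] by (cases "u = 0") auto
  define v where "v = (r / norm u) *\<^sub>R u"
  have nv: "norm v = r" using nz r by (simp add: v_def)
  have "app T v = (r / norm u) *\<^sub>R app T u"
    by (simp add: v_def linear_cmul[OF bounded_linear.linear[OF bounded_linear_app]])
  then have "norm (app T v) = (r / norm u) * norm (app T u)" using r by simp
  moreover have "(r / norm u) * norm (app T u) \<ge> (r / norm u) * (t * norm u)"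
    using u r nz by (intro mult_left_mono) auto
  ultimately have tv: "t * r \<le> norm (app T v)" using nz by (simp add: mult.commute)
  \<comment> \<open>The centre cancels in the difference, so at least one of the antipodal points
    \<open>x + v\<close> and \<open>x - v\<close> is mapped as far out as \<open>v\<close>.\<close>
  have "2 *\<^sub>R app T v = app T (x + v) - app T (x - v)"
    by (simp add: app_diff_right linear_add[OF bounded_linear.linear[OF bounded_linear_app]] scaleR_2)
  then have "2 * norm (app T v) \<le> norm (app T (x + v)) + norm (app T (x - v))"
    by (metis abs_numeral norm_scaleR norm_triangle_ineq4)
  then have "norm (app T v) \<le> norm (app T (x + v)) \<or> norm (app T v) \<le> norm (app T (x - v))"
    by linarith
  then show ?thesis
  proof
    assume "norm (app T v) \<le> norm (app T (x + v))"
    then show ?thesis using tv nv by (intro exI[of _ "x + v"]) auto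
  next
    assume "norm (app T v) \<le> norm (app T (x - v))"
    then show ?thesis using tv nv by (intro exI[of _ "x - v"]) auto
  qed
qed

text \<open>Steps of length at most 1/3^n lead to a limit \<open>x\<close> whose distance from the
  (n+1)-st point is at most half of 1/3^n. Of the fraction 2/3 of \<open>norm (T n)\<close> times
  1/3^n gained at that point, passing to \<open>x\<close> loses at most 1/2, so 1/6 remains, and
  growth like 4^n outweighs the factor 1/3^n.\<close>

lemma unbounded_operators_not_null:
  fixes T :: "nat \<Rightarrow> 'a::chilbert_space bop"
  assumes T: "\<And>n. 4 ^ n < norm (T n)"
  shows "\<exists>x. \<not> (\<lambda>n. app (T n) x) \<longlonglongrightarrow> 0"
proof -
  have pos: "0 < norm (T n)" for n using T[of n] by (metis zero_less_numeral zero_less_power order.strict_trans)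
  have "\<exists>y. norm (y - x) \<le> (1/3) ^ n \<and> (2/3 * norm (T n)) * (1/3) ^ n \<le> norm (app (T n) y)" for n x
    using pos[of n] by (intro gliding_step) auto
  then have "\<exists>g. \<forall>n x. norm (g n x - x) \<le> (1/3) ^ n \<and>
      (2/3 * norm (T n)) * (1/3) ^ n \<le> norm (app (T n) (g n x))" by (intro choice allI)
  then obtain g where g: "\<And>n x. norm (g n x - x) \<le> (1/3) ^ n"
    "\<And>n x. (2/3 * norm (T n)) * (1/3) ^ n \<le> norm (app (T n) (g n x))" by blast
  define X where "X = rec_nat 0 g"
  have X: "X (Suc n) = g n (X n)" for n by (simp add: X_def)
  define d where "d n = X (Suc n) - X n" for n
  have d: "norm (d n) \<le> (1/3) ^ n" for n by (simp add: d_def X g)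
  have smd: "summable d"
    by (rule summable_comparison_test'[where g = "\<lambda>n. (1/3) ^ n" and N = 0]) (use d in auto)
  define x where "x = X 0 + (\<Sum>n. d n)"
  have part: "X n = X 0 + (\<Sum>k<n. d k)" for n
    by (simp add: d_def sum_lessThan_telescope)
  have tail: "norm (x - X (Suc n)) \<le> (1/3) ^ n / 2" for n
  proof -
    have "x - X (Suc n) = (\<Sum>k. d (k + Suc n))"
      unfolding x_def part[of "Suc n"] using suminf_minus_initial_segment[OF smd, of "Suc n"] by simp
    also have "norm \<dots> \<le> (\<Sum>k. (1/3) ^ Suc n * (1/3::real) ^ k)"
    proof (rule norm_suminf_le)
      show "norm (d (k + Suc n)) \<le> (1/3) ^ Suc n * (1/3) ^ k" for k
        using d[of "k + Suc n"] by (simp add: power_add mult_ac)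
      show "summable (\<lambda>k. (1/3) ^ Suc n * (1/3::real) ^ k)"
        by (intro summable_mult summable_geometric) simp
    qed
    also have "\<dots> = (1/3) ^ Suc n * (1 / (1 - 1/3))"
      by (subst suminf_mult) (auto simp: suminf_geometric)
    finally show ?thesis by simp
  qed
  have big: "1/6 \<le> norm (app (T n) x)" for n
  proof -
    have "norm (app (T n) (X (Suc n) - x)) \<le> norm (T n) * ((1/3) ^ n / 2)"
      using tail[of n] by (intro order_trans[OF norm_app_le] mult_left_mono)
        (auto simp: norm_minus_commute)
    moreover have "norm (app (T n) (X (Suc n))) \<le> norm (app (T n) x) + norm (app (T n) (X (Suc n) - x))"
      by (metis add.commute app_diff_right diff_add_cancel norm_triangle_ineq)
    moreover have "2/3 * (norm (T n) * (1/3) ^ n) \<le> norm (app (T n) (X (Suc n)))"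
      using g(2)[of n "X n"] by (simp add: X)
    ultimately have "1/6 * (norm (T n) * (1/3) ^ n) \<le> norm (app (T n) x)" by simp
    moreover have "1 \<le> norm (T n) * (1/3) ^ n"
    proof -
      have "(4::real) ^ n * (1/3) ^ n \<le> norm (T n) * (1/3) ^ n"
        using T[of n] by (intro mult_right_mono) auto
      moreover have "(1::real) \<le> 4 ^ n * (1/3) ^ n"
        by (simp add: one_le_power flip: power_mult_distrib)
      ultimately show ?thesis by linarith
    qed
    ultimately show ?thesis by linarith
  qed
  have "\<not> (\<lambda>n. app (T n) x) \<longlonglongrightarrow> 0"
  proof
    assume "(\<lambda>n. app (T n) x) \<longlonglongrightarrow> 0"
    from LIMSEQ_D[OF this, of "1/6"] obtain N where "norm (app (T N) x) < 1/6" by auto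
    with big[of N] show False by simp
  qed
  then show ?thesis by blast
qed

section \<open>Additivity and boundedness of spectral measures\<close>

lemma borel_subsets_Int: "A \<in> borel_subsets S \<Longrightarrow> B \<in> borel_subsets S \<Longrightarrow> A \<inter> B \<in> borel_subsets S"
  and borel_subsets_Diff: "A \<in> borel_subsets S \<Longrightarrow> B \<in> borel_subsets S \<Longrightarrow> A - B \<in> borel_subsets S"
  and borel_subsets_empty: "{} \<in> borel_subsets S"
  by (auto simp: borel_subsets_def)

lemma borel_subsets_UN:
  "finite J \<Longrightarrow> (\<And>j. j \<in> J \<Longrightarrow> F j \<in> borel_subsets S) \<Longrightarrow> (\<Union>j\<in>J. F j) \<in> borel_subsets S"
  by (auto simp: borel_subsets_def)

lemma borel_subsets_trans: "A \<in> borel_subsets S \<Longrightarrow> B \<in> borel_subsets A \<Longrightarrow> B \<in> borel_subsets S"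
  by (auto simp: borel_subsets_def)

locale spectral_measure =
  fixes S :: "complex set" and E :: "complex set \<Rightarrow> 'a::chilbert_space bop"
  assumes measure: "spectral_measure_on S E"
    and borel [simp]: "S \<in> borel_subsets S"
begin

lemma whole: "E S = 1"
  using measure by (simp add: spectral_measure_on_def)

lemma mult: "A \<in> borel_subsets S \<Longrightarrow> B \<in> borel_subsets S \<Longrightarrow> E A * E B = E (A \<inter> B)"
  using measure by (simp add: spectral_measure_on_def)

lemma sums:
  fixes F :: "nat \<Rightarrow> complex set"
  assumes "\<And>n. F n \<in> borel_subsets S" "disjoint_family F"
  shows "(\<lambda>n. app (E (F n)) x) sums app (E (\<Union>n. F n)) x"
proof -
  have "range F \<subseteq> borel_subsets S" using assms(1) by auto
  then show ?thesis using measure assms(2) unfolding spectral_measure_on_def by blast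
qed

text \<open>The constant sequence of empty sets is disjoint, and a series of equal terms converges
  only if the term is 0.\<close>

lemma empty [simp]: "E {} = 0"
proof (rule bop_eqI)
  fix x
  have "(\<lambda>n. app (E {}) x) sums app (E (\<Union>n::nat. {})) x"
    by (rule sums) (auto simp: borel_subsets_empty disjoint_family_on_def)
  then have "(\<lambda>n::nat. app (E {}) x) \<longlonglongrightarrow> 0" by (meson sums_summable summable_LIMSEQ_zero)
  then show "app (E {}) x = app 0 x" by (simp add: LIMSEQ_const_iff zero_bop.rep_eq)
qed

lemma Un:
  assumes A: "A \<in> borel_subsets S" and B: "B \<in> borel_subsets S" and disj: "A \<inter> B = {}"
  shows "E (A \<union> B) = E A + E B"
proof (rule bop_eqI)
  fix x
  define F where "F n = (if n = 0 then A else if n = 1 then B else {})" for n :: nat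
  have U: "(\<Union>n. F n) = A \<union> B"
    unfolding F_def by (auto split: if_splits)
  have "(\<lambda>n. app (E (F n)) x) sums app (E (\<Union>n. F n)) x"
    using A B disj by (intro sums) (auto simp: F_def borel_subsets_empty disjoint_family_on_def)
  moreover have "(\<lambda>n. app (E (F n)) x) sums (\<Sum>n\<in>{0,1}. app (E (F n)) x)"
    by (rule sums_finite) (auto simp: F_def zero_bop.rep_eq)
  ultimately show "app (E (A \<union> B)) x = app (E A + E B) x"
    unfolding U by (auto simp: F_def plus_bop.rep_eq dest: sums_unique2)
qed

lemma UN:
  assumes "finite J" "\<And>j. j \<in> J \<Longrightarrow> F j \<in> borel_subsets S" "disjoint_family_on F J"
  shows "E (\<Union>j\<in>J. F j) = (\<Sum>j\<in>J. E (F j))"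
  using assms
proof (induction J rule: finite_induct)
  case (insert j J)
  have "E (\<Union>j\<in>insert j J. F j) = E (F j \<union> (\<Union>j\<in>J. F j))" by simp
  also have "\<dots> = E (F j) + E (\<Union>j\<in>J. F j)"
  proof (intro Un borel_subsets_UN)
    show "F j \<inter> (\<Union>j\<in>J. F j) = {}"
      using insert.hyps insert.prems(2) unfolding disjoint_family_on_def by fastforce
  qed (use insert.hyps insert.prems in auto)
  also have "E (\<Union>j\<in>J. F j) = (\<Sum>j\<in>J. E (F j))"
    using insert.prems by (intro insert.IH) (auto simp: disjoint_family_on_def)
  finally show ?case using insert.hyps by simp
qed simp

lemma Diff:
  assumes "A \<in> borel_subsets S" "B \<in> borel_subsets S" "B \<subseteq> A"
  shows "E (A - B) = E A - E B"
proof -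
  have "E (A - B \<union> B) = E (A - B) + E B"
    using assms by (intro Un borel_subsets_Diff) auto
  then show ?thesis using assms(3) by (simp add: Un_absorb2)
qed

lemma sum_partition:
  assumes A: "A \<in> borel_subsets S" and P: "borel_partition A P"
  shows "(\<Sum>B\<in>P. E B) = E A"
proof -
  have "E (\<Union>B\<in>P. B) = (\<Sum>B\<in>P. E B)"
    using P borel_subsets_trans[OF A]
    by (intro UN) (auto simp: borel_partition_def partition_on_def disjoint_def disjoint_family_on_def)
  then show ?thesis using P by (simp add: borel_partition_def partition_on_def)
qed

text \<open>If \<open>E\<close> were unbounded, one could split off disjoint sets \<open>F n\<close> with \<open>norm (E (F n)) > 4 ^ n\<close>,
  whereas \<open>E (F n)\<close> tends strongly to \<open>0\<close>.\<close>

lemma measure_bounded: "\<exists>M>0. \<forall>A\<in>borel_subsets S. norm (E A) \<le> M"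
proof (rule ccontr)
  assume no: "\<not> ?thesis"
  define unb where "unb A \<longleftrightarrow> A \<in> borel_subsets S \<and> (\<forall>K. \<exists>B\<in>borel_subsets A. K < norm (E B))" for A
  have unbS: "unb S"
    unfolding unb_def
  proof (intro conjI allI)
    fix K
    have "\<not> (\<forall>A\<in>borel_subsets S. norm (E A) \<le> max K 1)"
      using no by (metis max.cobounded2 less_le_trans zero_less_one)
    then show "\<exists>B\<in>borel_subsets S. K < norm (E B)" by force
  qed simp
  have split: "\<exists>A'. unb A' \<and> A' \<subseteq> A \<and> K < norm (E (A - A'))" if A: "unb A" for A K
  proof -
    have AS: "A \<in> borel_subsets S" using A by (simp add: unb_def)
    \<comment> \<open>The threshold makes both halves large, since
      \<open>E (A - B) = E A - E B\<close>.\<close>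
    obtain B where B: "B \<in> borel_subsets A" "norm (E B) > \<bar>K\<bar> + norm (E A)"
      using A by (auto simp: unb_def)
    have BS: "B \<in> borel_subsets S" "A - B \<in> borel_subsets S" "B \<subseteq> A"
      using borel_subsets_trans[OF AS B(1)] borel_subsets_Diff[OF AS] B(1)
      by (auto simp: borel_subsets_def)
    have "norm (E B) \<le> norm (E A) + norm (E (A - B))"
      using norm_triangle_ineq4[of "E A" "E (A - B)"] Diff[OF AS BS(1,3)] by simp
    then have big: "K < norm (E B)" "K < norm (E (A - B))"
      using B(2) norm_ge_zero[of "E A"] by linarith+
    \<comment> \<open>If \<open>E\<close> were bounded on the Borel subsets of both halves, cutting
      any \<open>C\<close> along \<open>B\<close> would bound it on those of \<open>A\<close>. An
      unbounded half is kept as the next set, and the other one, already large, is split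
      off.\<close>
    have "unb B \<or> unb (A - B)"
    proof (rule ccontr)
      assume "\<not> ?thesis"
      then have "\<exists>K. \<forall>C\<in>borel_subsets B. norm (E C) \<le> K" "\<exists>K. \<forall>C\<in>borel_subsets (A - B). norm (E C) \<le> K"
        using BS unfolding unb_def by (meson not_less)+
      then obtain K1 K2 where K: "\<And>C. C \<in> borel_subsets B \<Longrightarrow> norm (E C) \<le> K1"
        "\<And>C. C \<in> borel_subsets (A - B) \<Longrightarrow> norm (E C) \<le> K2"
        by blast
      obtain C where C: "C \<in> borel_subsets A" "K1 + K2 < norm (E C)"
        using A by (auto simp: unb_def)
      have mem: "C \<inter> B \<in> borel_subsets B" "C - B \<in> borel_subsets (A - B)"
        using C(1) BS by (auto simp: borel_subsets_def)
      have "E ((C \<inter> B) \<union> (C - B)) = E (C \<inter> B) + E (C - B)"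
        using borel_subsets_trans[OF BS(1) mem(1)] borel_subsets_trans[OF BS(2) mem(2)]
        by (intro Un) auto
      then have "norm (E C) \<le> norm (E (C \<inter> B)) + norm (E (C - B))"
        by (metis Int_Diff_Un norm_triangle_ineq)
      with K(1)[OF mem(1)] K(2)[OF mem(2)] C(2) show False by linarith
    qed
    moreover have "A - (A - B) = B" using BS(3) by auto
    ultimately show ?thesis using big BS(3) by (metis Diff_subset)
  qed
  obtain A where A: "\<And>n. unb (A n)" "\<And>n. A (Suc n) \<subseteq> A n" "\<And>n. 4 ^ n < norm (E (A n - A (Suc n)))"
    using dependent_nat_choice[of "\<lambda>_. unb" "\<lambda>n B C. C \<subseteq> B \<and> 4 ^ n < norm (E (B - C))"]
      unbS split by metis
  have dec: "decseq A" using A(2) by (simp add: decseq_Suc_iff)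
  have disj: "(A m - A (Suc m)) \<inter> (A n - A (Suc n)) = {}" if "m < n" for m n
    using decseqD[OF dec, of "Suc m" n] that by auto
  have disjF: "disjoint_family (\<lambda>n. A n - A (Suc n))"
    unfolding disjoint_family_on_def using disj by (metis Int_commute linorder_neqE_nat)
  have "(\<lambda>n. app (E (A n - A (Suc n))) x) \<longlonglongrightarrow> 0" for x
  proof (rule summable_LIMSEQ_zero[OF sums_summable[OF sums[OF _ disjF]]])
    show "A n - A (Suc n) \<in> borel_subsets S" for n
      using A(1) by (intro borel_subsets_Diff) (auto simp: unb_def)
  qed
  then show False
    using unbounded_operators_not_null[of "\<lambda>n. E (A n - A (Suc n))"] A(3) by blast
qed

end

section \<open>Fine partitions and Riemann sums\<close>

definition fine_cells :: "real \<Rightarrow> complex set set \<Rightarrow> bool"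
  where "fine_cells \<delta> P \<longleftrightarrow> (\<forall>A\<in>P. \<forall>z\<in>A. \<forall>w\<in>A. dist z w \<le> \<delta>)"

definition tagged :: "complex set set \<Rightarrow> (complex set \<Rightarrow> complex) \<Rightarrow> bool"
  where "tagged P t \<longleftrightarrow> (\<forall>A\<in>P. t A \<in> A)"

lemma fine_cells_mono: "fine_cells \<delta> P \<Longrightarrow> \<delta> \<le> \<epsilon> \<Longrightarrow> fine_cells \<epsilon> P"
  unfolding fine_cells_def by (meson order_trans)

lemma fine_cells_refines: "fine_cells \<delta> P \<Longrightarrow> refines A Q P \<Longrightarrow> fine_cells \<delta> Q"
  unfolding fine_cells_def refines_def by (meson subsetD)

lemma tagged_exists: "borel_partition A P \<Longrightarrow> \<exists>t. tagged P t"
  by (intro exI[of _ "\<lambda>B. SOME z. z \<in> B"])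
    (auto simp: tagged_def borel_partition_def partition_on_def some_in_eq)

text \<open>The cells come from a grid of half-open squares of side \<delta>/2, indexed by
  \<open>g\<close>. Boundedness lets \<open>A\<close> meet only finitely many of them, and half the
  mesh suffices because the distance is estimated by the sum of the two coordinate
  differences.\<close>

lemma fine_partition_exists:
  assumes A: "A \<in> sets borel" "bounded A" and \<delta>: "0 < \<delta>"
  shows "\<exists>P. borel_partition A P \<and> fine_cells \<delta> P"
proof -
  define \<eta> where "\<eta> = \<delta> / 2"
  have \<eta>: "\<eta> > 0" using \<delta> by (simp add: \<eta>_def)
  define g where "g z = (\<lfloor>Re z / \<eta>\<rfloor>, \<lfloor>Im z / \<eta>\<rfloor>)" for z
  define P where "P = (\<lambda>i. A \<inter> g -` {i}) ` (g ` A)"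
  obtain K where K: "\<And>z. z \<in> A \<Longrightarrow> cmod z \<le> K"
    using A(2) by (auto simp: bounded_iff)
  define N where "N = \<lceil>K / \<eta>\<rceil> + 1"
  have "g ` A \<subseteq> {-N..N} \<times> {-N..N}"
  proof
    have fl: "\<lfloor>x / \<eta>\<rfloor> \<in> {-N..N}" if "\<bar>x\<bar> \<le> K" for x
    proof -
      have "\<bar>x / \<eta>\<bar> \<le> K / \<eta>" using that \<eta> by (simp add: divide_right_mono)
      then have "- of_int \<lceil>K / \<eta>\<rceil> \<le> x / \<eta>" "x / \<eta> \<le> of_int \<lceil>K / \<eta>\<rceil>"
        using le_of_int_ceiling[of "K / \<eta>"] by linarith+
      then have "- \<lceil>K / \<eta>\<rceil> \<le> \<lfloor>x / \<eta>\<rfloor>" "\<lfloor>x / \<eta>\<rfloor> \<le> \<lceil>K / \<eta>\<rceil>"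
        by (simp_all add: le_floor_iff floor_le_iff)
      then show ?thesis unfolding N_def by simp
    qed
    fix p assume "p \<in> g ` A"
    then obtain z where z: "p = g z" "cmod z \<le> K" using K by auto
    have "\<bar>Re z\<bar> \<le> K" "\<bar>Im z\<bar> \<le> K"
      using z(2) abs_Re_le_cmod[of z] abs_Im_le_cmod[of z] by linarith+
    then show "p \<in> {-N..N} \<times> {-N..N}" unfolding z(1) g_def using fl by blast
  qed
  then have fin: "finite P" unfolding P_def by (meson finite_SigmaI finite_atLeastAtMost_int finite_imageI finite_subset)
  have pre: "g -` {(i, j)} = {z. of_int i * \<eta> \<le> Re z} \<inter> {z. Re z < (of_int i + 1) * \<eta>} \<inter>
      ({z. of_int j * \<eta> \<le> Im z} \<inter> {z. Im z < (of_int j + 1) * \<eta>})" for i j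
    using \<eta> by (auto simp: g_def floor_eq_iff pos_le_divide_eq pos_divide_less_eq)
  have "g -` {p} \<in> sets borel" for p
  proof (cases p)
    case (Pair i j)
    note halfspaces = borel_closed[OF closed_halfspace_Re_ge] borel_closed[OF closed_halfspace_Im_ge]
      borel_open[OF open_halfspace_Re_lt] borel_open[OF open_halfspace_Im_lt]
    show ?thesis unfolding Pair pre by (intro sets.Int halfspaces)
  qed
  then have "P \<subseteq> borel_subsets A" unfolding P_def borel_subsets_def using A(1) by auto
  moreover have "partition_on A P"
    unfolding partition_on_def P_def disjoint_def by auto
  moreover have "fine_cells \<delta> P"
    unfolding fine_cells_def
  proof (intro ballI)
    fix B z w assume "B \<in> P" "z \<in> B" "w \<in> B"
    then have "g z = g w" unfolding P_def by auto
    then have eq: "\<lfloor>Re z / \<eta>\<rfloor> = \<lfloor>Re w / \<eta>\<rfloor>" "\<lfloor>Im z / \<eta>\<rfloor> = \<lfloor>Im w / \<eta>\<rfloor>" by (auto simp: g_def)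
    have cl: "\<bar>x - y\<bar> \<le> \<eta>" if "\<lfloor>x / \<eta>\<rfloor> = \<lfloor>y / \<eta>\<rfloor>" for x y
    proof -
      have "\<bar>x / \<eta> - y / \<eta>\<bar> \<le> 1" using that by linarith
      then show ?thesis using \<eta> by (simp add: divide_le_eq flip: diff_divide_distrib)
    qed
    have "dist z w \<le> \<bar>Re (z - w)\<bar> + \<bar>Im (z - w)\<bar>" unfolding dist_norm by (rule cmod_le)
    also have "\<dots> \<le> \<eta> + \<eta>" using cl[OF eq(1)] cl[OF eq(2)] by simp
    finally show "dist z w \<le> \<delta>" by (simp add: \<eta>_def)
  qed
  ultimately show ?thesis using fin by (auto simp: borel_partition_def)
qed

lemma eventually_tagged_partitions:
  assumes "borel_partition A P"
  shows "\<forall>\<^sub>F (Q, t) in tagged_partitions A. borel_partition A Q \<and> refines A Q P \<and> tagged Q t"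
proof -
  have "tagged_partitions A \<le> principal {(Q, t). borel_partition A Q \<and> refines A Q P \<and> (\<forall>A\<in>Q. t A \<in> A)}"
    unfolding tagged_partitions_def using assms by (intro INF_lower) simp
  then show ?thesis
    by (auto simp: le_principal tagged_def)
qed

context spectral_measure
begin

text \<open>On the common refinement the two tags are each within \<delta> of any point of the
  intersection, so the coefficients differ by at most 2 \<delta>; \<open>norm_sum_scaleC_le\<close>
  contributes the remaining factor \<open>4 * M\<close>.\<close>

lemma riemann_sum_close:
  assumes A: "A \<in> borel_subsets S" and M: "\<And>B. B \<in> borel_subsets S \<Longrightarrow> norm (E B) \<le> M"
    and P: "borel_partition A P" "fine_cells \<delta> P" "tagged P t"
    and Q: "borel_partition A Q" "fine_cells \<delta> Q" "tagged Q u" and \<delta>: "0 \<le> \<delta>"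
  shows "norm ((\<Sum>B\<in>P. t B *\<^sub>C E B) - (\<Sum>C\<in>Q. u C *\<^sub>C E C)) \<le> 8 * M * \<delta>"
proof -
  have PS: "B \<in> borel_subsets S" if "B \<in> P" for B
    using that P(1) borel_subsets_trans[OF A] by (auto simp: borel_partition_def)
  have QS: "C \<in> borel_subsets S" if "C \<in> Q" for C
    using that Q(1) borel_subsets_trans[OF A] by (auto simp: borel_partition_def)
  have AB: "B \<subseteq> A" if "B \<in> P \<or> B \<in> Q" for B
    using that P(1) Q(1) by (auto simp: borel_partition_def borel_subsets_def)
  have fin: "finite P" "finite Q" using P Q by (auto simp: borel_partition_def)
  have 1: "(\<Sum>B\<in>P. t B *\<^sub>C E B) = (\<Sum>(B, C)\<in>P \<times> Q. t B *\<^sub>C E (B \<inter> C))"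
  proof -
    have "E B = (\<Sum>C\<in>Q. E (B \<inter> C))" if "B \<in> P" for B
    proof -
      have "E B = E B * E A" using mult[OF PS[OF that] A] AB that by (simp add: Int_absorb2)
      also have "\<dots> = (\<Sum>C\<in>Q. E B * E C)"
        by (simp add: sum_partition[OF A Q(1), symmetric] sum_distrib_left)
      finally show ?thesis using mult PS QS that by simp
    qed
    then show ?thesis by (simp add: scaleC_sum_right sum.cartesian_product)
  qed
  have 2: "(\<Sum>C\<in>Q. u C *\<^sub>C E C) = (\<Sum>(B, C)\<in>P \<times> Q. u C *\<^sub>C E (B \<inter> C))"
  proof -
    have "E C = (\<Sum>B\<in>P. E (B \<inter> C))" if "C \<in> Q" for C
    proof -
      have "E C = E A * E C" using mult[OF A QS[OF that]] AB that by (simp add: Int_absorb1)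
      also have "\<dots> = (\<Sum>B\<in>P. E B * E C)"
        by (simp add: sum_partition[OF A P(1), symmetric] sum_distrib_right)
      finally show ?thesis using mult PS QS that by simp
    qed
    then have "(\<Sum>C\<in>Q. u C *\<^sub>C E C) = (\<Sum>C\<in>Q. \<Sum>B\<in>P. u C *\<^sub>C E (B \<inter> C))"
      by (simp add: scaleC_sum_right)
    also have "\<dots> = (\<Sum>B\<in>P. \<Sum>C\<in>Q. u C *\<^sub>C E (B \<inter> C))" by (rule sum.swap)
    finally show ?thesis by (simp add: sum.cartesian_product)
  qed
  \<comment> \<open>Tags of disjoint cells may be far apart, but there \<open>E\<close> vanishes, so
    the coefficient can be set to 0.\<close>
  define f where "f = (\<lambda>(B, C). if B \<inter> C = {} then 0 else t B - u C)"
  have disj: "disjoint_family_on (\<lambda>(B, C). B \<inter> C) (P \<times> Q)"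
    using P(1) Q(1)
    by (auto simp: disjoint_family_on_def borel_partition_def partition_on_def disjoint_def) blast+
  have "(\<Sum>B\<in>P. t B *\<^sub>C E B) - (\<Sum>C\<in>Q. u C *\<^sub>C E C) =
      (\<Sum>p\<in>P \<times> Q. f p *\<^sub>C (case p of (B, C) \<Rightarrow> E (B \<inter> C)))"
    unfolding 1 2 sum_subtractf[symmetric]
    by (intro sum.cong) (auto simp: f_def scaleC_diff_left)
  also have "norm \<dots> \<le> 4 * (2 * \<delta>) * M"
  proof (rule norm_sum_scaleC_le)
    fix p assume "p \<in> P \<times> Q"
    then obtain B C where p: "p = (B, C)" "B \<in> P" "C \<in> Q" by auto
    show "cmod (f p) \<le> 2 * \<delta>"
    proof (cases "B \<inter> C = {}")
      case False
      then obtain z where z: "z \<in> B" "z \<in> C" by auto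
      have "dist (t B) z \<le> \<delta>" "dist z (u C) \<le> \<delta>"
        using P(2,3) Q(2,3) p z by (auto simp: fine_cells_def tagged_def)
      then show ?thesis
        using dist_triangle[of "t B" "u C" z] False by (simp add: p f_def dist_norm)
    qed (use \<delta> in \<open>simp add: p f_def\<close>)
  next
    fix J assume J: "J \<subseteq> P \<times> Q"
    have eq: "E (\<Union>p\<in>J. case p of (B, C) \<Rightarrow> B \<inter> C) = (\<Sum>p\<in>J. E (case p of (B, C) \<Rightarrow> B \<inter> C))"
      using J PS QS fin
      by (intro UN disjoint_family_on_mono[OF J disj])
        (auto intro: finite_subset intro!: borel_subsets_Int)
    have "(\<Union>p\<in>J. case p of (B, C) \<Rightarrow> B \<inter> C) \<in> borel_subsets S"
      using J PS QS fin by (intro borel_subsets_UN) (auto intro: finite_subset intro!: borel_subsets_Int)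
    from M[OF this] show "norm (\<Sum>p\<in>J. case p of (B, C) \<Rightarrow> E (B \<inter> C)) \<le> M"
      unfolding eq by (simp add: case_prod_unfold)
  qed (use fin \<delta> in auto)
  finally show ?thesis by (simp add: mult_ac)
qed

text \<open>Sums of mesh 1/(n+1) are Cauchy in norm, and letting n tend to infinity in
  \<open>riemann_sum_close\<close> keeps its constant. The explicit rate makes any filter along
  which the mesh shrinks usable later.\<close>

lemma riemann_sum_limit:
  assumes A: "A \<in> borel_subsets S" and M: "\<And>B. B \<in> borel_subsets S \<Longrightarrow> norm (E B) \<le> M" "M > 0"
    and bdd: "bounded S"
  shows "\<exists>T. \<forall>\<delta>>0. \<forall>P t. borel_partition A P \<longrightarrow> fine_cells \<delta> P \<longrightarrow> tagged P t \<longrightarrow>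
    norm ((\<Sum>B\<in>P. t B *\<^sub>C E B) - T) \<le> 8 * M * \<delta>"
proof -
  have "A \<in> sets borel" "bounded A"
    using A bdd by (auto simp: borel_subsets_def intro: bounded_subset)
  then have "\<exists>P t. borel_partition A P \<and> fine_cells (1 / Suc n) P \<and> tagged P t" for n
    using fine_partition_exists[of A "1 / Suc n"] tagged_exists by fastforce
  then obtain P t where P: "\<And>n. borel_partition A (P n)" "\<And>n. fine_cells (1 / Suc n) (P n)"
    "\<And>n. tagged (P n) (t n)" by metis
  define R where "R n = (\<Sum>B\<in>P n. t n B *\<^sub>C E B)" for n
  have "Cauchy R"
  proof (rule metric_CauchyI)
    fix e :: real assume e: "e > 0"
    obtain N where N: "inverse (Suc N) < e / (8 * M)"
      using reals_Archimedean[of "e / (8 * M)"] e M(2) by auto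
    have "dist (R m) (R n) < e" if mn: "m \<ge> N" "n \<ge> N" for m n
    proof -
      have "fine_cells (1 / Suc N) (P k)" if "k \<ge> N" for k
        by (rule fine_cells_mono[OF P(2)]) (use that in \<open>simp add: field_simps\<close>)
      then have "dist (R m) (R n) \<le> 8 * M * (1 / Suc N)"
        unfolding R_def dist_norm using mn P by (intro riemann_sum_close[OF A M(1)]) auto
      also have "\<dots> < e" using N M(2) by (simp add: field_simps)
      finally show ?thesis .
    qed
    then show "\<exists>N. \<forall>m\<ge>N. \<forall>n\<ge>N. dist (R m) (R n) < e" by blast
  qed
  then obtain T where T: "R \<longlonglongrightarrow> T" by (meson Cauchy_convergent_iff convergent_def)
  have "norm ((\<Sum>B\<in>Q. u B *\<^sub>C E B) - T) \<le> 8 * M * \<delta>"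
    if \<delta>: "\<delta> > 0" and Q: "borel_partition A Q" "fine_cells \<delta> Q" "tagged Q u" for \<delta> Q u
  proof (rule tendsto_le[OF trivial_limit_sequentially tendsto_const])
    show "(\<lambda>n. norm ((\<Sum>B\<in>Q. u B *\<^sub>C E B) - R n)) \<longlonglongrightarrow> norm ((\<Sum>B\<in>Q. u B *\<^sub>C E B) - T)"
      by (intro tendsto_intros T)
    obtain N where N: "inverse (Suc N) < \<delta>" using reals_Archimedean[OF \<delta>] by auto
    have "norm ((\<Sum>B\<in>Q. u B *\<^sub>C E B) - R n) \<le> 8 * M * \<delta>" if "n \<ge> N" for n
    proof -
      have "1 / Suc n \<le> inverse (Suc N)" using that by (simp add: field_simps)
      then have "fine_cells \<delta> (P n)" using fine_cells_mono[OF P(2)[of n], of \<delta>] N by linarith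
      then show ?thesis unfolding R_def using Q P \<delta> by (intro riemann_sum_close[OF A M(1)]) auto
    qed
    then show "\<forall>\<^sub>F n in sequentially. norm ((\<Sum>B\<in>Q. u B *\<^sub>C E B) - R n) \<le> 8 * M * \<delta>"
      unfolding eventually_sequentially by blast
  qed
  then show ?thesis by blast
qed

end

section \<open>Spectral decompositions\<close>

lemma scaleC_one_power: "(c *\<^sub>C (1::'a::chilbert_space bop)) ^ n = c ^ n *\<^sub>C 1"
  by (induction n) (simp_all add: scaleC_mult_left scaleC_mult_right scaleC_scaleC scaleC_one mult.commute)

lemma commute_power: "x * y = y * (x::'a::monoid_mult) \<Longrightarrow> x ^ n * y = y * x ^ n"
  by (metis power_commuting_commutes)

lemma binomial_commuting:
  fixes x y :: "'a::chilbert_space bop"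
  assumes "x * y = y * x"
  shows "(x + y) ^ n = (\<Sum>q\<le>n. of_nat (n choose q) *\<^sub>C (x ^ (n - q) * y ^ q))"
proof (induction n)
  case (Suc n)
  have xy: "x * y ^ q = y ^ q * x" for q using commute_power[of y x q] assms by simp
  let ?t = "\<lambda>n q. x ^ (n - q) * y ^ q"
  have "(x + y) ^ Suc n = (x + y) * (\<Sum>q\<le>n. of_nat (n choose q) *\<^sub>C ?t n q)"
    by (simp add: Suc)
  also have "\<dots> = (\<Sum>q\<le>n. of_nat (n choose q) *\<^sub>C ?t (Suc n) q) +
      (\<Sum>q\<le>n. of_nat (n choose q) *\<^sub>C ?t (Suc n) (Suc q))"
  proof -
    have "y * ?t n q = ?t (Suc n) (Suc q)" for q
      using commute_power[of x y "n - q"] assms by (simp flip: mult.assoc)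
    moreover have "x * ?t n q = ?t (Suc n) q" if "q \<le> n" for q
      using that by (simp add: Suc_diff_le mult.assoc)
    ultimately show ?thesis
      by (simp add: distrib_right sum_distrib_left scaleC_mult_right scaleC_add_right sum.distrib)
  qed
  \<comment> \<open>The new term has coefficient \<open>n choose Suc n\<close>, which is 0. It
    aligns the two ranges, so that Pascal's rule applies after splitting off the term of index
    0.\<close>
  also have "(\<Sum>q\<le>n. of_nat (n choose q) *\<^sub>C ?t (Suc n) q) =
      (\<Sum>q\<le>Suc n. of_nat (n choose q) *\<^sub>C ?t (Suc n) q)"
    by (simp add: binomial_eq_0)
  also have "\<dots> = ?t (Suc n) 0 + (\<Sum>q\<le>n. of_nat (n choose Suc q) *\<^sub>C ?t (Suc n) (Suc q))"
    by (simp only: sum.atMost_Suc_shift) (simp add: scaleC_one)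
  also have "?t (Suc n) 0 + (\<Sum>q\<le>n. of_nat (n choose Suc q) *\<^sub>C ?t (Suc n) (Suc q)) +
      (\<Sum>q\<le>n. of_nat (n choose q) *\<^sub>C ?t (Suc n) (Suc q)) =
      ?t (Suc n) 0 + (\<Sum>q\<le>n. of_nat (Suc n choose Suc q) *\<^sub>C ?t (Suc n) (Suc q))"
    by (simp add: scaleC_add_left sum.distrib add_ac)
  also have "\<dots> = (\<Sum>q\<le>Suc n. of_nat (Suc n choose q) *\<^sub>C ?t (Suc n) q)"
    by (simp only: sum.atMost_Suc_shift) (simp add: scaleC_one)
  finally show ?case .
qed (simp add: scaleC_one)

context spectral_measure
begin

text \<open>Projections of disjoint cells annihilate each other, so the cross terms vanish and
  operator-valued step functions multiply pointwise.\<close>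

lemma partition_sum_mult:
  assumes P: "finite P" "P \<subseteq> borel_subsets S" "disjoint P"
    and comm: "\<And>B C. B \<in> P \<Longrightarrow> C \<in> P \<Longrightarrow> E B * g C = g C * E B"
  shows "(\<Sum>B\<in>P. f B * E B) * (\<Sum>B\<in>P. g B * E B) = (\<Sum>B\<in>P. f B * g B * E B)"
proof -
  have "f B * E B * (g C * E C) = (if C = B then f B * g B * E B else 0)" if "B \<in> P" "C \<in> P" for B C
  proof -
    have "f B * E B * (g C * E C) = f B * g C * (E B * E C)"
      using comm[OF that] by (metis mult.assoc)
    also have "E B * E C = E (B \<inter> C)" using that P(2) mult by blast
    also have "B \<inter> C = (if C = B then B else {})" using P(3) that by (auto simp: disjoint_def)
    finally show ?thesis by auto
  qed
  then have "(\<Sum>B\<in>P. f B * E B) * (\<Sum>B\<in>P. g B * E B) =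
      (\<Sum>B\<in>P. \<Sum>C\<in>P. if C = B then f B * g B * E B else 0)"
    by (simp add: sum_product)
  then show ?thesis using P(1) by simp
qed

text \<open>The factor \<open>E A\<close> matters for exponent 0, where the right-hand side is the
  sum of all \<open>E B\<close> and not the identity.\<close>

lemma partition_sum_power:
  assumes A: "A \<in> borel_subsets S" and P: "borel_partition A P"
    and comm: "\<And>B C. B \<in> P \<Longrightarrow> C \<in> P \<Longrightarrow> E B * f C = f C * E B"
  shows "(\<Sum>B\<in>P. f B * E B) ^ n * E A = (\<Sum>B\<in>P. f B ^ n * E B)"
proof (induction n)
  case 0
  show ?case using sum_partition[OF A P] by simp
next
  case (Suc n)
  have "(\<Sum>B\<in>P. f B * E B) ^ Suc n * E A = (\<Sum>B\<in>P. f B * E B) * (\<Sum>B\<in>P. f B ^ n * E B)"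
    by (simp add: mult.assoc Suc)
  also have "\<dots> = (\<Sum>B\<in>P. f B * f B ^ n * E B)"
    using P borel_subsets_trans[OF A] comm
    by (intro partition_sum_mult)
      (auto simp: borel_partition_def partition_on_def commute_power simp flip: commute_power)
  finally show ?case by simp
qed

end

locale spectral_dec =
  fixes X :: "'a::chilbert_space bop" and E :: "complex set \<Rightarrow> 'a bop" and m :: "complex \<Rightarrow> nat"
  assumes dec: "spectral_decomposition X E m"
begin

abbreviation "\<sigma> \<equiv> spectrum X"

lemma level_set_borel: "{\<mu> \<in> \<sigma>. m \<mu> = k} \<in> borel_subsets \<sigma>"
  using dec by (auto simp: spectral_decomposition_def Let_def borel_subsets_def)

sublocale spectral_measure \<sigma> E
proof
  show "spectral_measure_on \<sigma> E" using dec by (simp add: spectral_decomposition_def Let_def)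
  have "(\<Union>k. {\<mu> \<in> \<sigma>. m \<mu> = k}) \<in> sets borel"
    using level_set_borel by (intro sets.countable_UN) (auto simp: borel_subsets_def)
  also have "(\<Union>k. {\<mu> \<in> \<sigma>. m \<mu> = k}) = \<sigma>" by auto
  finally show "\<sigma> \<in> borel_subsets \<sigma>" by (simp add: borel_subsets_def)
qed

section \<open>Scalar and nilpotent parts\<close>

definition "M = (SOME M. M > 0 \<and> (\<forall>A\<in>borel_subsets \<sigma>. norm (E A) \<le> M))"

lemma M: "M > 0" "A \<in> borel_subsets \<sigma> \<Longrightarrow> norm (E A) \<le> M"
  using someI_ex[OF measure_bounded[unfolded Bex_def]] unfolding M_def by blast+

text \<open>\<open>scalar_part A\<close> is \<open>\<integral>\<^sub>A \<mu> dE(\<mu>)\<close> and \<open>nil_part A\<close> is \<open>\<integral>\<^sub>A (X - \<mu> I) dE(\<mu>)\<close>.\<close>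

definition "scalar_part A = (SOME T. \<forall>\<delta>>0. \<forall>P t. borel_partition A P \<longrightarrow> fine_cells \<delta> P \<longrightarrow>
    tagged P t \<longrightarrow> norm ((\<Sum>B\<in>P. t B *\<^sub>C E B) - T) \<le> 8 * M * \<delta>)"

definition "nil_part A = X * E A - scalar_part A"

lemma bounded_spectrum: "bounded \<sigma>"
  using compact_spectrum compact_imp_bounded by blast

lemma scalar_part:
  assumes "A \<in> borel_subsets \<sigma>" "\<delta> > 0" "borel_partition A P" "fine_cells \<delta> P" "tagged P t"
  shows "norm ((\<Sum>B\<in>P. t B *\<^sub>C E B) - scalar_part A) \<le> 8 * M * \<delta>"
  using someI_ex[OF riemann_sum_limit[OF assms(1) M(2,1) bounded_spectrum]] assms(2-)
  unfolding scalar_part_def by blast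

lemma eventually_fine_cells:
  assumes A: "A \<in> borel_subsets \<sigma>" and \<delta>: "\<delta> > 0"
  shows "\<forall>\<^sub>F (P, t) in tagged_partitions A. borel_partition A P \<and> tagged P t \<and> fine_cells \<delta> P"
proof -
  have "A \<in> sets borel" "bounded A"
    using A bounded_spectrum by (auto simp: borel_subsets_def intro: bounded_subset)
  then obtain Q where "borel_partition A Q" "fine_cells \<delta> Q"
    using fine_partition_exists \<delta> by blast
  then show ?thesis
    using eventually_tagged_partitions[of A Q]
    by (auto elim!: eventually_mono intro: fine_cells_refines)
qed

text \<open>The filter is arbitrary because the limit is needed both along partitions of
  \<open>A\<close> itself and along the cells inside \<open>A\<close> of partitions of the whole
  spectrum.\<close>

lemma tendsto_scalar_part:
  assumes A: "A \<in> borel_subsets \<sigma>"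
    and ev: "\<And>\<delta>. \<delta> > 0 \<Longrightarrow> \<forall>\<^sub>F p in F. borel_partition A (P p) \<and> tagged (P p) (t p) \<and> fine_cells \<delta> (P p)"
  shows "((\<lambda>p. \<Sum>B\<in>P p. t p B *\<^sub>C E B) \<longlongrightarrow> scalar_part A) F"
proof (rule tendstoI)
  fix e :: real assume e: "e > 0"
  define \<delta> where "\<delta> = e / (16 * M)"
  have \<delta>: "\<delta> > 0" "8 * M * \<delta> < e" using e M(1) by (simp_all add: \<delta>_def)
  show "\<forall>\<^sub>F p in F. dist (\<Sum>B\<in>P p. t p B *\<^sub>C E B) (scalar_part A) < e"
    using ev[OF \<delta>(1)]
  proof (rule eventually_mono)
    fix p assume "borel_partition A (P p) \<and> tagged (P p) (t p) \<and> fine_cells \<delta> (P p)"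
    then show "dist (\<Sum>B\<in>P p. t p B *\<^sub>C E B) (scalar_part A) < e"
      using scalar_part[OF A \<delta>(1), of "P p" "t p"] \<delta>(2) by (simp add: dist_norm)
  qed
qed

text \<open>The terms containing \<open>X\<close> add up to \<open>X * E A\<close> for every
  partition, so only the scalar sums vary.\<close>

lemma tendsto_nil_part:
  assumes A: "A \<in> borel_subsets \<sigma>"
    and ev: "\<And>\<delta>. \<delta> > 0 \<Longrightarrow> \<forall>\<^sub>F p in F. borel_partition A (P p) \<and> tagged (P p) (t p) \<and> fine_cells \<delta> (P p)"
  shows "((\<lambda>p. \<Sum>B\<in>P p. (X - t p B *\<^sub>C 1) * E B) \<longlongrightarrow> nil_part A) F"
proof (rule Lim_transform_eventually)
  show "((\<lambda>p. X * E A - (\<Sum>B\<in>P p. t p B *\<^sub>C E B)) \<longlongrightarrow> nil_part A) F"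
    unfolding nil_part_def by (intro tendsto_intros tendsto_scalar_part[OF A ev])
  show "\<forall>\<^sub>F p in F. X * E A - (\<Sum>B\<in>P p. t p B *\<^sub>C E B) = (\<Sum>B\<in>P p. (X - t p B *\<^sub>C 1) * E B)"
    using ev[of 1]
    by (auto elim!: eventually_mono
        simp: sum_partition[OF A, symmetric] sum_distrib_left left_diff_distrib sum_subtractf scaleC_mult_left)
qed

text \<open>Convergence in norm implies the strong convergence that defines the spectral integral.
  This turns the axioms about \<open>N 1\<close> into statements about
  \<open>nil_part\<close>.\<close>

lemma spectral_integral_nil_part:
  assumes A: "A \<in> borel_subsets \<sigma>"
  shows "spectral_integral E (\<lambda>\<mu>. (X - \<mu> *\<^sub>C 1) ^ 1) A = nil_part A"
proof -
  have ev: "\<forall>\<^sub>F p in tagged_partitions A.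
      borel_partition A (fst p) \<and> tagged (fst p) (snd p) \<and> fine_cells \<delta> (fst p)" if "\<delta> > 0" for \<delta>
    using eventually_fine_cells[OF A that] by (simp add: case_prod_unfold)
  have "has_spectral_integral E (\<lambda>\<mu>. (X - \<mu> *\<^sub>C 1) ^ 1) A (nil_part A)"
    unfolding has_spectral_integral_def case_prod_unfold power_one_right
    by (intro allI tendsto_app tendsto_nil_part[OF A ev])
  then show ?thesis
    unfolding spectral_integral_def using has_spectral_integral_unique by blast
qed

lemma nil_part_mult:
  assumes "A \<in> borel_subsets \<sigma>" "B \<in> borel_subsets \<sigma>"
  shows "E B * nil_part A = nil_part (A \<inter> B)" "nil_part A * E B = nil_part (A \<inter> B)"
proof -
  let ?N = "spectral_integral E (\<lambda>\<mu>. (X - \<mu> *\<^sub>C 1) ^ 1)"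
  have "E B * ?N A = ?N (A \<inter> B) \<and> ?N A * E B = ?N (A \<inter> B)"
    using dec assms unfolding spectral_decomposition_def Let_def by blast
  then show "E B * nil_part A = nil_part (A \<inter> B)" "nil_part A * E B = nil_part (A \<inter> B)"
    using assms borel_subsets_Int[OF assms] by (simp_all only: spectral_integral_nil_part)
qed

lemma nil_part_power:
  assumes "A \<in> borel_subsets \<sigma>" "1 \<le> l" "\<And>\<mu>. \<mu> \<in> A \<Longrightarrow> m \<mu> \<le> l"
  shows "nil_part A ^ l = 0"
proof -
  have "spectral_integral E (\<lambda>\<mu>. (X - \<mu> *\<^sub>C 1) ^ 1) A ^ l = 0"
    using dec assms unfolding spectral_decomposition_def Let_def by blast
  then show ?thesis by (simp only: spectral_integral_nil_part[OF assms(1)])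
qed

lemma scalar_part_commute:
  assumes A: "A \<in> borel_subsets \<sigma>" and T: "\<And>B. B \<in> borel_subsets \<sigma> \<Longrightarrow> T * E B = E B * T"
  shows "T * scalar_part A = scalar_part A * T"
proof -
  have ev: "\<forall>\<^sub>F p in tagged_partitions A.
      borel_partition A (fst p) \<and> tagged (fst p) (snd p) \<and> fine_cells \<delta> (fst p)" if "\<delta> > 0" for \<delta>
    using eventually_fine_cells[OF A that] by (simp add: case_prod_unfold)
  have lim: "((\<lambda>p. \<Sum>B\<in>fst p. snd p B *\<^sub>C E B) \<longlongrightarrow> scalar_part A) (tagged_partitions A)"
    by (intro tendsto_scalar_part[OF A ev])
  have "((\<lambda>p. T * (\<Sum>B\<in>fst p. snd p B *\<^sub>C E B)) \<longlongrightarrow> scalar_part A * T) (tagged_partitions A)"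
  proof (rule Lim_transform_eventually[OF tendsto_mult[OF lim tendsto_const]])
    show "\<forall>\<^sub>F p in tagged_partitions A.
        (\<Sum>B\<in>fst p. snd p B *\<^sub>C E B) * T = T * (\<Sum>B\<in>fst p. snd p B *\<^sub>C E B)"
      using ev[OF zero_less_one]
    proof (rule eventually_mono)
      fix p assume "borel_partition A (fst p) \<and> tagged (fst p) (snd p) \<and> fine_cells 1 (fst p)"
      then have "T * E B = E B * T" if "B \<in> fst p" for B
        using that T borel_subsets_trans[OF A] by (auto simp: borel_partition_def)
      then show "(\<Sum>B\<in>fst p. snd p B *\<^sub>C E B) * T = T * (\<Sum>B\<in>fst p. snd p B *\<^sub>C E B)"
        by (simp add: sum_distrib_left sum_distrib_right scaleC_mult_left scaleC_mult_right)
    qed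
  qed
  then show ?thesis
    by (rule tendsto_unique[OF tagged_partitions_neq_bot tendsto_mult[OF tendsto_const lim]])
qed

text \<open>Since \<open>E \<sigma> = 1\<close>, the operator \<open>X\<close> is the sum of its
  scalar and nilpotent parts. The first is a norm limit of combinations of commuting projections;
  for the second, the axioms give the same value to both products with \<open>E B\<close>.\<close>

lemma commute:
  assumes B: "B \<in> borel_subsets \<sigma>"
  shows "X * E B = E B * X"
proof -
  have "E B * scalar_part \<sigma> = scalar_part \<sigma> * E B"
    using mult B by (intro scalar_part_commute) (auto simp: Int_commute)
  moreover have "E B * nil_part \<sigma> = nil_part \<sigma> * E B"
    using nil_part_mult[OF borel B] by simp
  ultimately show ?thesis by (simp add: nil_part_def whole algebra_simps)
qed

lemma commute_shift:
  assumes B: "B \<in> borel_subsets \<sigma>"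
  shows "(X - c *\<^sub>C 1) ^ n * E B = E B * (X - c *\<^sub>C 1) ^ n"
  using commute[OF B]
  by (intro commute_power) (simp add: algebra_simps scaleC_mult_left scaleC_mult_right)

section \<open>Riemann sums of shifted powers over a Borel set\<close>

lemma eventually_local_cells:
  assumes A: "A \<in> borel_subsets \<sigma>" and \<delta>: "\<delta> > 0"
  shows "\<forall>\<^sub>F (P, t) in tagged_partitions \<sigma>. borel_partition \<sigma> P \<and> tagged P t \<and>
    (\<forall>B\<in>P. B \<subseteq> A \<or> B \<inter> A = {}) \<and> borel_partition A {B \<in> P. B \<subseteq> A} \<and> fine_cells \<delta> {B \<in> P. B \<subseteq> A}"
proof -
  \<comment> \<open>Every refinement of this partition has cells that lie inside \<open>A\<close> or
    miss it. The empty set is removed because one of the two pieces may be empty.\<close>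
  have "borel_partition \<sigma> ({A, \<sigma> - A} - {{}})"
    using A borel borel_subsets_Diff[OF borel A]
    by (auto simp: borel_partition_def partition_on_def disjoint_def borel_subsets_def)
  from eventually_tagged_partitions[OF this] eventually_fine_cells[OF borel \<delta>] show ?thesis
  proof eventually_elim
    fix p assume "case p of (Q, t) \<Rightarrow> borel_partition \<sigma> Q \<and> refines \<sigma> Q ({A, \<sigma> - A} - {{}}) \<and> tagged Q t"
      "case p of (P, t) \<Rightarrow> borel_partition \<sigma> P \<and> tagged P t \<and> fine_cells \<delta> P"
    then obtain P t where p: "p = (P, t)" and P: "borel_partition \<sigma> P" "tagged P t" "fine_cells \<delta> P"
      and r: "refines \<sigma> P ({A, \<sigma> - A} - {{}})" by auto
    have cells: "B \<subseteq> A \<or> B \<inter> A = {}" if "B \<in> P" for B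
    proof -
      from r that obtain C where "C \<in> {A, \<sigma> - A}" "B \<subseteq> C" unfolding refines_def by blast
      then show ?thesis by auto
    qed
    have "partition_on A {B \<in> P. B \<subseteq> A}"
    proof (rule partition_onI)
      show "\<Union>{B \<in> P. B \<subseteq> A} = A"
      proof
        show "A \<subseteq> \<Union>{B \<in> P. B \<subseteq> A}"
        proof
          fix z assume z: "z \<in> A"
          then have "z \<in> \<Union>P" using A P(1) by (auto simp: borel_partition_def partition_on_def borel_subsets_def)
          with cells z show "z \<in> \<Union>{B \<in> P. B \<subseteq> A}" by blast
        qed
      qed auto
    qed (use P(1) in \<open>auto simp: borel_partition_def partition_on_def disjoint_def disjnt_def\<close>)
    then have "borel_partition A {B \<in> P. B \<subseteq> A}"
      using P(1) by (auto simp: borel_partition_def borel_subsets_def)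
    with P cells show "case p of (P, t) \<Rightarrow> borel_partition \<sigma> P \<and> tagged P t \<and>
        (\<forall>B\<in>P. B \<subseteq> A \<or> B \<inter> A = {}) \<and> borel_partition A {B \<in> P. B \<subseteq> A} \<and> fine_cells \<delta> {B \<in> P. B \<subseteq> A}"
      by (auto simp: p fine_cells_def)
  qed
qed

text \<open>The Riemann sum over the cells inside \<open>A\<close> of the functional calculus of \<open>z \<mapsto> (z - a)\<^sup>j\<close>,
  for order of nilpotency \<open>k\<close>.\<close>

definition "monomial_sum A a k j p = (\<Sum>B\<in>{B \<in> fst p. B \<subseteq> A}. \<Sum>q<k.
    (of_nat (j choose q) * (snd p B - a) ^ (j - q)) *\<^sub>C ((X - snd p B *\<^sub>C 1) ^ q * E B))"

text \<open>Step functions multiply pointwise, so the sum over the cells can be carried out before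
  the sum over q and yields powers of \<open>U\<close> and \<open>V\<close>. The second equation
  separates these powers for norm estimates; the third shows that powers of \<open>U\<close> are
  again scalar Riemann sums.\<close>

lemma monomial_sum_eq:
  fixes P t A a
  defines "U \<equiv> \<Sum>B\<in>{B \<in> P. B \<subseteq> A}. ((t B - a) *\<^sub>C 1) * E B"
    and "V \<equiv> \<Sum>B\<in>{B \<in> P. B \<subseteq> A}. (X - t B *\<^sub>C 1) * E B"
  assumes A: "A \<in> borel_subsets \<sigma>" and P: "borel_partition A {B \<in> P. B \<subseteq> A}"
  shows "monomial_sum A a k j (P, t) = (\<Sum>q<k. of_nat (j choose q) *\<^sub>C (U ^ (j - q) * V ^ q * E A))"
    and "U ^ i * V ^ q * E A = (U ^ i * E A) * (V ^ q * E A)"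
    and "U ^ i * E A = (\<Sum>B\<in>{B \<in> P. B \<subseteq> A}. (t B - a) ^ i *\<^sub>C E B)"
proof -
  let ?P = "{B \<in> P. B \<subseteq> A}"
  have PS: "B \<in> borel_subsets \<sigma>" if "B \<in> ?P" for B
    using that P borel_subsets_trans[OF A] unfolding borel_partition_def by blast
  have fin: "finite ?P" "?P \<subseteq> borel_subsets \<sigma>" "disjoint ?P"
    using P PS by (auto simp: borel_partition_def partition_on_def)
  have cV: "E B * (X - t C *\<^sub>C 1) ^ q = (X - t C *\<^sub>C 1) ^ q * E B" if "B \<in> ?P" for B C q
    using commute_shift[OF PS[OF that]] by simp
  have U: "U ^ i * E A = (\<Sum>B\<in>?P. ((t B - a) *\<^sub>C 1) ^ i * E B)" for i
    unfolding U_def by (rule partition_sum_power[OF A P]) (simp add: scaleC_mult_left scaleC_mult_right)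
  have V: "V ^ q * E A = (\<Sum>B\<in>?P. (X - t B *\<^sub>C 1) ^ q * E B)" for q
    unfolding V_def by (rule partition_sum_power[OF A P]) (use cV[of _ _ 1] in simp)
  have EV: "E A * (V ^ q * E A) = V ^ q * E A" for q
    unfolding V sum_distrib_left
  proof (rule sum.cong)
    fix B assume B: "B \<in> ?P"
    have "E A * E B = E B" using mult[OF A PS[OF B]] B by (simp add: Int_absorb1)
    then show "E A * ((X - t B *\<^sub>C 1) ^ q * E B) = (X - t B *\<^sub>C 1) ^ q * E B"
      using commute_shift[OF A, of "t B" q] by (metis mult.assoc)
  qed simp
  then show UV: "U ^ i * V ^ q * E A = (U ^ i * E A) * (V ^ q * E A)" for i q
    by (simp add: mult.assoc)
  show "U ^ i * E A = (\<Sum>B\<in>?P. (t B - a) ^ i *\<^sub>C E B)"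
    unfolding U by (simp add: scaleC_one_power scaleC_mult_left)
  have "U ^ i * V ^ q * E A = (\<Sum>B\<in>?P. (t B - a) ^ i *\<^sub>C ((X - t B *\<^sub>C 1) ^ q * E B))" for i q
    unfolding UV U V using partition_sum_mult[OF fin, of "\<lambda>B. (X - t B *\<^sub>C 1) ^ q" "\<lambda>B. ((t B - a) *\<^sub>C 1) ^ i"] cV
    by (simp add: scaleC_one_power scaleC_mult_left)
  then show "monomial_sum A a k j (P, t) = (\<Sum>q<k. of_nat (j choose q) *\<^sub>C (U ^ (j - q) * V ^ q * E A))"
    unfolding monomial_sum_def
    by (simp add: scaleC_sum_right scaleC_scaleC) (rule sum.swap)
qed

lemma eventually_local_cells':
  assumes A: "A \<in> borel_subsets \<sigma>" and \<delta>: "\<delta> > 0"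
  shows "\<forall>\<^sub>F p in tagged_partitions \<sigma>. borel_partition A {B \<in> fst p. B \<subseteq> A} \<and>
    tagged {B \<in> fst p. B \<subseteq> A} (snd p) \<and> fine_cells \<delta> {B \<in> fst p. B \<subseteq> A}"
  using eventually_local_cells[OF A \<delta>] by (rule eventually_mono) (auto simp: tagged_def)

text \<open>In norm, \<open>U\<close> tends to \<open>x\<close> and \<open>V\<close> to
  \<open>y\<close>; these limits commute and add up to \<open>(X - a *\<^sub>C 1) * E A\<close>.
  Since \<open>y ^ k = 0\<close>, the truncated sum in the limit is the complete binomial expansion
  of their sum.\<close>

lemma tendsto_monomial_sum:
  assumes A: "A \<in> borel_subsets \<sigma>" and k: "1 \<le> k" "\<And>\<mu>. \<mu> \<in> A \<Longrightarrow> m \<mu> \<le> k"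
  shows "(monomial_sum A a k j \<longlongrightarrow> (X - a *\<^sub>C 1) ^ j * E A) (tagged_partitions \<sigma>)"
proof -
  let ?F = "tagged_partitions \<sigma>"
  define U where "U p = (\<Sum>B\<in>{B \<in> fst p. B \<subseteq> A}. ((snd p B - a) *\<^sub>C 1) * E B)"
    for p :: "complex set set \<times> (complex set \<Rightarrow> complex)"
  define V where "V p = (\<Sum>B\<in>{B \<in> fst p. B \<subseteq> A}. (X - snd p B *\<^sub>C 1) * E B)"
    for p :: "complex set set \<times> (complex set \<Rightarrow> complex)"
  define x where "x = scalar_part A - a *\<^sub>C E A"
  define y where "y = nil_part A"
  note ev = eventually_local_cells'[OF A]
  have V: "(V \<longlongrightarrow> y) ?F" unfolding V_def y_def by (rule tendsto_nil_part[OF A ev])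
  have U: "(U \<longlongrightarrow> x) ?F"
  proof (rule Lim_transform_eventually)
    show "((\<lambda>p. (\<Sum>B\<in>{B \<in> fst p. B \<subseteq> A}. snd p B *\<^sub>C E B) - a *\<^sub>C E A) \<longlongrightarrow> x) ?F"
      unfolding x_def by (intro tendsto_intros tendsto_scalar_part[OF A ev])
    show "\<forall>\<^sub>F p in ?F. (\<Sum>B\<in>{B \<in> fst p. B \<subseteq> A}. snd p B *\<^sub>C E B) - a *\<^sub>C E A = U p"
      using ev[OF zero_less_one]
      by (rule eventually_mono)
        (auto simp: U_def sum_partition[OF A, symmetric] scaleC_sum_right scaleC_mult_left
          scaleC_diff_left left_diff_distrib sum_subtractf)
  qed
  have EE: "E A * E A = E A" using mult[OF A A] by simp
  have sE: "E A * scalar_part A = scalar_part A * E A"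
    using mult A by (intro scalar_part_commute) (auto simp: Int_commute)
  have sX: "X * scalar_part A = scalar_part A * X"
    using commute by (intro scalar_part_commute A)
  have xy: "x * y = y * x"
  proof -
    have "scalar_part A * (X * E A) = X * E A * scalar_part A"
      using sE sX by (metis mult.assoc)
    moreover have "E A * (X * E A) = X * E A * E A"
      using commute[OF A] by (simp add: mult.assoc)
    ultimately show ?thesis
      using sE by (simp add: x_def y_def nil_part_def algebra_simps scaleC_mult_left scaleC_mult_right
          flip: scaleC_add_right)
  qed
  have sum: "x + y = (X - a *\<^sub>C 1) * E A"
    by (simp add: x_def y_def nil_part_def algebra_simps scaleC_mult_left)
  have y0: "y ^ q = 0" if "q \<ge> k" for q
  proof -
    have "y ^ k = 0" unfolding y_def by (rule nil_part_power[OF A k])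
    then show ?thesis using that by (metis le_add_diff_inverse mult_zero_left power_add)
  qed
  \<comment> \<open>The projection commutes with \<open>X\<close> and is idempotent, so it can be
    collected on the right; the extra factor \<open>E A\<close> accounts for
    \<open>j = 0\<close>.\<close>
  have "((X - a *\<^sub>C 1) * E A) ^ j * E A = (X - a *\<^sub>C 1) ^ j * E A"
  proof (induction j)
    case (Suc j)
    have "((X - a *\<^sub>C 1) * E A) ^ Suc j * E A = (X - a *\<^sub>C 1) * (E A * ((X - a *\<^sub>C 1) ^ j * E A))"
      by (simp add: mult.assoc Suc)
    also have "E A * ((X - a *\<^sub>C 1) ^ j * E A) = (X - a *\<^sub>C 1) ^ j * E A"
      using commute_shift[OF A] EE by (metis mult.assoc)
    finally show ?case by (simp add: mult.assoc)
  qed simp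
  then have "(X - a *\<^sub>C 1) ^ j * E A = (\<Sum>q\<le>j. of_nat (j choose q) *\<^sub>C (x ^ (j - q) * y ^ q)) * E A"
    by (simp flip: sum add: binomial_commuting[OF xy])
  also have "\<dots> = (\<Sum>q\<le>j. of_nat (j choose q) *\<^sub>C (x ^ (j - q) * y ^ q * E A))"
    by (simp add: sum_distrib_right scaleC_mult_left)
  \<comment> \<open>The ranges differ only in zero terms: the power of \<open>y\<close> vanishes
    from \<open>k\<close> on, and the binomial coefficient vanishes beyond \<open>j\<close>.\<close>
  also have "\<dots> = (\<Sum>q<k. of_nat (j choose q) *\<^sub>C (x ^ (j - q) * y ^ q * E A))"
    by (rule sum.mono_neutral_cong) (auto simp: y0 not_le not_less binomial_eq_0)
  finally have lim_eq: "(\<Sum>q<k. of_nat (j choose q) *\<^sub>C (x ^ (j - q) * y ^ q * E A)) = (X - a *\<^sub>C 1) ^ j * E A"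
    by simp
  show ?thesis
  proof (rule Lim_transform_eventually)
    show "((\<lambda>p. \<Sum>q<k. of_nat (j choose q) *\<^sub>C (U p ^ (j - q) * V p ^ q * E A)) \<longlongrightarrow>
        (X - a *\<^sub>C 1) ^ j * E A) ?F"
      unfolding lim_eq[symmetric]
      by (intro tendsto_sum bounded_linear.tendsto[OF bounded_linear_scaleC_right] tendsto_mult
          tendsto_power U V tendsto_const)
    show "\<forall>\<^sub>F p in ?F. (\<Sum>q<k. of_nat (j choose q) *\<^sub>C (U p ^ (j - q) * V p ^ q * E A)) = monomial_sum A a k j p"
      using ev[OF zero_less_one]
    proof (rule eventually_mono)
      fix p :: "complex set set \<times> (complex set \<Rightarrow> complex)"
      assume "borel_partition A {B \<in> fst p. B \<subseteq> A} \<and>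
        tagged {B \<in> fst p. B \<subseteq> A} (snd p) \<and> fine_cells 1 {B \<in> fst p. B \<subseteq> A}"
      then show "(\<Sum>q<k. of_nat (j choose q) *\<^sub>C (U p ^ (j - q) * V p ^ q * E A)) = monomial_sum A a k j p"
        using monomial_sum_eq(1)[OF A, of "fst p" a k j "snd p"] by (simp add: U_def V_def)
    qed
  qed
qed

text \<open>Submultiplicativity would bound the powers of \<open>U\<close> only geometrically with
  ratio \<open>4 * \<rho> * M\<close>, which may exceed the radius of the series. Instead,
  \<open>U ^ i * E A\<close> is itself a Riemann sum with coefficients of modulus at most
  \<open>\<rho> ^ i\<close>, so the constant \<open>4 * M\<close> enters once. Only the first
  \<open>k\<close> powers of \<open>V\<close> occur, and their bounds go into
  \<open>K\<close>.\<close>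

lemma monomial_sum_bound:
  assumes A: "A \<in> borel_subsets \<sigma>" "A \<subseteq> cball a \<rho>" and \<rho>: "0 \<le> \<rho>" "\<rho> < r"
  shows "\<exists>K\<ge>0. \<forall>\<^sub>F p in tagged_partitions \<sigma>. \<forall>j. norm (monomial_sum A a k j p) \<le> K * r ^ j"
proof -
  \<comment> \<open>A bound for \<open>V\<close>, written below as
    \<open>X * E A - a *\<^sub>C E A - U ^ 1 * E A\<close>, that does not depend on the
    partition.\<close>
  define C where "C = norm X * M + cmod a * M + 4 * \<rho> * M"
  define K where "K = (\<Sum>q<k. (4 * M) * (C ^ q * M) * (1 / (r - \<rho>)) ^ q)"
  have C0: "0 \<le> C" unfolding C_def using M(1) \<rho> by simp
  have "\<forall>\<^sub>F p in tagged_partitions \<sigma>. \<forall>j. norm (monomial_sum A a k j p) \<le> K * r ^ j"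
    using eventually_local_cells'[OF A(1) zero_less_one]
  proof (rule eventually_mono, intro allI)
    fix p :: "complex set set \<times> (complex set \<Rightarrow> complex)" and j
    assume p: "borel_partition A {B \<in> fst p. B \<subseteq> A} \<and>
        tagged {B \<in> fst p. B \<subseteq> A} (snd p) \<and> fine_cells 1 {B \<in> fst p. B \<subseteq> A}"
    obtain P t where pt: "p = (P, t)" by fastforce
    let ?P = "{B \<in> P. B \<subseteq> A}"
    have P: "borel_partition A ?P" "tagged ?P t" using p by (auto simp: pt)
    have PS: "B \<in> borel_subsets \<sigma>" if "B \<in> ?P" for B
      using that P borel_subsets_trans[OF A(1)] unfolding borel_partition_def by blast
    define U where "U = (\<Sum>B\<in>?P. ((t B - a) *\<^sub>C 1) * E B)"
    define V where "V = (\<Sum>B\<in>?P. (X - t B *\<^sub>C 1) * E B)"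
    note eq = monomial_sum_eq[OF A(1) P(1), where t = t and a = a, folded U_def V_def]
    have Ui: "norm (U ^ i * E A) \<le> 4 * \<rho> ^ i * M" for i
      unfolding eq(3)
    proof (rule norm_sum_scaleC_le)
      show "finite ?P" using P(1) by (simp add: borel_partition_def)
      fix B assume B: "B \<in> ?P"
      then have "t B \<in> A" using P(2) by (auto simp: tagged_def)
      then have "cmod (t B - a) \<le> \<rho>" using A(2) by (auto simp: dist_norm norm_minus_commute)
      then show "cmod ((t B - a) ^ i) \<le> \<rho> ^ i" by (simp add: norm_power power_mono)
    next
      fix J assume J: "J \<subseteq> ?P"
      have "finite ?P" "disjoint ?P" using P(1) by (auto simp: borel_partition_def partition_on_def)
      then have "finite J" "disjoint J" using J by (meson finite_subset pairwise_subset)+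
      then have J': "finite J" "J \<subseteq> borel_subsets \<sigma>" "disjoint_family_on id J"
        using J PS by (auto simp: disjoint_def disjoint_family_on_def)
      have "norm (E (\<Union>B\<in>J. id B)) \<le> M"
        using J' by (intro M(2) borel_subsets_UN) auto
      also have "E (\<Union>B\<in>J. id B) = sum E J"
        using J' by (subst UN) auto
      finally show "norm (sum E J) \<le> M" .
    qed (use \<rho> in auto)
    have Vn: "norm V \<le> C"
    proof -
      have V: "V = X * E A - a *\<^sub>C E A - U ^ 1 * E A"
        unfolding eq(3) by (simp add: V_def sum_partition[OF A(1) P(1), symmetric] sum_distrib_left
            scaleC_sum_right scaleC_diff_left left_diff_distrib sum_subtractf scaleC_mult_left)
      have "norm V \<le> norm (X * E A) + norm (a *\<^sub>C E A) + norm (U ^ 1 * E A)"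
        unfolding V by (meson add_mono norm_triangle_ineq4 order_trans order_refl)
      also have "\<dots> \<le> norm X * M + cmod a * M + 4 * \<rho> ^ 1 * M"
        by (intro add_mono Ui order_trans[OF norm_mult_ineq] order_trans[OF norm_scaleC] mult_left_mono M(2) A(1)) auto
      finally show ?thesis by (simp add: C_def)
    qed
    have Vq: "norm (V ^ q * E A) \<le> C ^ q * M" for q
      using Vn C0 M(2)[OF A(1)]
      by (intro order_trans[OF norm_mult_ineq] mult_mono order_trans[OF norm_power_bop] power_mono) auto
    have "norm (monomial_sum A a k j p) \<le> (\<Sum>q<k. norm (of_nat (j choose q) *\<^sub>C (U ^ (j - q) * V ^ q * E A)))"
      unfolding pt eq(1) by (rule norm_sum)
    also have "\<dots> \<le> (\<Sum>q<k. (4 * M) * (C ^ q * M) * (1 / (r - \<rho>)) ^ q * r ^ j)"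
    proof (rule sum_mono)
      fix q
      have "norm (of_nat (j choose q) *\<^sub>C (U ^ (j - q) * V ^ q * E A)) \<le>
          of_nat (j choose q) * norm ((U ^ (j - q) * E A) * (V ^ q * E A))"
        using norm_scaleC[of "of_nat (j choose q)"] by (simp add: eq(2))
      also have "\<dots> \<le> of_nat (j choose q) * ((4 * \<rho> ^ (j - q) * M) * (C ^ q * M))"
        by (intro mult_left_mono order_trans[OF norm_mult_ineq] mult_mono Ui Vq) (use \<rho> M(1) in auto)
      also have "\<dots> = (4 * M) * (C ^ q * M) * (of_nat (j choose q) * \<rho> ^ (j - q))" by (simp add: mult_ac)
      also have "\<dots> \<le> (4 * M) * (C ^ q * M) * ((1 / (r - \<rho>)) ^ q * r ^ j)"
      proof (rule mult_left_mono)
        show "of_nat (j choose q) * \<rho> ^ (j - q) \<le> (1 / (r - \<rho>)) ^ q * r ^ j"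
        proof (cases "q \<le> j")
          case True
          \<comment> \<open>A single nonnegative term of the expansion of
            \<open>((r - \<rho>) + \<rho>) ^ j\<close>.\<close>
          have "of_nat (j choose q) * (r - \<rho>) ^ q * \<rho> ^ (j - q) \<le>
              (\<Sum>i\<le>j. of_nat (j choose i) * (r - \<rho>) ^ i * \<rho> ^ (j - i))"
            using True \<rho> by (intro member_le_sum[where f = "\<lambda>i. of_nat (j choose i) * (r - \<rho>) ^ i * \<rho> ^ (j - i)"]) auto
          also have "\<dots> = r ^ j" using binomial_ring[of "r - \<rho>" \<rho> j] by simp
          finally show ?thesis using \<rho> by (simp add: field_simps power_divide)
        next
          case False
          then show ?thesis using \<rho> by (simp add: binomial_eq_0)
        qed
      qed (use M(1) C0 in auto)
      finally show "norm (of_nat (j choose q) *\<^sub>C (U ^ (j - q) * V ^ q * E A)) \<le>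
          (4 * M) * (C ^ q * M) * (1 / (r - \<rho>)) ^ q * r ^ j" by (simp add: mult_ac)
    qed
    also have "\<dots> = K * r ^ j" by (simp add: K_def sum_distrib_right)
    finally show "norm (monomial_sum A a k j p) \<le> K * r ^ j" .
  qed
  moreover have "K \<ge> 0" unfolding K_def using M(1) C0 \<rho> by (intro sum_nonneg) auto
  ultimately show ?thesis by blast
qed

end

section \<open>Double power series\<close>

text \<open>Truncated subtraction in the exponent is harmless: for \<open>q > e i\<close> the
  binomial coefficient is 0, as is the derivative.\<close>

lemma higher_deriv_monomial_sum:
  "(deriv ^^ q) (\<lambda>x::complex. \<Sum>i\<in>F. u i * (x - a) ^ e i) =
    (\<lambda>x. \<Sum>i\<in>F. u i * (fact q * of_nat (e i choose q) * (x - a) ^ (e i - q)))"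
proof (induction q)
  case (Suc q)
  have coeff: "fact q * of_nat (n choose q) * (of_nat (n - q) :: complex) = fact (Suc q) * of_nat (n choose Suc q)" for n
  proof -
    have "(n choose q) * (n - q) = Suc q * (n choose Suc q)"
    proof (cases n)
      case (Suc k)
      then show ?thesis
        using binomial_absorb_comp[of n q] Suc_times_binomial[of q k] by (simp add: mult.commute)
    qed simp
    then have "(of_nat (n choose q) * of_nat (n - q) :: complex) = of_nat (Suc q) * of_nat (n choose Suc q)"
      by (metis of_nat_mult)
    then show ?thesis by (simp add: mult.assoc)
  qed
  have "((\<lambda>x. \<Sum>i\<in>F. u i * (fact q * of_nat (e i choose q) * (x - a) ^ (e i - q))) has_field_derivative
      (\<Sum>i\<in>F. u i * (fact q * of_nat (e i choose q) * (of_nat (e i - q) * (x - a) ^ (e i - q - 1))))) (at x)" for x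
    by (auto intro!: DERIV_sum derivative_eq_intros)
  moreover have "fact q * of_nat (n choose q) * (of_nat (n - q) * y) =
      fact (Suc q) * of_nat (n choose Suc q) * y" for n and y :: complex
    by (simp only: mult.assoc[symmetric] coeff)
  ultimately have "((\<lambda>x. \<Sum>i\<in>F. u i * (fact q * of_nat (e i choose q) * (x - a) ^ (e i - q))) has_field_derivative
      (\<Sum>i\<in>F. u i * (fact (Suc q) * of_nat (e i choose Suc q) * (x - a) ^ (e i - q - 1)))) (at x)" for x
    by simp
  then have "deriv (\<lambda>x. \<Sum>i\<in>F. u i * (fact q * of_nat (e i choose q) * (x - a) ^ (e i - q))) x =
      (\<Sum>i\<in>F. u i * (fact (Suc q) * of_nat (e i choose Suc q) * (x - a) ^ (e i - Suc q)))" for x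
    using DERIV_imp_deriv by fastforce
  then show ?case by (simp add: Suc del: fact_Suc)
qed simp

text \<open>By the Weierstrass test the finite partial sums converge uniformly on a smaller disc,
  where holomorphic limits may be differentiated. The index type is free and \<open>e\<close> need
  not be injective, because a double series is treated as a series in one variable indexed by
  pairs.\<close>

lemma has_sum_higher_deriv:
  fixes u :: "'i \<Rightarrow> complex" and e :: "'i \<Rightarrow> nat"
  assumes f: "\<And>z. z \<in> ball a r \<Longrightarrow> ((\<lambda>i. u i * (z - a) ^ e i) has_sum f z) I" and z: "z \<in> ball a r"
  shows "((\<lambda>i. u i * (fact q * of_nat (e i choose q) * (z - a) ^ (e i - q))) has_sum (deriv ^^ q) f z) I"
proof -
  obtain \<rho> where \<rho>: "dist a z < \<rho>" "\<rho> < r" using z dense by (auto simp: mem_ball)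
  then have \<rho>0: "0 < \<rho>" using zero_le_dist[of a z] by linarith
  \<comment> \<open>The single point \<open>a + of_real \<rho>\<close> supplies the majorant, since
    unconditional summability of complex families is absolute.\<close>
  have "(\<lambda>i. u i * (complex_of_real \<rho>) ^ e i) summable_on I"
    using f[of "a + of_real \<rho>"] \<rho> \<rho>0 by (auto simp: dist_norm summable_on_def)
  then have dom: "(\<lambda>i. cmod (u i * complex_of_real \<rho> ^ e i)) summable_on I"
    by (simp add: summable_on_iff_abs_summable_on_complex)
  have "uniform_limit (ball a \<rho>) (\<lambda>F x. \<Sum>i\<in>F. u i * (x - a) ^ e i) f (finite_subsets_at_top I)"
  proof (rule Weierstrass_m_test_general'[OF _ _ dom])
    fix i x assume x: "x \<in> ball a \<rho>"
    then have "cmod (x - a) ^ e i \<le> \<rho> ^ e i" by (intro power_mono) (auto simp: dist_norm norm_minus_commute)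
    then show "cmod (u i * (x - a) ^ e i) \<le> cmod (u i * complex_of_real \<rho> ^ e i)"
      using \<rho>0 by (simp add: norm_mult norm_power mult_left_mono)
  next
    fix x assume "x \<in> ball a \<rho>"
    then show "((\<lambda>i. u i * (x - a) ^ e i) has_sum f x) I" using \<rho> by (intro f) auto
  qed
  then have "((\<lambda>F. (deriv ^^ q) (\<lambda>x. \<Sum>i\<in>F. u i * (x - a) ^ e i) z) \<longlongrightarrow> (deriv ^^ q) f z) (finite_subsets_at_top I)"
    by (rule higher_deriv_complex_uniform_limit)
      (use \<rho> in \<open>auto intro!: holomorphic_intros always_eventually\<close>)
  then show ?thesis by (simp add: has_sum_def higher_deriv_monomial_sum)
qed

definition series_at ::
  "(nat \<times> nat \<Rightarrow> complex) \<Rightarrow> complex \<Rightarrow> complex \<Rightarrow> real \<Rightarrow> (complex \<times> complex \<Rightarrow> complex) \<Rightarrow> bool"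
  where "series_at c a b r \<beta> \<longleftrightarrow> (\<forall>z\<in>ball a r. \<forall>w\<in>ball b r.
    ((\<lambda>(j, k). c (j, k) * (z - a) ^ j * (w - b) ^ k) has_sum \<beta> (z, w)) UNIV)"

lemma series_at_mono: "series_at c a b r \<beta> \<Longrightarrow> s \<le> r \<Longrightarrow> series_at c a b s \<beta>"
  by (auto simp: series_at_def)

lemma series_atD:
  "series_at c a b r \<beta> \<Longrightarrow> z \<in> ball a r \<Longrightarrow> w \<in> ball b r \<Longrightarrow>
    ((\<lambda>(j, k). c (j, k) * (z - a) ^ j * (w - b) ^ k) has_sum \<beta> (z, w)) UNIV"
  by (auto simp: series_at_def)

lemma bianalytic_on_series_at:
  "bianalytic_on \<beta> D \<Longrightarrow> (a, b) \<in> D \<Longrightarrow> \<exists>r>0. \<exists>c. series_at c a b r \<beta>"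
  by (auto simp: bianalytic_on_def series_at_def)

text \<open>One variable at a time: with the first argument fixed the series is differentiated in
  the second, and the resulting factors join the coefficients for the differentiation in the
  first.\<close>

lemma series_at_partial_deriv:
  assumes \<beta>: "series_at c a b r \<beta>" and z: "z \<in> ball a r" and w: "w \<in> ball b r"
  shows "((\<lambda>(j, k). c (j, k) * ((of_nat (j choose q\<^sub>1) * (z - a) ^ (j - q\<^sub>1)) *
      (of_nat (k choose q\<^sub>2) * (w - b) ^ (k - q\<^sub>2)))) has_sum
      (partial_deriv q\<^sub>1 q\<^sub>2 \<beta> z w / (fact q\<^sub>1 * fact q\<^sub>2))) UNIV"
proof -
  have 1: "((\<lambda>p. (c p * (fact q\<^sub>2 * of_nat (snd p choose q\<^sub>2) * (w - b) ^ (snd p - q\<^sub>2))) * (z' - a) ^ fst p)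
      has_sum (deriv ^^ q\<^sub>2) (\<lambda>w'. \<beta> (z', w')) w) UNIV" if z': "z' \<in> ball a r" for z'
  proof -
    have "((\<lambda>p. (c p * (z' - a) ^ fst p) * (w' - b) ^ snd p) has_sum \<beta> (z', w')) UNIV"
      if "w' \<in> ball b r" for w'
      using series_atD[OF \<beta> z' that] by (simp add: case_prod_unfold)
    from has_sum_higher_deriv[OF this w] show ?thesis by (simp add: mult_ac)
  qed
  from has_sum_higher_deriv[OF this z]
  have "((\<lambda>p. (c p * (fact q\<^sub>2 * of_nat (snd p choose q\<^sub>2) * (w - b) ^ (snd p - q\<^sub>2))) *
      (fact q\<^sub>1 * of_nat (fst p choose q\<^sub>1) * (z - a) ^ (fst p - q\<^sub>1))) has_sum partial_deriv q\<^sub>1 q\<^sub>2 \<beta> z w) UNIV"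
    by (simp add: partial_deriv_def)
  from has_sum_cmult_left[OF this, of "1 / (fact q\<^sub>1 * fact q\<^sub>2)"] show ?thesis
    by (simp add: case_prod_unfold mult_ac)
qed

lemma series_at_abs_summable:
  assumes "series_at c a b r \<beta>" "0 \<le> s" "s < r"
  shows "(\<lambda>p. cmod (c p) * (s ^ fst p * s ^ snd p)) summable_on UNIV"
proof -
  have "((\<lambda>(j, k). c (j, k) * of_real s ^ j * of_real s ^ k) has_sum \<beta> (a + of_real s, b + of_real s)) UNIV"
    using series_atD[OF assms(1), of "a + of_real s" "b + of_real s"] assms(2,3) by (simp add: dist_norm)
  then have "(\<lambda>p. c p * of_real s ^ fst p * of_real s ^ snd p) summable_on UNIV"
    by (auto simp: summable_on_def case_prod_unfold)
  then have "(\<lambda>p. cmod (c p * of_real s ^ fst p * of_real s ^ snd p)) summable_on UNIV"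
    by (simp add: summable_on_iff_abs_summable_on_complex)
  then show ?thesis using assms(2) by (simp add: norm_mult norm_power mult.assoc)
qed

lemma series_at_lincomb:
  assumes "series_at c a b r \<beta>" "series_at d a b r \<gamma>"
  shows "series_at (\<lambda>p. u * c p + v * d p) a b r (\<lambda>p. u * \<beta> p + v * \<gamma> p)"
  unfolding series_at_def
proof (intro ballI)
  fix z w assume z: "z \<in> ball a r" "w \<in> ball b r"
  from has_sum_add[OF has_sum_cmult_right[OF series_atD[OF assms(1) z], of u]
      has_sum_cmult_right[OF series_atD[OF assms(2) z], of v]]
  show "((\<lambda>(j, k). (u * c (j, k) + v * d (j, k)) * (z - a) ^ j * (w - b) ^ k) has_sum
      (u * \<beta> (z, w) + v * \<gamma> (z, w))) UNIV"
    by (simp add: case_prod_unfold algebra_simps)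
qed

text \<open>Linearity of iterated \<open>deriv\<close> would call for differentiability at every
  stage; it is read off from the common expansion by uniqueness of sums.\<close>

lemma partial_deriv_lincomb:
  assumes \<beta>: "bianalytic_on \<beta> D" and \<gamma>: "bianalytic_on \<gamma> D" and ab: "(a, b) \<in> D"
  shows "partial_deriv q\<^sub>1 q\<^sub>2 (\<lambda>p. u * \<beta> p + v * \<gamma> p) a b =
    u * partial_deriv q\<^sub>1 q\<^sub>2 \<beta> a b + v * partial_deriv q\<^sub>1 q\<^sub>2 \<gamma> a b"
proof -
  obtain r c s d where r: "r > 0" "series_at c a b r \<beta>" and s: "s > 0" "series_at d a b s \<gamma>"
    using bianalytic_on_series_at[OF \<beta> ab] bianalytic_on_series_at[OF \<gamma> ab] by blast
  define t where "t = min r s"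
  have t: "a \<in> ball a t" "b \<in> ball b t" "series_at c a b t \<beta>" "series_at d a b t \<gamma>"
    using r s by (auto simp: t_def intro: series_at_mono)
  note ser = series_at_partial_deriv[OF _ t(1,2), of _ _ q\<^sub>1 q\<^sub>2]
  have "partial_deriv q\<^sub>1 q\<^sub>2 (\<lambda>p. u * \<beta> p + v * \<gamma> p) a b / (fact q\<^sub>1 * fact q\<^sub>2) =
      u * (partial_deriv q\<^sub>1 q\<^sub>2 \<beta> a b / (fact q\<^sub>1 * fact q\<^sub>2)) + v * (partial_deriv q\<^sub>1 q\<^sub>2 \<gamma> a b / (fact q\<^sub>1 * fact q\<^sub>2))"
    by (rule has_sum_unique[OF ser[OF series_at_lincomb[OF t(3,4)]]])
      (use has_sum_add[OF has_sum_cmult_right[OF ser[OF t(3)], of u] has_sum_cmult_right[OF ser[OF t(4)], of v]]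
        in \<open>simp add: case_prod_unfold algebra_simps\<close>)
  then show ?thesis by (simp add: field_simps)
qed

section \<open>Cauchy products of double series\<close>

text \<open>The coefficients of a product of two double power series. The box consists of the
  \<open>p\<close> below \<open>n\<close> componentwise, so \<open>n - p\<close> is a true
  difference.\<close>

definition convolution :: "(nat \<times> nat \<Rightarrow> complex) \<Rightarrow> (nat \<times> nat \<Rightarrow> complex) \<Rightarrow> nat \<times> nat \<Rightarrow> complex"
  where "convolution c d n = (\<Sum>p\<in>{..fst n} \<times> {..snd n}. c p * d (n - p))"

text \<open>The pairs are regrouped by \<open>n = p + q\<close>. A family \<open>h\<close> evaluated
  at \<open>p + q\<close> stands in place of a product, since besides scalar monomials it has to
  cover powers placed on the two sides of a fixed operator, which are not multiplicative in the
  exponents.\<close>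

lemma has_sum_convolution:
  fixes h :: "nat \<times> nat \<Rightarrow> 'b::{banach, complex_vector}"
  assumes inner: "\<And>p. ((\<lambda>q. (c p * d q) *\<^sub>C h (p + q)) has_sum u p) UNIV"
    and outer: "(u has_sum T) UNIV"
    and summable: "(\<lambda>(p, q). (c p * d q) *\<^sub>C h (p + q)) summable_on UNIV \<times> UNIV"
  shows "((\<lambda>n. convolution c d n *\<^sub>C h n) has_sum T) UNIV"
proof -
  let ?B = "\<lambda>n::nat \<times> nat. {..fst n} \<times> {..snd n}"
  have total: "((\<lambda>(p, q). (c p * d q) *\<^sub>C h (p + q)) has_sum T) (UNIV \<times> UNIV)"
    using inner outer summable by (intro has_sum_SigmaI) auto
  have "((\<lambda>(n, p). (c p * d (n - p)) *\<^sub>C h n) has_sum T) (Sigma UNIV ?B)"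
    by (rule has_sum_reindex_bij_witness[where i = "\<lambda>(p, q). (p + q, p)" and j = "\<lambda>(n, p). (p, n - p)",
          THEN iffD2, OF _ _ _ _ _ refl total]) (auto simp: plus_prod_def minus_prod_def)
  then show ?thesis
  proof (rule has_sum_SigmaD)
    fix n
    have "((\<lambda>p. (c p * d (n - p)) *\<^sub>C h n) has_sum (\<Sum>p\<in>?B n. (c p * d (n - p)) *\<^sub>C h n)) (?B n)"
      by (intro has_sum_finite) auto
    then show "((\<lambda>p. (\<lambda>(n, p). (c p * d (n - p)) *\<^sub>C h n) (n, p)) has_sum (convolution c d n *\<^sub>C h n)) (?B n)"
      by (simp add: convolution_def scaleC_sum_left)
  qed
qed

lemma summable_on_prod_times:
  fixes f :: "'i \<Rightarrow> real" and g :: "'j \<Rightarrow> real"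
  assumes f: "f summable_on A" and g: "g summable_on B" and nonneg: "\<And>x. 0 \<le> f x" "\<And>y. 0 \<le> g y"
  shows "(\<lambda>(x, y). f x * g y) summable_on A \<times> B"
proof (rule summable_on_SigmaI)
  show "((\<lambda>y. case (x, y) of (x, y) \<Rightarrow> f x * g y) has_sum f x * infsum g B) B" for x
    using g by (auto intro: has_sum_cmult_right)
  show "(\<lambda>x. f x * infsum g B) summable_on A" by (rule summable_on_cmult_left[OF f])
qed (use nonneg in auto)

text \<open>The bound is imposed on \<open>u *\<^sub>C h n\<close> and not on \<open>h n\<close>,
  because the sort of \<open>'b\<close> does not relate the norm to complex scaling.\<close>

lemma summable_on_convolution:
  fixes h :: "nat \<times> nat \<Rightarrow> 'b::{banach, complex_vector}"
  assumes c: "series_at c a b r \<beta>" and d: "series_at d a b r \<gamma>" and s: "0 \<le> s" "s < r"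
    and K: "0 \<le> K"
    and bound: "\<And>u n. norm (u *\<^sub>C h n) \<le> cmod u * (K * (s ^ fst n * s ^ snd n))"
  shows "(\<lambda>(p, q). (c p * d q) *\<^sub>C h (p + q)) summable_on UNIV \<times> UNIV"
proof -
  let ?f = "\<lambda>c p. cmod (c p) * (s ^ fst p * s ^ snd p)"
  have "(\<lambda>(p, q). ?f c p * (K * ?f d q)) summable_on UNIV \<times> UNIV"
    using series_at_abs_summable[OF c s] series_at_abs_summable[OF d s] s K
    by (intro summable_on_prod_times summable_on_cmult_right) auto
  then have "(\<lambda>x. norm (case x of (p, q) \<Rightarrow> (c p * d q) *\<^sub>C h (p + q))) summable_on UNIV \<times> UNIV"
  proof (rule Infinite_Sum.abs_summable_on_comparison_test')
    fix x :: "(nat \<times> nat) \<times> (nat \<times> nat)"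
    obtain p q where x: "x = (p, q)" by (rule prod.exhaust)
    show "norm (case x of (p, q) \<Rightarrow> (c p * d q) *\<^sub>C h (p + q)) \<le> (case x of (p, q) \<Rightarrow> ?f c p * (K * ?f d q))"
      using bound[of "c p * d q" "p + q"] by (simp add: x norm_mult power_add mult_ac)
  qed
  then show ?thesis by (rule abs_summable_summable)
qed

lemma series_at_convolution:
  assumes c: "series_at c a b r \<beta>" and d: "series_at d a b r \<gamma>"
  shows "series_at (convolution c d) a b r (\<lambda>p. \<beta> p * \<gamma> p)"
  unfolding series_at_def
proof (intro ballI)
  fix z w assume z: "z \<in> ball a r" "w \<in> ball b r"
  define h where "h p = (z - a) ^ fst p * (w - b) ^ snd p" for p :: "nat \<times> nat"
  define s where "s = max (cmod (z - a)) (cmod (w - b))"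
  have s: "0 \<le> s" "s < r" using z by (auto simp: s_def dist_norm norm_minus_commute max_def)
  have le: "cmod (z - a) \<le> s" "cmod (w - b) \<le> s" by (simp_all add: s_def)
  have h: "h (p + q) = h p * h q" for p q by (simp add: h_def power_add)
  have bound: "norm (u *\<^sub>C h n) \<le> cmod u * (1 * (s ^ fst n * s ^ snd n))" for u n
    unfolding scaleC_complex_def norm_mult h_def norm_power mult_1_left
    using s(1) le by (intro mult_left_mono mult_mono power_mono) auto
  have \<beta>: "((\<lambda>p. c p * h p) has_sum \<beta> (z, w)) UNIV"
    using series_atD[OF c z] by (simp add: case_prod_unfold h_def mult.assoc)
  have \<gamma>: "((\<lambda>p. d p * h p) has_sum \<gamma> (z, w)) UNIV"
    using series_atD[OF d z] by (simp add: case_prod_unfold h_def mult.assoc)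
  have "((\<lambda>n. convolution c d n *\<^sub>C h n) has_sum \<beta> (z, w) * \<gamma> (z, w)) UNIV"
  proof (rule has_sum_convolution)
    show "((\<lambda>q. (c p * d q) *\<^sub>C h (p + q)) has_sum (c p * h p) * \<gamma> (z, w)) UNIV" for p
      using has_sum_cmult_right[OF \<gamma>, of "c p * h p"] by (simp add: scaleC_complex_def h mult_ac)
    show "((\<lambda>p. (c p * h p) * \<gamma> (z, w)) has_sum \<beta> (z, w) * \<gamma> (z, w)) UNIV"
      by (rule has_sum_cmult_left[OF \<beta>])
    show "(\<lambda>(p, q). (c p * d q) *\<^sub>C h (p + q)) summable_on UNIV \<times> UNIV"
      by (rule summable_on_convolution[OF c d s zero_le_one bound])
  qed
  then show "((\<lambda>(j, k). convolution c d (j, k) * (z - a) ^ j * (w - b) ^ k) has_sum \<beta> (z, w) * \<gamma> (z, w)) UNIV"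
    by (simp add: case_prod_unfold h_def scaleC_complex_def mult.assoc)
qed

lemma has_sum_sum_finite:
  fixes f :: "'i \<Rightarrow> 'j \<Rightarrow> 'b::topological_comm_monoid_add"
  shows "(\<And>i. i \<in> I \<Longrightarrow> (f i has_sum s i) A) \<Longrightarrow> ((\<lambda>x. \<Sum>i\<in>I. f i x) has_sum (\<Sum>i\<in>I. s i)) A"
  by (induction I rule: infinite_finite_induct) (auto intro: has_sum_add has_sum_0)

section \<open>Double operator integrals\<close>

definition gdoi_sum ::
  "'a::chilbert_space bop \<Rightarrow> (complex set \<Rightarrow> 'a bop) \<Rightarrow> (complex \<Rightarrow> nat) \<Rightarrow>
   'a bop \<Rightarrow> (complex set \<Rightarrow> 'a bop) \<Rightarrow> (complex \<Rightarrow> nat) \<Rightarrow>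
   (complex \<times> complex \<Rightarrow> complex) \<Rightarrow> 'a bop \<Rightarrow>
   (complex set set \<times> (complex set \<Rightarrow> complex)) \<times> (complex set set \<times> (complex set \<Rightarrow> complex)) \<Rightarrow> 'a bop"
  where "gdoi_sum X\<^sub>1 E\<^sub>1 m\<^sub>1 X\<^sub>2 E\<^sub>2 m\<^sub>2 \<beta> Y p = (\<Sum>A\<in>fst (fst p). \<Sum>B\<in>fst (snd p).
    gdoi_integrand X\<^sub>1 E\<^sub>1 m\<^sub>1 X\<^sub>2 E\<^sub>2 m\<^sub>2 \<beta> Y (snd (fst p) A) A (snd (snd p) B) B)"

lemma has_gdoi_iff:
  "has_gdoi X\<^sub>1 E\<^sub>1 m\<^sub>1 X\<^sub>2 E\<^sub>2 m\<^sub>2 \<beta> Y T \<longleftrightarrow>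
    (\<forall>x. ((\<lambda>p. app (gdoi_sum X\<^sub>1 E\<^sub>1 m\<^sub>1 X\<^sub>2 E\<^sub>2 m\<^sub>2 \<beta> Y p) x) \<longlongrightarrow> app T x)
      (tagged_partitions (spectrum X\<^sub>1) \<times>\<^sub>F tagged_partitions (spectrum X\<^sub>2)))"
  by (simp add: has_gdoi_def gdoi_sum_def case_prod_unfold)

lemma gdoi_eq: "has_gdoi X\<^sub>1 E\<^sub>1 m\<^sub>1 X\<^sub>2 E\<^sub>2 m\<^sub>2 \<beta> Y T \<Longrightarrow> gdoi X\<^sub>1 E\<^sub>1 m\<^sub>1 X\<^sub>2 E\<^sub>2 m\<^sub>2 \<beta> Y = T"
  unfolding gdoi_def using has_gdoi_unique by blast

lemma has_gdoi_gdoi: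
  "gdoi_well_defined X\<^sub>1 E\<^sub>1 m\<^sub>1 X\<^sub>2 E\<^sub>2 m\<^sub>2 \<beta> \<Longrightarrow>
    has_gdoi X\<^sub>1 E\<^sub>1 m\<^sub>1 X\<^sub>2 E\<^sub>2 m\<^sub>2 \<beta> Y (gdoi X\<^sub>1 E\<^sub>1 m\<^sub>1 X\<^sub>2 E\<^sub>2 m\<^sub>2 \<beta> Y)"
  unfolding gdoi_well_defined_def using gdoi_eq by metis

context spectral_dec
begin

lemma eventually_cells:
  "\<forall>\<^sub>F p in tagged_partitions \<sigma>. finite (fst p) \<and> fst p \<subseteq> borel_subsets \<sigma> \<and> (\<forall>A\<in>fst p. snd p A \<in> \<sigma>)"
  using eventually_fine_cells[OF borel zero_less_one]
proof (rule eventually_mono)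
  fix p :: "complex set set \<times> (complex set \<Rightarrow> complex)"
  assume "case p of (P, t) \<Rightarrow> borel_partition \<sigma> P \<and> tagged P t \<and> fine_cells 1 P"
  then have p: "borel_partition \<sigma> (fst p)" "tagged (fst p) (snd p)" by auto
  then have "snd p A \<in> \<sigma>" if "A \<in> fst p" for A
    using that unfolding tagged_def borel_partition_def borel_subsets_def by blast
  with p show "finite (fst p) \<and> fst p \<subseteq> borel_subsets \<sigma> \<and> (\<forall>A\<in>fst p. snd p A \<in> \<sigma>)"
    by (auto simp: borel_partition_def)
qed

lemma level_sums:
  assumes A: "A \<in> borel_subsets \<sigma>"
  shows "(\<lambda>k. app (E (A \<inter> {\<mu> \<in> \<sigma>. m \<mu> = k})) x) sums app (E A) x"
proof -
  have "(\<lambda>k. app (E (A \<inter> {\<mu> \<in> \<sigma>. m \<mu> = k})) x) sums app (E (\<Union>k. A \<inter> {\<mu> \<in> \<sigma>. m \<mu> = k})) x"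
    by (intro sums borel_subsets_Int A level_set_borel) (auto simp: disjoint_family_on_def)
  also have "(\<Union>k. A \<inter> {\<mu> \<in> \<sigma>. m \<mu> = k}) = A" using A by (auto simp: borel_subsets_def)
  finally show ?thesis .
qed

lemma order_ge_1: "\<mu> \<in> \<sigma> \<Longrightarrow> 1 \<le> m \<mu>"
  using dec by (simp add: spectral_decomposition_def Let_def)

lemma norm_localized_power_le:
  assumes A: "A \<in> borel_subsets \<sigma>" and k: "1 \<le> k" "\<And>\<mu>. \<mu> \<in> A \<Longrightarrow> m \<mu> \<le> k"
    and bound: "\<forall>\<^sub>F p in tagged_partitions \<sigma>. \<forall>j. norm (monomial_sum A a k j p) \<le> K * r ^ j"
  shows "norm ((X - a *\<^sub>C 1) ^ j * E A) \<le> K * r ^ j"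
  by (rule tendsto_upperbound[OF tendsto_norm[OF tendsto_monomial_sum[OF A k]]])
    (use bound tagged_partitions_neq_bot in \<open>auto elim: eventually_mono\<close>)

end

locale spectral_dec_pair =
  one: spectral_dec X\<^sub>1 E\<^sub>1 m\<^sub>1 + two: spectral_dec X\<^sub>2 E\<^sub>2 m\<^sub>2
  for X\<^sub>1 :: "'a::chilbert_space bop" and E\<^sub>1 m\<^sub>1 and X\<^sub>2 :: "'a bop" and E\<^sub>2 m\<^sub>2
begin

abbreviation "tags \<equiv> tagged_partitions (spectrum X\<^sub>1) \<times>\<^sub>F tagged_partitions (spectrum X\<^sub>2)"
abbreviation "integrand \<equiv> gdoi_integrand X\<^sub>1 E\<^sub>1 m\<^sub>1 X\<^sub>2 E\<^sub>2 m\<^sub>2"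
abbreviation "riemann_sum \<equiv> gdoi_sum X\<^sub>1 E\<^sub>1 m\<^sub>1 X\<^sub>2 E\<^sub>2 m\<^sub>2"
abbreviation "is_gdoi \<equiv> has_gdoi X\<^sub>1 E\<^sub>1 m\<^sub>1 X\<^sub>2 E\<^sub>2 m\<^sub>2"

lemma eventually_tags:
  assumes "\<forall>\<^sub>F p in tagged_partitions (spectrum X\<^sub>1). P p" "\<forall>\<^sub>F p in tagged_partitions (spectrum X\<^sub>2). Q p"
  shows "\<forall>\<^sub>F p in tags. P (fst p) \<and> Q (snd p)"
  by (rule eventually_conj[OF eventually_compose_filterlim[OF assms(1) filterlim_fst]
      eventually_compose_filterlim[OF assms(2) filterlim_snd]])

lemma integrand_restrict:
  assumes "A \<in> borel_subsets (spectrum X\<^sub>1)" "B \<in> borel_subsets (spectrum X\<^sub>2)"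
    and "A' \<in> borel_subsets (spectrum X\<^sub>1)" "B' \<in> borel_subsets (spectrum X\<^sub>2)"
  shows "integrand \<beta> (E\<^sub>1 A * Y * E\<^sub>2 B) \<mu> A' \<nu> B' = E\<^sub>1 A * integrand \<beta> Y \<mu> A' \<nu> B' * E\<^sub>2 B"
proof -
  have "(X\<^sub>1 - \<mu> *\<^sub>C 1) ^ q\<^sub>1 * E\<^sub>1 A' * (E\<^sub>1 A * Y * E\<^sub>2 B) * (X\<^sub>2 - \<nu> *\<^sub>C 1) ^ q\<^sub>2 * E\<^sub>2 B' =
      E\<^sub>1 A * ((X\<^sub>1 - \<mu> *\<^sub>C 1) ^ q\<^sub>1 * E\<^sub>1 A' * Y * (X\<^sub>2 - \<nu> *\<^sub>C 1) ^ q\<^sub>2 * E\<^sub>2 B') * E\<^sub>2 B" for q\<^sub>1 q\<^sub>2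
  proof -
    have "E\<^sub>1 A' * E\<^sub>1 A = E\<^sub>1 A * E\<^sub>1 A'"
      using one.mult[OF assms(3,1)] one.mult[OF assms(1,3)] by (simp add: Int_commute)
    then have l: "(X\<^sub>1 - \<mu> *\<^sub>C 1) ^ q\<^sub>1 * E\<^sub>1 A' * E\<^sub>1 A = E\<^sub>1 A * ((X\<^sub>1 - \<mu> *\<^sub>C 1) ^ q\<^sub>1 * E\<^sub>1 A')"
      by (simp only: mult.assoc) (simp only: one.commute_shift[OF assms(1)] flip: mult.assoc)
    have e: "E\<^sub>2 B * E\<^sub>2 B' = E\<^sub>2 B' * E\<^sub>2 B"
      using two.mult[OF assms(2,4)] two.mult[OF assms(4,2)] by (simp add: Int_commute)
    have "E\<^sub>2 B * ((X\<^sub>2 - \<nu> *\<^sub>C 1) ^ q\<^sub>2 * E\<^sub>2 B') = (X\<^sub>2 - \<nu> *\<^sub>C 1) ^ q\<^sub>2 * (E\<^sub>2 B * E\<^sub>2 B')"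
      by (simp only: two.commute_shift[OF assms(2)] flip: mult.assoc)
    then have r: "E\<^sub>2 B * ((X\<^sub>2 - \<nu> *\<^sub>C 1) ^ q\<^sub>2 * E\<^sub>2 B') = (X\<^sub>2 - \<nu> *\<^sub>C 1) ^ q\<^sub>2 * E\<^sub>2 B' * E\<^sub>2 B"
      by (simp only: e mult.assoc)
    have "(X\<^sub>1 - \<mu> *\<^sub>C 1) ^ q\<^sub>1 * E\<^sub>1 A' * (E\<^sub>1 A * Y * E\<^sub>2 B) * (X\<^sub>2 - \<nu> *\<^sub>C 1) ^ q\<^sub>2 * E\<^sub>2 B' =
        ((X\<^sub>1 - \<mu> *\<^sub>C 1) ^ q\<^sub>1 * E\<^sub>1 A' * E\<^sub>1 A) * Y * (E\<^sub>2 B * ((X\<^sub>2 - \<nu> *\<^sub>C 1) ^ q\<^sub>2 * E\<^sub>2 B'))"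
      by (simp only: mult.assoc)
    then show ?thesis unfolding l r by (simp only: mult.assoc)
  qed
  then show ?thesis
    by (simp add: gdoi_integrand_def sum_distrib_left sum_distrib_right scaleC_mult_left scaleC_mult_right)
qed

text \<open>Each compressing projection commutes with the powers and projections on its own side, so
  every Riemann sum is compressed as a whole; fixed bounded factors on both sides preserve strong
  limits.\<close>

lemma has_gdoi_restrict:
  assumes A: "A \<in> borel_subsets (spectrum X\<^sub>1)" and B: "B \<in> borel_subsets (spectrum X\<^sub>2)"
    and T: "is_gdoi \<beta> Y T"
  shows "is_gdoi \<beta> (E\<^sub>1 A * Y * E\<^sub>2 B) (E\<^sub>1 A * T * E\<^sub>2 B)"
  unfolding has_gdoi_iff
proof
  fix x
  have "((\<lambda>p. app (E\<^sub>1 A) (app (riemann_sum \<beta> Y p) (app (E\<^sub>2 B) x))) \<longlongrightarrow>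
      app (E\<^sub>1 A) (app T (app (E\<^sub>2 B) x))) tags"
    by (rule tendsto_app_right) (use T in \<open>simp add: has_gdoi_iff\<close>)
  then show "((\<lambda>p. app (riemann_sum \<beta> (E\<^sub>1 A * Y * E\<^sub>2 B) p) x) \<longlongrightarrow> app (E\<^sub>1 A * T * E\<^sub>2 B) x) tags"
    unfolding times_bop.rep_eq
  proof (rule Lim_transform_eventually)
    show "\<forall>\<^sub>F p in tags. app (E\<^sub>1 A) (app (riemann_sum \<beta> Y p) (app (E\<^sub>2 B) x)) =
        app (riemann_sum \<beta> (E\<^sub>1 A * Y * E\<^sub>2 B) p) x"
      using eventually_tags[OF one.eventually_cells two.eventually_cells]
    proof (rule eventually_mono, elim conjE)
      fix p :: "(complex set set \<times> (complex set \<Rightarrow> complex)) \<times> (complex set set \<times> (complex set \<Rightarrow> complex))"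
      assume sub: "fst (fst p) \<subseteq> borel_subsets (spectrum X\<^sub>1)" "fst (snd p) \<subseteq> borel_subsets (spectrum X\<^sub>2)"
      have "riemann_sum \<beta> (E\<^sub>1 A * Y * E\<^sub>2 B) p = E\<^sub>1 A * riemann_sum \<beta> Y p * E\<^sub>2 B"
        unfolding gdoi_sum_def sum_distrib_left sum_distrib_right
        using sub by (intro sum.cong integrand_restrict A B refl) auto
      then show "app (E\<^sub>1 A) (app (riemann_sum \<beta> Y p) (app (E\<^sub>2 B) x)) =
          app (riemann_sum \<beta> (E\<^sub>1 A * Y * E\<^sub>2 B) p) x"
        by (simp add: times_bop.rep_eq)
    qed
  qed
qed

section \<open>The integral on a small rectangle\<close>

text \<open>The contribution of a single cell to \<open>monomial_sum\<close>, with tag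
  \<mu>.\<close>

definition "cell_term X (E :: complex set \<Rightarrow> 'a bop) k a \<mu> A j =
  (\<Sum>q<k. (of_nat (j choose q) * (\<mu> - a) ^ (j - q)) *\<^sub>C ((X - \<mu> *\<^sub>C 1) ^ q * E A))"

text \<open>The Taylor coefficients of \<beta> at the tags are series in its coefficients at the
  centre, and each series term splits into a factor for either variable. Only finitely many orders
  occur, so the sums may be exchanged.\<close>

lemma integrand_has_sum:
  assumes \<beta>: "series_at c a b r \<beta>" and \<mu>: "\<mu> \<in> ball a r" and \<nu>: "\<nu> \<in> ball b r"
  shows "((\<lambda>(j, k). c (j, k) *\<^sub>C (cell_term X\<^sub>1 E\<^sub>1 (m\<^sub>1 \<mu>) a \<mu> A j * Y * cell_term X\<^sub>2 E\<^sub>2 (m\<^sub>2 \<nu>) b \<nu> B k))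
    has_sum integrand \<beta> Y \<mu> A \<nu> B) UNIV"
proof -
  let ?x = "\<lambda>j q. of_nat (j choose q) * (\<mu> - a) ^ (j - q)" and ?y = "\<lambda>k q. of_nat (k choose q) * (\<nu> - b) ^ (k - q)"
  let ?L = "\<lambda>q. (X\<^sub>1 - \<mu> *\<^sub>C 1) ^ q * E\<^sub>1 A" and ?R = "\<lambda>q. (X\<^sub>2 - \<nu> *\<^sub>C 1) ^ q * E\<^sub>2 B"
  have "((\<lambda>(j, k). \<Sum>q\<^sub>1<m\<^sub>1 \<mu>. \<Sum>q\<^sub>2<m\<^sub>2 \<nu>. (c (j, k) * (?x j q\<^sub>1 * ?y k q\<^sub>2)) *\<^sub>C (?L q\<^sub>1 * Y * ?R q\<^sub>2))
      has_sum integrand \<beta> Y \<mu> A \<nu> B) UNIV"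
    unfolding gdoi_integrand_def case_prod_unfold
  proof (intro has_sum_sum_finite)
    fix q\<^sub>1 q\<^sub>2
    from has_sum_bounded_linear[OF bounded_linear_scaleC_left[of "?L q\<^sub>1 * Y * ?R q\<^sub>2"]
        series_at_partial_deriv[OF \<beta> \<mu> \<nu>, of q\<^sub>1 q\<^sub>2]]
    show "((\<lambda>p. (c (fst p, snd p) * (?x (fst p) q\<^sub>1 * ?y (snd p) q\<^sub>2)) *\<^sub>C (?L q\<^sub>1 * Y * ?R q\<^sub>2)) has_sum
        (partial_deriv q\<^sub>1 q\<^sub>2 \<beta> \<mu> \<nu> / (fact q\<^sub>1 * fact q\<^sub>2)) *\<^sub>C
        (?L q\<^sub>1 * Y * (X\<^sub>2 - \<nu> *\<^sub>C 1) ^ q\<^sub>2 * E\<^sub>2 B)) UNIV"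
      by (simp add: case_prod_unfold mult.assoc)
  qed
  moreover have "(\<Sum>q\<^sub>1<m\<^sub>1 \<mu>. \<Sum>q\<^sub>2<m\<^sub>2 \<nu>. (c (j, k) * (?x j q\<^sub>1 * ?y k q\<^sub>2)) *\<^sub>C (?L q\<^sub>1 * Y * ?R q\<^sub>2)) =
      c (j, k) *\<^sub>C (cell_term X\<^sub>1 E\<^sub>1 (m\<^sub>1 \<mu>) a \<mu> A j * Y * cell_term X\<^sub>2 E\<^sub>2 (m\<^sub>2 \<nu>) b \<nu> B k)" for j k
  proof -
    have "(c (j, k) * (?x j q\<^sub>1 * ?y k q\<^sub>2)) *\<^sub>C (?L q\<^sub>1 * Y * ?R q\<^sub>2) =
        c (j, k) *\<^sub>C ((?x j q\<^sub>1 *\<^sub>C ?L q\<^sub>1) * Y * (?y k q\<^sub>2 *\<^sub>C ?R q\<^sub>2))" for q\<^sub>1 q\<^sub>2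
      by (simp add: scaleC_mult_left scaleC_mult_right scaleC_scaleC mult_ac)
    then show ?thesis
      by (simp only: cell_term_def sum_distrib_left sum_distrib_right scaleC_sum_right) (rule sum.swap)
  qed
  ultimately show ?thesis by simp
qed

text \<open>The constant \<open>K\<close> precedes the quantifiers over \<open>c\<close> and
  \<beta>, because one bound on the operator monomials has to serve the series of several functions
  about the same centre.\<close>

lemma gdoi_local:
  assumes A: "A \<in> borel_subsets (spectrum X\<^sub>1)" "A \<subseteq> cball a \<rho>"
    and B: "B \<in> borel_subsets (spectrum X\<^sub>2)" "B \<subseteq> cball b \<rho>"
    and k\<^sub>1: "1 \<le> k\<^sub>1" "\<And>\<mu>. \<mu> \<in> A \<Longrightarrow> m\<^sub>1 \<mu> = k\<^sub>1"
    and k\<^sub>2: "1 \<le> k\<^sub>2" "\<And>\<nu>. \<nu> \<in> B \<Longrightarrow> m\<^sub>2 \<nu> = k\<^sub>2"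
    and \<rho>: "0 \<le> \<rho>" "\<rho> < s" "s < r"
  shows "\<exists>K\<ge>0. (\<forall>u n. norm (u *\<^sub>C ((X\<^sub>1 - a *\<^sub>C 1) ^ fst n * (E\<^sub>1 A * Y * E\<^sub>2 B) * (X\<^sub>2 - b *\<^sub>C 1) ^ snd n)) \<le>
      cmod u * (K * (s ^ fst n * s ^ snd n))) \<and>
    (\<forall>c \<beta>. series_at c a b r \<beta> \<longrightarrow> (\<exists>T. is_gdoi \<beta> (E\<^sub>1 A * Y * E\<^sub>2 B) T \<and>
      ((\<lambda>n. c n *\<^sub>C ((X\<^sub>1 - a *\<^sub>C 1) ^ fst n * (E\<^sub>1 A * Y * E\<^sub>2 B) * (X\<^sub>2 - b *\<^sub>C 1) ^ snd n)) has_sum T) UNIV))"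
proof -
  let ?Y = "E\<^sub>1 A * Y * E\<^sub>2 B"
  have s0: "0 \<le> s" using \<rho> by simp
  have k\<^sub>1': "m\<^sub>1 \<mu> \<le> k\<^sub>1" if "\<mu> \<in> A" for \<mu> using k\<^sub>1(2)[OF that] by simp
  have k\<^sub>2': "m\<^sub>2 \<nu> \<le> k\<^sub>2" if "\<nu> \<in> B" for \<nu> using k\<^sub>2(2)[OF that] by simp
  let ?L = "one.monomial_sum A a k\<^sub>1" and ?R = "two.monomial_sum B b k\<^sub>2"
  obtain K\<^sub>1 where K\<^sub>1: "K\<^sub>1 \<ge> 0"
    "\<forall>\<^sub>F p in tagged_partitions (spectrum X\<^sub>1). \<forall>j. norm (?L j p) \<le> K\<^sub>1 * s ^ j"
    using one.monomial_sum_bound[OF A \<rho>(1,2)] by blast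
  obtain K\<^sub>2 where K\<^sub>2: "K\<^sub>2 \<ge> 0"
    "\<forall>\<^sub>F p in tagged_partitions (spectrum X\<^sub>2). \<forall>j. norm (?R j p) \<le> K\<^sub>2 * s ^ j"
    using two.monomial_sum_bound[OF B \<rho>(1,2)] by blast
  define K where "K = K\<^sub>1 * norm Y * K\<^sub>2"
  have K: "K \<ge> 0" using K\<^sub>1(1) K\<^sub>2(1) by (simp add: K_def)
  have bound: "norm (u *\<^sub>C (S * Y * S')) \<le> cmod u * (K * (s ^ j * s ^ k))"
    if "norm S \<le> K\<^sub>1 * s ^ j" "norm S' \<le> K\<^sub>2 * s ^ k" for u S S' j k
  proof -
    have "norm (S * Y * S') \<le> (K\<^sub>1 * s ^ j) * norm Y * (K\<^sub>2 * s ^ k)"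
      using that K\<^sub>1(1) K\<^sub>2(1) s0
      by (intro order_trans[OF norm_mult_ineq] mult_mono mult_nonneg_nonneg) auto
    also have "\<dots> = K * (s ^ j * s ^ k)" by (simp add: K_def mult_ac)
    finally show ?thesis by (meson mult_left_mono norm_ge_zero norm_scaleC order_trans)
  qed
  define t where "t n = (X\<^sub>1 - a *\<^sub>C 1) ^ fst n * ?Y * (X\<^sub>2 - b *\<^sub>C 1) ^ snd n" for n :: "nat \<times> nat"
  have t: "t n = ((X\<^sub>1 - a *\<^sub>C 1) ^ fst n * E\<^sub>1 A) * Y * ((X\<^sub>2 - b *\<^sub>C 1) ^ snd n * E\<^sub>2 B)" for n
    unfolding t_def two.commute_shift[OF B(1)] by (simp only: mult.assoc)
  have bound_t: "norm (u *\<^sub>C t n) \<le> cmod u * (K * (s ^ fst n * s ^ snd n))" for u n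
    unfolding t
    by (intro bound one.norm_localized_power_le[OF A(1) k\<^sub>1(1) k\<^sub>1' K\<^sub>1(2)]
        two.norm_localized_power_le[OF B(1) k\<^sub>2(1) k\<^sub>2' K\<^sub>2(2)])
  have "\<exists>T. is_gdoi \<beta> ?Y T \<and> ((\<lambda>n. c n *\<^sub>C t n) has_sum T) UNIV" if \<beta>: "series_at c a b r \<beta>" for c \<beta>
  proof -
    define f where "f p n = c n *\<^sub>C (?L (fst n) (fst p) * Y * ?R (snd n) (snd p))"
      for p :: "(complex set set \<times> (complex set \<Rightarrow> complex)) \<times> (complex set set \<times> (complex set \<Rightarrow> complex))"
        and n :: "nat \<times> nat"
    define dom where "dom n = cmod (c n) * (K * (s ^ fst n * s ^ snd n))" for n
    \<comment> \<open>On this set the series indexed by \<open>n\<close> have the common majorant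
      \<open>dom\<close>, so their partial sums converge uniformly in \<open>p\<close>. As
      \<open>p\<close> is eventually in it, the limit along the partitions and the sum may be
      exchanged.\<close>
    define good where "good = {p :: (complex set set \<times> (complex set \<Rightarrow> complex)) \<times> (complex set set \<times> (complex set \<Rightarrow> complex)).
      (\<forall>j. norm (?L j (fst p)) \<le> K\<^sub>1 * s ^ j) \<and> (\<forall>j. norm (?R j (snd p)) \<le> K\<^sub>2 * s ^ j)}"
    have dom: "dom summable_on UNIV"
      using summable_on_cmult_right[OF series_at_abs_summable[OF \<beta> s0 \<rho>(3)], of K]
      by (simp add: dom_def[abs_def] mult_ac)
    have bound_f: "norm (f p n) \<le> dom n" if "p \<in> good" for p n
      unfolding f_def dom_def by (rule bound) (use that in \<open>auto simp: good_def\<close>)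
    have "(\<lambda>n. norm (c n *\<^sub>C t n)) summable_on UNIV"
      using dom by (rule Infinite_Sum.abs_summable_on_comparison_test') (simp add: dom_def bound_t)
    then have "(\<lambda>n. c n *\<^sub>C t n) summable_on UNIV" by (rule abs_summable_summable)
    then obtain T where T: "((\<lambda>n. c n *\<^sub>C t n) has_sum T) UNIV" by (auto simp: summable_on_def)
    have lim_f: "((\<lambda>p. f p n) \<longlongrightarrow> c n *\<^sub>C t n) tags" for n
      unfolding f_def t
      by (intro bounded_linear.tendsto[OF bounded_linear_scaleC_right] tendsto_mult tendsto_const
          filterlim_compose[OF one.tendsto_monomial_sum[OF A(1) k\<^sub>1(1) k\<^sub>1'] filterlim_fst]
          filterlim_compose[OF two.tendsto_monomial_sum[OF B(1) k\<^sub>2(1) k\<^sub>2'] filterlim_snd])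
    have "((\<lambda>p. \<Sum>\<^sub>\<infinity>n. f p n) \<longlongrightarrow> T) tags"
    proof (rule swap_uniform_limit')
      show "\<forall>\<^sub>F F in finite_subsets_at_top UNIV. ((\<lambda>p. \<Sum>n\<in>F. f p n) \<longlongrightarrow> (\<Sum>n\<in>F. c n *\<^sub>C t n)) tags"
        by (intro always_eventually allI tendsto_sum lim_f)
      show "((\<lambda>F. \<Sum>n\<in>F. c n *\<^sub>C t n) \<longlongrightarrow> T) (finite_subsets_at_top UNIV)"
        using T by (simp add: has_sum_def)
      show "uniform_limit good (\<lambda>F p. \<Sum>n\<in>F. f p n) (\<lambda>p. \<Sum>\<^sub>\<infinity>n. f p n) (finite_subsets_at_top UNIV)"
        by (rule Weierstrass_m_test_general[OF bound_f dom])
      show "\<forall>\<^sub>F p in tags. p \<in> good"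
        using eventually_tags[OF K\<^sub>1(2) K\<^sub>2(2)] by (simp add: good_def)
    qed simp
    moreover have "\<forall>\<^sub>F p in tags. (\<Sum>\<^sub>\<infinity>n. f p n) = riemann_sum \<beta> ?Y p"
      using eventually_tags[OF one.eventually_local_cells[OF A(1) zero_less_one]
          two.eventually_local_cells[OF B(1) zero_less_one]]
    proof (rule eventually_mono)
      fix p :: "(complex set set \<times> (complex set \<Rightarrow> complex)) \<times> (complex set set \<times> (complex set \<Rightarrow> complex))"
      obtain P t\<^sub>1 Q t\<^sub>2 where p: "p = ((P, t\<^sub>1), (Q, t\<^sub>2))" by (metis prod.collapse)
      assume "(case fst p of (P, t) \<Rightarrow> borel_partition (spectrum X\<^sub>1) P \<and> tagged P t \<and>
          (\<forall>C\<in>P. C \<subseteq> A \<or> C \<inter> A = {}) \<and> borel_partition A {C \<in> P. C \<subseteq> A} \<and> fine_cells 1 {C \<in> P. C \<subseteq> A}) \<and>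
        (case snd p of (P, t) \<Rightarrow> borel_partition (spectrum X\<^sub>2) P \<and> tagged P t \<and>
          (\<forall>C\<in>P. C \<subseteq> B \<or> C \<inter> B = {}) \<and> borel_partition B {C \<in> P. C \<subseteq> B} \<and> fine_cells 1 {C \<in> P. C \<subseteq> B})"
      then have P: "borel_partition (spectrum X\<^sub>1) P" "tagged P t\<^sub>1" "\<And>C. C \<in> P \<Longrightarrow> C \<subseteq> A \<or> C \<inter> A = {}"
        and Q: "borel_partition (spectrum X\<^sub>2) Q" "tagged Q t\<^sub>2" "\<And>C. C \<in> Q \<Longrightarrow> C \<subseteq> B \<or> C \<inter> B = {}"
        by (auto simp: p)
      have fin: "finite P" "finite Q" using P Q by (auto simp: borel_partition_def)
      have PS: "C \<in> borel_subsets (spectrum X\<^sub>1)" if "C \<in> P" for C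
        using that P by (auto simp: borel_partition_def)
      have QS: "C \<in> borel_subsets (spectrum X\<^sub>2)" if "C \<in> Q" for C
        using that Q by (auto simp: borel_partition_def)
      let ?I = "\<lambda>Y C D. integrand \<beta> Y (t\<^sub>1 C) C (t\<^sub>2 D) D"
      have restr: "?I ?Y C D = E\<^sub>1 A * ?I Y C D * E\<^sub>2 B" if "C \<in> P" "D \<in> Q" for C D
        by (rule integrand_restrict[OF A(1) B(1) PS[OF that(1)] QS[OF that(2)]])
      have cut\<^sub>1: "E\<^sub>1 A * (X\<^sub>1 - \<mu> *\<^sub>C 1) ^ q * E\<^sub>1 C = (if C \<subseteq> A then (X\<^sub>1 - \<mu> *\<^sub>C 1) ^ q * E\<^sub>1 C else 0)"
        if "C \<in> P" for C \<mu> q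
      proof -
        have "E\<^sub>1 A * (X\<^sub>1 - \<mu> *\<^sub>C 1) ^ q * E\<^sub>1 C = (X\<^sub>1 - \<mu> *\<^sub>C 1) ^ q * E\<^sub>1 (A \<inter> C)"
          by (simp only: mult.assoc one.mult[OF A(1) PS[OF that]] flip: one.commute_shift[OF A(1)])
        moreover have "A \<inter> C = (if C \<subseteq> A then C else {})" using P(3)[OF that] by auto
        ultimately show ?thesis by simp
      qed
      have cut\<^sub>2: "(X\<^sub>2 - \<mu> *\<^sub>C 1) ^ q * E\<^sub>2 C * E\<^sub>2 B = (if C \<subseteq> B then (X\<^sub>2 - \<mu> *\<^sub>C 1) ^ q * E\<^sub>2 C else 0)"
        if "C \<in> Q" for C \<mu> q
      proof -
        have "(X\<^sub>2 - \<mu> *\<^sub>C 1) ^ q * E\<^sub>2 C * E\<^sub>2 B = (X\<^sub>2 - \<mu> *\<^sub>C 1) ^ q * E\<^sub>2 (C \<inter> B)"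
          using two.mult[OF QS[OF that] B(1)] by (simp add: mult.assoc)
        moreover have "C \<inter> B = (if C \<subseteq> B then C else {})" using Q(3)[OF that] by auto
        ultimately show ?thesis by simp
      qed
      \<comment> \<open>A cell lies inside the chosen Borel set or misses it, so the compression
        leaves an integrand unchanged or annihilates it.\<close>
      have I: "?I ?Y C D = (if C \<subseteq> A \<and> D \<subseteq> B then ?I Y C D else 0)" if "C \<in> P" "D \<in> Q" for C D
      proof -
        have "E\<^sub>1 A * ((X\<^sub>1 - \<mu> *\<^sub>C 1) ^ q\<^sub>1 * E\<^sub>1 C * Y * (X\<^sub>2 - \<nu> *\<^sub>C 1) ^ q\<^sub>2 * E\<^sub>2 D) * E\<^sub>2 B =
            (E\<^sub>1 A * (X\<^sub>1 - \<mu> *\<^sub>C 1) ^ q\<^sub>1 * E\<^sub>1 C) * Y * ((X\<^sub>2 - \<nu> *\<^sub>C 1) ^ q\<^sub>2 * E\<^sub>2 D * E\<^sub>2 B)" for \<mu> \<nu> q\<^sub>1 q\<^sub>2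
          by (simp only: mult.assoc)
        then have "E\<^sub>1 A * ((X\<^sub>1 - \<mu> *\<^sub>C 1) ^ q\<^sub>1 * E\<^sub>1 C * Y * (X\<^sub>2 - \<nu> *\<^sub>C 1) ^ q\<^sub>2 * E\<^sub>2 D) * E\<^sub>2 B =
            (if C \<subseteq> A \<and> D \<subseteq> B then (X\<^sub>1 - \<mu> *\<^sub>C 1) ^ q\<^sub>1 * E\<^sub>1 C * Y * (X\<^sub>2 - \<nu> *\<^sub>C 1) ^ q\<^sub>2 * E\<^sub>2 D else 0)" for \<mu> \<nu> q\<^sub>1 q\<^sub>2
          unfolding cut\<^sub>1[OF that(1)] cut\<^sub>2[OF that(2)] by (auto simp: mult.assoc)
        then show ?thesis
          unfolding restr[OF that]
          by (cases "C \<subseteq> A \<and> D \<subseteq> B"; simp only: if_True if_False)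
            (simp_all add: gdoi_integrand_def sum_distrib_left sum_distrib_right scaleC_mult_left scaleC_mult_right)
      qed
      let ?P = "{C \<in> P. C \<subseteq> A}" and ?Q = "{C \<in> Q. C \<subseteq> B}"
      have sum_eq: "riemann_sum \<beta> ?Y p = (\<Sum>C\<in>?P. \<Sum>D\<in>?Q. ?I Y C D)"
      proof -
        have "riemann_sum \<beta> ?Y p = (\<Sum>C\<in>P. \<Sum>D\<in>Q. if C \<subseteq> A \<and> D \<subseteq> B then ?I Y C D else 0)"
          unfolding gdoi_sum_def p by (auto intro!: sum.cong simp: I)
        also have "\<dots> = (\<Sum>C\<in>P. if C \<subseteq> A then (\<Sum>D\<in>?Q. ?I Y C D) else 0)"
          by (rule sum.cong) (auto simp: sum.inter_filter[OF fin(2)])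
        also have "\<dots> = (\<Sum>C\<in>?P. \<Sum>D\<in>?Q. ?I Y C D)"
          by (simp add: sum.inter_filter[OF fin(1)])
        finally show ?thesis .
      qed
      have "((\<lambda>n. \<Sum>C\<in>?P. \<Sum>D\<in>?Q. c n *\<^sub>C (cell_term X\<^sub>1 E\<^sub>1 k\<^sub>1 a (t\<^sub>1 C) C (fst n) * Y *
          cell_term X\<^sub>2 E\<^sub>2 k\<^sub>2 b (t\<^sub>2 D) D (snd n))) has_sum (\<Sum>C\<in>?P. \<Sum>D\<in>?Q. ?I Y C D)) UNIV"
      proof (intro has_sum_sum_finite)
        fix C D assume C: "C \<in> ?P" and D: "D \<in> ?Q"
        \<comment> \<open>Membership of the tags gives two things: the expansion about the centre is
          valid there, and the orders of nilpotency are \<open>k\<^sub>1\<close> and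
          \<open>k\<^sub>2\<close>, so that all cells are truncated alike.\<close>
        have in_cells: "t\<^sub>1 C \<in> A" "t\<^sub>2 D \<in> B" using C D P(2) Q(2) by (auto simp: tagged_def)
        then have "t\<^sub>1 C \<in> ball a r" "t\<^sub>2 D \<in> ball b r" using A(2) B(2) \<rho> by fastforce+
        from integrand_has_sum[OF \<beta> this, of C Y D]
        show "((\<lambda>n. c n *\<^sub>C (cell_term X\<^sub>1 E\<^sub>1 k\<^sub>1 a (t\<^sub>1 C) C (fst n) * Y *
          cell_term X\<^sub>2 E\<^sub>2 k\<^sub>2 b (t\<^sub>2 D) D (snd n))) has_sum ?I Y C D) UNIV"
          using k\<^sub>1(2)[OF in_cells(1)] k\<^sub>2(2)[OF in_cells(2)] by (simp add: case_prod_unfold)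
      qed
      also have "(\<lambda>n. \<Sum>C\<in>?P. \<Sum>D\<in>?Q. c n *\<^sub>C (cell_term X\<^sub>1 E\<^sub>1 k\<^sub>1 a (t\<^sub>1 C) C (fst n) * Y *
          cell_term X\<^sub>2 E\<^sub>2 k\<^sub>2 b (t\<^sub>2 D) D (snd n))) = f p"
      proof
        fix n
        have "?L j (P, t\<^sub>1) = (\<Sum>C\<in>?P. cell_term X\<^sub>1 E\<^sub>1 k\<^sub>1 a (t\<^sub>1 C) C j)" for j
          by (simp add: one.monomial_sum_def cell_term_def)
        moreover have "?R j (Q, t\<^sub>2) = (\<Sum>D\<in>?Q. cell_term X\<^sub>2 E\<^sub>2 k\<^sub>2 b (t\<^sub>2 D) D j)" for j
          by (simp add: two.monomial_sum_def cell_term_def)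
        ultimately show "(\<Sum>C\<in>?P. \<Sum>D\<in>?Q. c n *\<^sub>C (cell_term X\<^sub>1 E\<^sub>1 k\<^sub>1 a (t\<^sub>1 C) C (fst n) * Y *
          cell_term X\<^sub>2 E\<^sub>2 k\<^sub>2 b (t\<^sub>2 D) D (snd n))) = f p n"
          by (simp only: f_def p fst_conv snd_conv sum_distrib_left sum_distrib_right scaleC_sum_right)
            (rule sum.swap)
      qed
      finally show "(\<Sum>\<^sub>\<infinity>n. f p n) = riemann_sum \<beta> ?Y p"
        unfolding sum_eq by (rule infsumI)
    qed
    ultimately have "(riemann_sum \<beta> ?Y \<longlongrightarrow> T) tags" by (rule Lim_transform_eventually)
    then have "is_gdoi \<beta> ?Y T" unfolding has_gdoi_iff by (auto intro: tendsto_app)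
    with T show ?thesis by blast
  qed
  with K bound_t show ?thesis unfolding t_def by blast
qed

text \<open>Both compressions are sums of the same series. For \<open>V\<close>, the series of the
  compressed \<open>U\<close> is inserted into that of \<beta>, which produces a double family in
  \<open>h (p + q)\<close>; its regrouping has the convolution as coefficients, and these are the
  coefficients of the product function used for \<open>W\<close>.\<close>

lemma gdoi_mult_local:
  assumes A: "A \<in> borel_subsets (spectrum X\<^sub>1)" "A \<subseteq> cball a \<rho>"
    and B: "B \<in> borel_subsets (spectrum X\<^sub>2)" "B \<subseteq> cball b \<rho>"
    and k\<^sub>1: "1 \<le> k\<^sub>1" "\<And>\<mu>. \<mu> \<in> A \<Longrightarrow> m\<^sub>1 \<mu> = k\<^sub>1"
    and k\<^sub>2: "1 \<le> k\<^sub>2" "\<And>\<nu>. \<nu> \<in> B \<Longrightarrow> m\<^sub>2 \<nu> = k\<^sub>2"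
    and \<rho>: "0 \<le> \<rho>" "\<rho> < r"
    and c: "series_at c a b r \<beta>" and d: "series_at d a b r \<gamma>"
    and \<gamma>: "is_gdoi \<gamma> Y U" and \<beta>: "is_gdoi \<beta> U V" and \<beta>\<gamma>: "is_gdoi (\<lambda>p. \<beta> p * \<gamma> p) Y W"
  shows "E\<^sub>1 A * V * E\<^sub>2 B = E\<^sub>1 A * W * E\<^sub>2 B"
proof -
  obtain s where s: "\<rho> < s" "s < r" using \<rho>(2) dense by blast
  have s0: "0 \<le> s" using s \<rho> by simp
  let ?L = "\<lambda>j. (X\<^sub>1 - a *\<^sub>C 1) ^ j" and ?R = "\<lambda>j. (X\<^sub>2 - b *\<^sub>C 1) ^ j"
  let ?Y = "E\<^sub>1 A * Y * E\<^sub>2 B" and ?U = "E\<^sub>1 A * U * E\<^sub>2 B"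
  define h where "h n = ?L (fst n) * ?Y * ?R (snd n)" for n
  note local = gdoi_local[OF A B k\<^sub>1 k\<^sub>2 \<rho>(1) s]
  obtain K where K: "K \<ge> 0" "\<And>u n. norm (u *\<^sub>C h n) \<le> cmod u * (K * (s ^ fst n * s ^ snd n))"
    and loc: "\<And>c \<beta>. series_at c a b r \<beta> \<Longrightarrow> \<exists>T. is_gdoi \<beta> ?Y T \<and> ((\<lambda>n. c n *\<^sub>C h n) has_sum T) UNIV"
    using local[of Y] unfolding h_def by blast
  \<comment> \<open>By uniqueness, the integral of \<gamma> at the compressed \<open>Y\<close>,
    known as a series, is the compression of \<open>U\<close>.\<close>
  have U: "((\<lambda>n. d n *\<^sub>C h n) has_sum ?U) UNIV"
    using loc[OF d] has_gdoi_unique[OF has_gdoi_restrict[OF A(1) B(1) \<gamma>]] by blast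
  have W: "((\<lambda>n. convolution c d n *\<^sub>C h n) has_sum (E\<^sub>1 A * W * E\<^sub>2 B)) UNIV"
    using loc[OF series_at_convolution[OF c d]] has_gdoi_unique[OF has_gdoi_restrict[OF A(1) B(1) \<beta>\<gamma>]]
    by blast
  obtain T where T: "is_gdoi \<beta> ?U T" "((\<lambda>n. c n *\<^sub>C (?L (fst n) * ?U * ?R (snd n))) has_sum T) UNIV"
    using local[of U] c by blast
  have "T = E\<^sub>1 A * V * E\<^sub>2 B"
    by (rule has_gdoi_unique[OF T(1) has_gdoi_restrict[OF A(1) B(1) \<beta>]])
  with T(2) have V: "((\<lambda>n. c n *\<^sub>C (?L (fst n) * ?U * ?R (snd n))) has_sum (E\<^sub>1 A * V * E\<^sub>2 B)) UNIV"
    by simp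
  have "((\<lambda>n. convolution c d n *\<^sub>C h n) has_sum (E\<^sub>1 A * V * E\<^sub>2 B)) UNIV"
  proof (rule has_sum_convolution[OF _ V])
    fix p :: "nat \<times> nat"
    have hp: "?L (fst p) * h q * ?R (snd p) = h (p + q)" for q
    proof -
      have "?R (snd q) * ?R (snd p) = ?R (snd (p + q))"
        by (simp add: add.commute flip: power_add)
      then show ?thesis by (simp add: h_def power_add mult.assoc)
    qed
    \<comment> \<open>A bounded linear map may be applied termwise to the series of the compressed
      \<open>U\<close>; by \<open>hp\<close> it shifts the index by \<open>p\<close>.\<close>
    have "bounded_linear (\<lambda>T. c p *\<^sub>C (?L (fst p) * T * ?R (snd p)))"
      by (intro bounded_linear_compose[OF bounded_linear_scaleC_right]
          bounded_linear_compose[OF bounded_linear_mult_left bounded_linear_mult_right])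
    from has_sum_bounded_linear[OF this U]
    show "((\<lambda>q. (c p * d q) *\<^sub>C h (p + q)) has_sum c p *\<^sub>C (?L (fst p) * ?U * ?R (snd p))) UNIV"
      by (simp add: scaleC_mult_left scaleC_mult_right scaleC_scaleC hp)
  next
    show "(\<lambda>(p, q). (c p * d q) *\<^sub>C h (p + q)) summable_on UNIV \<times> UNIV"
      by (rule summable_on_convolution[OF c d s0 s(2) K])
  qed
  then show ?thesis using W has_sum_unique by blast
qed

section \<open>From small rectangles to the whole spectra\<close>

text \<open>Both projections of the whole spectra are the identity, so \<open>Z\<close> is the
  finite sum of its compressions to the rectangles of two partitions. Inside a rectangle the orders
  of nilpotency are summed strongly, first on the right with the left one fixed, then on the
  left.\<close>

lemma zero_if_locally_zero:
  assumes zero: "\<And>a b. a \<in> spectrum X\<^sub>1 \<Longrightarrow> b \<in> spectrum X\<^sub>2 \<Longrightarrow> \<exists>r>0. \<forall>A B k\<^sub>1 k\<^sub>2.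
      A \<in> borel_subsets (spectrum X\<^sub>1) \<longrightarrow> A \<subseteq> ball a r \<longrightarrow>
      B \<in> borel_subsets (spectrum X\<^sub>2) \<longrightarrow> B \<subseteq> ball b r \<longrightarrow>
      1 \<le> k\<^sub>1 \<longrightarrow> 1 \<le> k\<^sub>2 \<longrightarrow> (\<forall>\<mu>\<in>A. m\<^sub>1 \<mu> = k\<^sub>1) \<longrightarrow> (\<forall>\<nu>\<in>B. m\<^sub>2 \<nu> = k\<^sub>2) \<longrightarrow> E\<^sub>1 A * Z * E\<^sub>2 B = 0"
  shows "Z = 0"
proof -
  let ?S = "spectrum X\<^sub>1 \<times> spectrum X\<^sub>2"
  define vanishes where "vanishes a b r \<longleftrightarrow> (\<forall>A B k\<^sub>1 k\<^sub>2.
      A \<in> borel_subsets (spectrum X\<^sub>1) \<longrightarrow> A \<subseteq> ball a r \<longrightarrow>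
      B \<in> borel_subsets (spectrum X\<^sub>2) \<longrightarrow> B \<subseteq> ball b r \<longrightarrow>
      1 \<le> k\<^sub>1 \<longrightarrow> 1 \<le> k\<^sub>2 \<longrightarrow> (\<forall>\<mu>\<in>A. m\<^sub>1 \<mu> = k\<^sub>1) \<longrightarrow> (\<forall>\<nu>\<in>B. m\<^sub>2 \<nu> = k\<^sub>2) \<longrightarrow>
      E\<^sub>1 A * Z * E\<^sub>2 B = 0)" for a b r
  have "\<exists>r>0. vanishes a b r" if "a \<in> spectrum X\<^sub>1" "b \<in> spectrum X\<^sub>2" for a b
    unfolding vanishes_def by (rule zero[OF that])
  then obtain r where r: "\<And>a b. a \<in> spectrum X\<^sub>1 \<Longrightarrow> b \<in> spectrum X\<^sub>2 \<Longrightarrow> r a b > 0"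
    and vanishes: "\<And>a b. a \<in> spectrum X\<^sub>1 \<Longrightarrow> b \<in> spectrum X\<^sub>2 \<Longrightarrow> vanishes a b (r a b)"
    by metis
  note vanishes = vanishes[unfolded vanishes_def, rule_format]
  have small: "E\<^sub>1 A * Z * E\<^sub>2 B = 0"
    if ab: "a \<in> spectrum X\<^sub>1" "b \<in> spectrum X\<^sub>2"
      and A: "A \<in> borel_subsets (spectrum X\<^sub>1)" "A \<subseteq> ball a (r a b)"
      and B: "B \<in> borel_subsets (spectrum X\<^sub>2)" "B \<subseteq> ball b (r a b)" for a b A B
  proof -
    let ?A = "\<lambda>k. A \<inter> {\<mu> \<in> spectrum X\<^sub>1. m\<^sub>1 \<mu> = k}" and ?B = "\<lambda>k. B \<inter> {\<nu> \<in> spectrum X\<^sub>2. m\<^sub>2 \<nu> = k}"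
    \<comment> \<open>Empty level sets are treated apart, since positivity of the order is known
      only where it is attained.\<close>
    have z: "E\<^sub>1 (?A k\<^sub>1) * Z * E\<^sub>2 (?B k\<^sub>2) = 0" for k\<^sub>1 k\<^sub>2
    proof (cases "?A k\<^sub>1 = {} \<or> ?B k\<^sub>2 = {}")
      case True
      then have "E\<^sub>1 (?A k\<^sub>1) = 0 \<or> E\<^sub>2 (?B k\<^sub>2) = 0" by (metis one.empty two.empty)
      then show ?thesis by (metis mult_zero_left mult_zero_right)
    next
      case False
      then have "1 \<le> k\<^sub>1" "1 \<le> k\<^sub>2" using one.order_ge_1 two.order_ge_1 by auto
      then show ?thesis
        using A B by (intro vanishes[OF ab, where k\<^sub>1 = k\<^sub>1 and k\<^sub>2 = k\<^sub>2]) (auto intro!: borel_subsets_Int one.level_set_borel two.level_set_borel)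
    qed
    have "app (E\<^sub>1 (?A k) * Z * E\<^sub>2 B) x = 0" for k x
    proof -
      have "(\<lambda>j. app (E\<^sub>1 (?A k) * Z) (app (E\<^sub>2 (?B j)) x)) sums app (E\<^sub>1 (?A k) * Z) (app (E\<^sub>2 B) x)"
        by (rule bounded_linear.sums[OF bounded_linear_app two.level_sums[OF B(1)]])
      moreover have "app (E\<^sub>1 (?A k) * Z) (app (E\<^sub>2 (?B j)) x) = 0" for j
        using z[of k j] by (metis times_bop.rep_eq zero_bop.rep_eq)
      ultimately show ?thesis
        using sums_unique2[OF sums_zero] by (auto simp: times_bop.rep_eq)
    qed
    then have "(\<lambda>k::nat. 0) sums app (E\<^sub>1 A) (app (Z * E\<^sub>2 B) x)" for x
      using one.level_sums[OF A(1), of "app (Z * E\<^sub>2 B) x"] by (simp add: times_bop.rep_eq)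
    then have "app (E\<^sub>1 A) (app (Z * E\<^sub>2 B) x) = 0" for x
      using sums_unique2 sums_zero by blast
    then show ?thesis by (intro bop_eqI) (simp add: times_bop.rep_eq zero_bop.rep_eq)
  qed
  show ?thesis
  proof (cases "?S = {}")
    case True
    \<comment> \<open>An empty spectrum forces the identity to equal the projection of the empty
      set, so the space is trivial. The Lebesgue number is taken for a nonempty cover only.\<close>
    then have "(1 :: 'a bop) = 0" using one.whole two.whole by auto
    then show ?thesis by (metis mult_1_left mult_zero_left)
  next
    case False
    define \<C> where "\<C> = (\<lambda>(a, b). ball a (r a b) \<times> ball b (r a b)) ` ?S"
    have "compact ?S" by (intro compact_Times compact_spectrum)
    moreover have "\<C> \<noteq> {}" using False by (auto simp: \<C>_def)
    moreover have "?S \<subseteq> \<Union>\<C>" unfolding \<C>_def using r by fastforce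
    moreover have "open C" if "C \<in> \<C>" for C using that by (auto simp: \<C>_def intro: open_Times)
    ultimately obtain \<delta> where \<delta>: "0 < \<delta>" "\<And>T. T \<subseteq> ?S \<Longrightarrow> diameter T < \<delta> \<Longrightarrow> \<exists>C\<in>\<C>. T \<subseteq> C"
      by (rule Lebesgue_number_lemma) blast+
    obtain P where P: "borel_partition (spectrum X\<^sub>1) P" "fine_cells (\<delta> / 4) P"
      using fine_partition_exists[of "spectrum X\<^sub>1" "\<delta> / 4"] one.bounded_spectrum \<delta>(1)
        borel_closed[OF closed_spectrum] by auto
    obtain Q where Q: "borel_partition (spectrum X\<^sub>2) Q" "fine_cells (\<delta> / 4) Q"
      using fine_partition_exists[of "spectrum X\<^sub>2" "\<delta> / 4"] two.bounded_spectrum \<delta>(1)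
        borel_closed[OF closed_spectrum] by auto
    have "E\<^sub>1 A * Z * E\<^sub>2 B = 0" if AB: "A \<in> P" "B \<in> Q" for A B
    proof -
      have bs: "A \<in> borel_subsets (spectrum X\<^sub>1)" "B \<in> borel_subsets (spectrum X\<^sub>2)" "A \<noteq> {}" "B \<noteq> {}"
        using AB P(1) Q(1) by (auto simp: borel_partition_def partition_on_def)
      \<comment> \<open>The two coordinates contribute \<delta>/4 each, which leaves the strict
        inequality that the Lebesgue number demands.\<close>
      have "diameter (A \<times> B) \<le> \<delta> / 2"
      proof (rule diameter_le)
        fix x y assume xy: "x \<in> A \<times> B" "y \<in> A \<times> B"
        then have "dist (fst x) (fst y) \<le> \<delta> / 4" "dist (snd x) (snd y) \<le> \<delta> / 4"
          using AB P(2) Q(2) by (auto simp: fine_cells_def)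
        moreover have "dist x y \<le> dist (fst x) (fst y) + dist (snd x) (snd y)"
          unfolding dist_prod_def by (rule sqrt_sum_squares_le_sum) auto
        ultimately show "norm (x - y) \<le> \<delta> / 2" by (simp add: dist_norm)
      qed (use bs in auto)
      then have "diameter (A \<times> B) < \<delta>" using \<delta>(1) by linarith
      moreover have "A \<times> B \<subseteq> ?S" using bs by (auto simp: borel_subsets_def)
      ultimately obtain C where "C \<in> \<C>" "A \<times> B \<subseteq> C"
        using \<delta>(2) by blast
      then obtain a b where ab: "a \<in> spectrum X\<^sub>1" "b \<in> spectrum X\<^sub>2"
        "A \<times> B \<subseteq> ball a (r a b) \<times> ball b (r a b)"
        unfolding \<C>_def by auto
      from ab(3) bs(3,4) have "A \<subseteq> ball a (r a b)" "B \<subseteq> ball b (r a b)"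
        by (auto simp: times_subset_iff)
      then show ?thesis using bs(1,2) by (intro small[OF ab(1,2)])
    qed
    then have "(\<Sum>A\<in>P. \<Sum>B\<in>Q. E\<^sub>1 A * Z * E\<^sub>2 B) = 0" by simp
    moreover have "(\<Sum>A\<in>P. \<Sum>B\<in>Q. E\<^sub>1 A * Z * E\<^sub>2 B) = (\<Sum>A\<in>P. E\<^sub>1 A) * Z * (\<Sum>B\<in>Q. E\<^sub>2 B)"
      by (simp add: sum_distrib_left sum_distrib_right) (rule sum.swap)
    ultimately show ?thesis
      using one.sum_partition[OF one.borel P(1)] two.sum_partition[OF two.borel Q(1)]
      by (simp add: one.whole two.whole)
  qed
qed

section \<open>Multiplicativity and linearity of the integral\<close>

lemma gdoi_mult:
  assumes an: "bianalytic_on \<beta> D" "bianalytic_on \<gamma> D" and D: "spectrum X\<^sub>1 \<times> spectrum X\<^sub>2 \<subseteq> D"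
    and \<gamma>: "is_gdoi \<gamma> Y U" and \<beta>: "is_gdoi \<beta> U V" and \<beta>\<gamma>: "is_gdoi (\<lambda>p. \<beta> p * \<gamma> p) Y W"
  shows "V = W"
proof -
  have "V - W = 0"
  proof (rule zero_if_locally_zero)
    fix a b assume "a \<in> spectrum X\<^sub>1" "b \<in> spectrum X\<^sub>2"
    then have ab: "(a, b) \<in> D" using D by auto
    obtain r c s d where r: "r > 0" "series_at c a b r \<beta>" and s: "s > 0" "series_at d a b s \<gamma>"
      using bianalytic_on_series_at[OF an(1) ab] bianalytic_on_series_at[OF an(2) ab] by blast
    define t where "t = min r s"
    have t: "0 < t" "series_at c a b t \<beta>" "series_at d a b t \<gamma>"
      using r s by (auto simp: t_def intro: series_at_mono)
    show "\<exists>r>0. \<forall>A B k\<^sub>1 k\<^sub>2.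
      A \<in> borel_subsets (spectrum X\<^sub>1) \<longrightarrow> A \<subseteq> ball a r \<longrightarrow>
      B \<in> borel_subsets (spectrum X\<^sub>2) \<longrightarrow> B \<subseteq> ball b r \<longrightarrow>
      1 \<le> k\<^sub>1 \<longrightarrow> 1 \<le> k\<^sub>2 \<longrightarrow> (\<forall>\<mu>\<in>A. m\<^sub>1 \<mu> = k\<^sub>1) \<longrightarrow> (\<forall>\<nu>\<in>B. m\<^sub>2 \<nu> = k\<^sub>2) \<longrightarrow> E\<^sub>1 A * (V - W) * E\<^sub>2 B = 0"
    \<comment> \<open>Half the common radius of convergence keeps the sets strictly inside the
      region of both expansions.\<close>
    proof (intro exI[of _ "t / 2"] conjI allI impI)
      fix A B k\<^sub>1 k\<^sub>2
      assume *: "A \<in> borel_subsets (spectrum X\<^sub>1)" "A \<subseteq> ball a (t / 2)"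
        "B \<in> borel_subsets (spectrum X\<^sub>2)" "B \<subseteq> ball b (t / 2)"
        "1 \<le> k\<^sub>1" "1 \<le> k\<^sub>2" "\<forall>\<mu>\<in>A. m\<^sub>1 \<mu> = k\<^sub>1" "\<forall>\<nu>\<in>B. m\<^sub>2 \<nu> = k\<^sub>2"
      have "A \<subseteq> cball a (t / 2)" "B \<subseteq> cball b (t / 2)" using * ball_subset_cball by blast+
      then have "E\<^sub>1 A * V * E\<^sub>2 B = E\<^sub>1 A * W * E\<^sub>2 B"
        using * t(1) by (intro gdoi_mult_local[where \<rho> = "t / 2" and r = t, OF _ _ _ _ _ _ _ _ _ _ t(2,3) \<gamma> \<beta> \<beta>\<gamma>]) auto
      then show "E\<^sub>1 A * (V - W) * E\<^sub>2 B = 0" by (simp add: algebra_simps)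
    qed (use t in auto)
  qed
  then show ?thesis by simp
qed

text \<open>Linearity already holds for each Riemann sum whose tags lie in the spectra, where both
  functions are analytic. The existence of the combined integral is part of the conclusion.\<close>

lemma gdoi_lincomb:
  assumes an: "bianalytic_on \<beta> D" "bianalytic_on \<gamma> D" and D: "spectrum X\<^sub>1 \<times> spectrum X\<^sub>2 \<subseteq> D"
    and \<beta>: "is_gdoi \<beta> Y U" and \<gamma>: "is_gdoi \<gamma> Y V"
  shows "is_gdoi (\<lambda>p. u * \<beta> p + v * \<gamma> p) Y (u *\<^sub>C U + v *\<^sub>C V)"
  unfolding has_gdoi_iff
proof
  fix x
  note lim = \<beta>[unfolded has_gdoi_iff, rule_format, of x] \<gamma>[unfolded has_gdoi_iff, rule_format, of x]
  have "((\<lambda>p. u *\<^sub>C app (riemann_sum \<beta> Y p) x + v *\<^sub>C app (riemann_sum \<gamma> Y p) x) \<longlongrightarrow>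
      u *\<^sub>C app U x + v *\<^sub>C app V x) tags"
    by (rule tendsto_add[OF bounded_linear.tendsto[OF bounded_linear_scaleC lim(1)]
          bounded_linear.tendsto[OF bounded_linear_scaleC lim(2)]])
  then show "((\<lambda>p. app (riemann_sum (\<lambda>p. u * \<beta> p + v * \<gamma> p) Y p) x) \<longlongrightarrow>
      app (u *\<^sub>C U + v *\<^sub>C V) x) tags"
    unfolding plus_bop.rep_eq scaleC_bop.rep_eq
  proof (rule Lim_transform_eventually)
    show "\<forall>\<^sub>F p in tags. u *\<^sub>C app (riemann_sum \<beta> Y p) x + v *\<^sub>C app (riemann_sum \<gamma> Y p) x =
        app (riemann_sum (\<lambda>p. u * \<beta> p + v * \<gamma> p) Y p) x"
      using eventually_tags[OF one.eventually_cells two.eventually_cells]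
    proof (rule eventually_mono, elim conjE)
      fix p :: "(complex set set \<times> (complex set \<Rightarrow> complex)) \<times> (complex set set \<times> (complex set \<Rightarrow> complex))"
      assume tags: "\<forall>A\<in>fst (fst p). snd (fst p) A \<in> spectrum X\<^sub>1" "\<forall>B\<in>fst (snd p). snd (snd p) B \<in> spectrum X\<^sub>2"
      have "integrand (\<lambda>p. u * \<beta> p + v * \<gamma> p) Y \<mu> A \<nu> B =
          u *\<^sub>C integrand \<beta> Y \<mu> A \<nu> B + v *\<^sub>C integrand \<gamma> Y \<mu> A \<nu> B"
        if "\<mu> \<in> spectrum X\<^sub>1" "\<nu> \<in> spectrum X\<^sub>2" for \<mu> A \<nu> B
      proof -
        have "(\<mu>, \<nu>) \<in> D" using D that by auto
        note partial_deriv_lincomb[OF an this]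
        then show ?thesis
          unfolding gdoi_integrand_def
          by (simp add: scaleC_sum_right scaleC_scaleC add_divide_distrib scaleC_add_left sum.distrib)
      qed
      then have "riemann_sum (\<lambda>p. u * \<beta> p + v * \<gamma> p) Y p = u *\<^sub>C riemann_sum \<beta> Y p + v *\<^sub>C riemann_sum \<gamma> Y p"
        using tags by (simp add: gdoi_sum_def scaleC_sum_right sum.distrib)
      then show "u *\<^sub>C app (riemann_sum \<beta> Y p) x + v *\<^sub>C app (riemann_sum \<gamma> Y p) x =
          app (riemann_sum (\<lambda>p. u * \<beta> p + v * \<gamma> p) Y p) x"
        by (simp add: plus_bop.rep_eq scaleC_bop.rep_eq)
    qed
  qed
qed

end

theorem lemma2:
  fixes X\<^sub>1 X\<^sub>2 :: "'h::chilbert_space bop"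
    and E\<^sub>1 E\<^sub>2 :: "complex set \<Rightarrow> 'h bop"
    and m\<^sub>1 m\<^sub>2 :: "complex \<Rightarrow> nat"
    and D :: "(complex \<times> complex) set"
  assumes "spectral_decomposition X\<^sub>1 E\<^sub>1 m\<^sub>1"
    and "spectral_decomposition X\<^sub>2 E\<^sub>2 m\<^sub>2"
    and "open D" "connected D" "D \<noteq> {}"
    and "spectrum X\<^sub>1 \<times> spectrum X\<^sub>2 \<subseteq> D"
  shows "(\<forall>\<beta>\<^sub>1 \<beta>\<^sub>2 c\<^sub>1 c\<^sub>2.
            bianalytic_on \<beta>\<^sub>1 D \<and> bianalytic_on \<beta>\<^sub>2 D \<and>
            gdoi_well_defined X\<^sub>1 E\<^sub>1 m\<^sub>1 X\<^sub>2 E\<^sub>2 m\<^sub>2 \<beta>\<^sub>1 \<and>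
            gdoi_well_defined X\<^sub>1 E\<^sub>1 m\<^sub>1 X\<^sub>2 E\<^sub>2 m\<^sub>2 \<beta>\<^sub>2 \<longrightarrow>
            gdoi X\<^sub>1 E\<^sub>1 m\<^sub>1 X\<^sub>2 E\<^sub>2 m\<^sub>2 (\<lambda>p. c\<^sub>1 * \<beta>\<^sub>1 p + c\<^sub>2 * \<beta>\<^sub>2 p) =
              (\<lambda>Y. c\<^sub>1 *\<^sub>C gdoi X\<^sub>1 E\<^sub>1 m\<^sub>1 X\<^sub>2 E\<^sub>2 m\<^sub>2 \<beta>\<^sub>1 Y +
                   c\<^sub>2 *\<^sub>C gdoi X\<^sub>1 E\<^sub>1 m\<^sub>1 X\<^sub>2 E\<^sub>2 m\<^sub>2 \<beta>\<^sub>2 Y)) \<and>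
         (\<forall>\<beta> \<gamma>.
            bianalytic_on \<beta> D \<and> bianalytic_on \<gamma> D \<and>
            gdoi_well_defined X\<^sub>1 E\<^sub>1 m\<^sub>1 X\<^sub>2 E\<^sub>2 m\<^sub>2 \<beta> \<and>
            gdoi_well_defined X\<^sub>1 E\<^sub>1 m\<^sub>1 X\<^sub>2 E\<^sub>2 m\<^sub>2 \<gamma> \<and>
            gdoi_well_defined X\<^sub>1 E\<^sub>1 m\<^sub>1 X\<^sub>2 E\<^sub>2 m\<^sub>2 (\<lambda>p. \<beta> p * \<gamma> p) \<longrightarrow>
            gdoi X\<^sub>1 E\<^sub>1 m\<^sub>1 X\<^sub>2 E\<^sub>2 m\<^sub>2 (\<lambda>p. \<beta> p * \<gamma> p) =
              gdoi X\<^sub>1 E\<^sub>1 m\<^sub>1 X\<^sub>2 E\<^sub>2 m\<^sub>2 \<beta> \<circ> gdoi X\<^sub>1 E\<^sub>1 m\<^sub>1 X\<^sub>2 E\<^sub>2 m\<^sub>2 \<gamma>)"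
proof -
  interpret spectral_dec_pair X\<^sub>1 E\<^sub>1 m\<^sub>1 X\<^sub>2 E\<^sub>2 m\<^sub>2
    by (intro spectral_dec_pair.intro spectral_dec.intro assms(1,2))
  note D = assms(6)
  show ?thesis
  proof (intro conjI allI impI)
    fix \<beta>\<^sub>1 \<beta>\<^sub>2 c\<^sub>1 c\<^sub>2
    assume "bianalytic_on \<beta>\<^sub>1 D \<and> bianalytic_on \<beta>\<^sub>2 D \<and>
      gdoi_well_defined X\<^sub>1 E\<^sub>1 m\<^sub>1 X\<^sub>2 E\<^sub>2 m\<^sub>2 \<beta>\<^sub>1 \<and> gdoi_well_defined X\<^sub>1 E\<^sub>1 m\<^sub>1 X\<^sub>2 E\<^sub>2 m\<^sub>2 \<beta>\<^sub>2"
    then show "gdoi X\<^sub>1 E\<^sub>1 m\<^sub>1 X\<^sub>2 E\<^sub>2 m\<^sub>2 (\<lambda>p. c\<^sub>1 * \<beta>\<^sub>1 p + c\<^sub>2 * \<beta>\<^sub>2 p) =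
        (\<lambda>Y. c\<^sub>1 *\<^sub>C gdoi X\<^sub>1 E\<^sub>1 m\<^sub>1 X\<^sub>2 E\<^sub>2 m\<^sub>2 \<beta>\<^sub>1 Y + c\<^sub>2 *\<^sub>C gdoi X\<^sub>1 E\<^sub>1 m\<^sub>1 X\<^sub>2 E\<^sub>2 m\<^sub>2 \<beta>\<^sub>2 Y)"
      by (intro ext gdoi_eq gdoi_lincomb[OF _ _ D] has_gdoi_gdoi) auto
  next
    fix \<beta> \<gamma>
    assume an: "bianalytic_on \<beta> D \<and> bianalytic_on \<gamma> D \<and>
      gdoi_well_defined X\<^sub>1 E\<^sub>1 m\<^sub>1 X\<^sub>2 E\<^sub>2 m\<^sub>2 \<beta> \<and> gdoi_well_defined X\<^sub>1 E\<^sub>1 m\<^sub>1 X\<^sub>2 E\<^sub>2 m\<^sub>2 \<gamma> \<and>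
      gdoi_well_defined X\<^sub>1 E\<^sub>1 m\<^sub>1 X\<^sub>2 E\<^sub>2 m\<^sub>2 (\<lambda>p. \<beta> p * \<gamma> p)"
    show "gdoi X\<^sub>1 E\<^sub>1 m\<^sub>1 X\<^sub>2 E\<^sub>2 m\<^sub>2 (\<lambda>p. \<beta> p * \<gamma> p) =
        gdoi X\<^sub>1 E\<^sub>1 m\<^sub>1 X\<^sub>2 E\<^sub>2 m\<^sub>2 \<beta> \<circ> gdoi X\<^sub>1 E\<^sub>1 m\<^sub>1 X\<^sub>2 E\<^sub>2 m\<^sub>2 \<gamma>"
    proof
      fix Y
      show "gdoi X\<^sub>1 E\<^sub>1 m\<^sub>1 X\<^sub>2 E\<^sub>2 m\<^sub>2 (\<lambda>p. \<beta> p * \<gamma> p) Y =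
          (gdoi X\<^sub>1 E\<^sub>1 m\<^sub>1 X\<^sub>2 E\<^sub>2 m\<^sub>2 \<beta> \<circ> gdoi X\<^sub>1 E\<^sub>1 m\<^sub>1 X\<^sub>2 E\<^sub>2 m\<^sub>2 \<gamma>) Y"
        \<comment> \<open>The outer integral is taken at the operand produced by the inner one;
          well-definedness at every operand supplies it.\<close>
        unfolding o_apply
        using an has_gdoi_gdoi by (intro gdoi_mult[where \<beta> = \<beta> and \<gamma> = \<gamma>, OF _ _ D, symmetric]) auto
    qed
  qed
qed

end
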